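(* Assume $1 \leq p < \infty$ and $\psi \in L^p(\mathbb{R}^d)$ with $P|\psi| \in L^p_{loc}(\mathbb{R}^d)$ and $\int_{\mathbb{R}^d} \psi \, dx = 1$. Let $\frac1p+\frac1q=1$. Then for all $f \in L^p$, the norm $\|f\|_p$ is equivalent (with constants independent of $f$) to $$N(f) := \inf \left\{ \| c \|_{\ell^1(\ell^p)} : c\in \ell^1(\ell^p),\ f = Sc \right\},$$ where $f=Sc$ is understood with the series $Sc=\sum_{j>0}\sum_{k\in\mathbb{Z}^d} c_{j,k}\psi_{j,k}$ converging in the sense that the sum over $k$ converges pointwise absolutely a.e. to a function in $L^p$ and the sum over $j$ converges absolutely in $L^p$. Explicitly, $$|\det b| \, \| P|\psi| \|_{L^p(b\mathcal{C})}^{-1} \, \| f \|_p \ \leq\ N(f)\ \leq\ |\det b|^{1/q} \| f \|_p .$$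
   Context: Fix $d \in \mathbb{N}$. The dilation matrices $a_j$ ($j=1,2,3,\ldots$) are invertible $d \times d$ real matrices that are expanding: $\|a_j^{-1}\| \to 0$ as $j \to \infty$ (operator norm on $\mathbb{R}^d$). The translation matrix $b$ is an invertible $d \times d$ real matrix. $L^p=L^p(\mathbb{R}^d)$ consists of complex-valued functions. Sums over $j>0$ are over $j=1,2,3,\ldots$; $1/\infty=0$. For $\psi \in L^p$ put $\psi_{j,k}(x) = |\det a_j|^{1/p}\psi(a_j x - bk)$, $x \in \mathbb{R}^d$, $k \in \mathbb{Z}^d$. The synthesis operator is $Sc=\sum_{j>0}\sum_{k\in\mathbb{Z}^d}c_{j,k}\psi_{j,k}$. For sequences $c=\{c_{j,k}\}_{j>0,k\in\mathbb{Z}^d}$ of complex numbers, $\|c\|_{\ell^1(\ell^p)} = \sum_{j>0} \big(\sum_{k\in\mathbb{Z}^d}|c_{j,k}|^p\big)^{1/p}$, and $\ell^1(\ell^p)$ is the Banach space of sequences with finite norm. The periodization of a function $f$ is $Pf(x) = |\det b|\sum_{k\in\mathbb{Z}^d} f(x-bk)$. $\mathcal{C}=[0,1)^d$ and $b\mathcal{C} = \{bx : x\in\mathcal{C}\}$. (The condition $P|\psi|\in L^p_{loc}$ implies $\psi \in L^1$.) *)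

theory Defs
  imports "HOL-Analysis.Analysis"
begin

text \<open>Elements of \<open>L\<^sup>p\<close> are represented by functions; equality in \<open>L\<^sup>p\<close> is equality almost everywhere.\<close>

definition in_Lp :: "real \<Rightarrow> 'a measure \<Rightarrow> ('a \<Rightarrow> 'b::real_normed_vector) \<Rightarrow> bool" where
  "in_Lp p M f \<longleftrightarrow> f \<in> borel_measurable M \<and> integrable M (\<lambda>x. norm (f x) powr p)"

definition Lp_norm :: "real \<Rightarrow> 'a measure \<Rightarrow> ('a \<Rightarrow> 'b::real_normed_vector) \<Rightarrow> real" where
  "Lp_norm p M f = (\<integral>x. norm (f x) powr p \<partial>M) powr (1 / p)"

definition in_Lp_loc :: "real \<Rightarrow> (real^'n \<Rightarrow> 'b::real_normed_vector) \<Rightarrow> bool" where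
  "in_Lp_loc p f \<longleftrightarrow> (\<forall>K. compact K \<longrightarrow> in_Lp p (lebesgue_on K) f)"

definition lattice_vec :: "int^'n \<Rightarrow> real^'n" where
  "lattice_vec k = (\<chi> i. of_int (k $ i))"

text \<open>\<^const>\<open>infsum\<close> is 0 where the series diverges, so statements about the periodization
  of a function should be accompanied by \<open>periodization_converges\<close>.\<close>

definition periodization ::
    "real^'n^'n \<Rightarrow> (real^'n \<Rightarrow> 'b::real_normed_vector) \<Rightarrow> real^'n \<Rightarrow> 'b" where
  "periodization b f x = \<bar>det b\<bar> *\<^sub>R (\<Sum>\<^sub>\<infinity>k\<in>UNIV. f (x - b *v lattice_vec k))"

definition periodization_converges ::
    "real^'n^'n \<Rightarrow> (real^'n \<Rightarrow> 'b::real_normed_vector) \<Rightarrow> bool" where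
  "periodization_converges b f \<longleftrightarrow>
     (AE x in lebesgue. (\<lambda>k. norm (f (x - b *v lattice_vec k))) summable_on UNIV)"

definition unit_cube :: "(real^'n) set" where
  "unit_cube = {x. \<forall>i. 0 \<le> x $ i \<and> x $ i < 1}"

definition expanding :: "(nat \<Rightarrow> real^'n^'n) \<Rightarrow> bool" where
  "expanding a \<longleftrightarrow> (\<lambda>j. onorm (\<lambda>x. matrix_inv (a j) *v x)) \<longlonglongrightarrow> 0"

definition affine_fun ::
    "real \<Rightarrow> (nat \<Rightarrow> real^'n^'n) \<Rightarrow> real^'n^'n \<Rightarrow> (real^'n \<Rightarrow> complex)
      \<Rightarrow> nat \<Rightarrow> int^'n \<Rightarrow> real^'n \<Rightarrow> complex" where
  "affine_fun p a b \<psi> j k x =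
     of_real (\<bar>det (a j)\<bar> powr (1 / p)) * \<psi> (a j *v x - b *v lattice_vec k)"

text \<open>Sequences are indexed by scales \<open>j \<ge> 1\<close>; the entries at \<open>j = 0\<close> are ignored throughout.\<close>

definition in_l1lp :: "real \<Rightarrow> (nat \<Rightarrow> int^'n \<Rightarrow> complex) \<Rightarrow> bool" where
  "in_l1lp p c \<longleftrightarrow>
     (\<forall>j\<ge>1. (\<lambda>k. norm (c j k) powr p) summable_on UNIV) \<and>
     (\<lambda>j. (\<Sum>\<^sub>\<infinity>k\<in>UNIV. norm (c j k) powr p) powr (1 / p)) summable_on {1..}"

definition l1lp_norm :: "real \<Rightarrow> (nat \<Rightarrow> int^'n \<Rightarrow> complex) \<Rightarrow> real" where
  "l1lp_norm p c = (\<Sum>\<^sub>\<infinity>j\<in>{1..}. (\<Sum>\<^sub>\<infinity>k\<in>UNIV. norm (c j k) powr p) powr (1 / p))"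

definition synthesis_scale ::
    "real \<Rightarrow> (nat \<Rightarrow> real^'n^'n) \<Rightarrow> real^'n^'n \<Rightarrow> (real^'n \<Rightarrow> complex)
      \<Rightarrow> (nat \<Rightarrow> int^'n \<Rightarrow> complex) \<Rightarrow> nat \<Rightarrow> real^'n \<Rightarrow> complex" where
  "synthesis_scale p a b \<psi> c j x = (\<Sum>\<^sub>\<infinity>k\<in>UNIV. c j k * affine_fun p a b \<psi> j k x)"

text \<open>\<open>synthesizes p a b \<psi> c f\<close> is \<open>f = Sc\<close>: at each scale the sum over \<open>k\<close> converges absolutely
  a.e. to a function in \<open>L\<^sup>p\<close>, and the sum over \<open>j\<close> converges absolutely in \<open>L\<^sup>p\<close>, to \<open>f\<close>.\<close>

definition synthesizes ::
    "real \<Rightarrow> (nat \<Rightarrow> real^'n^'n) \<Rightarrow> real^'n^'n \<Rightarrow> (real^'n \<Rightarrow> complex)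
      \<Rightarrow> (nat \<Rightarrow> int^'n \<Rightarrow> complex) \<Rightarrow> (real^'n \<Rightarrow> complex) \<Rightarrow> bool" where
  "synthesizes p a b \<psi> c f \<longleftrightarrow>
     (\<forall>j\<ge>1. (AE x in lebesgue. (\<lambda>k. norm (c j k * affine_fun p a b \<psi> j k x)) summable_on UNIV) \<and>
             in_Lp p lebesgue (synthesis_scale p a b \<psi> c j)) \<and>
     (\<lambda>j. Lp_norm p lebesgue (synthesis_scale p a b \<psi> c j)) summable_on {1..} \<and>
     (\<lambda>J. Lp_norm p lebesgue (\<lambda>x. f x - (\<Sum>j=1..J. synthesis_scale p a b \<psi> c j x))) \<longlonglongrightarrow> 0"

text \<open>Valued in \<^typ>\<open>ennreal\<close> so that the infimum is \<open>\<infinity>\<close> when \<open>f\<close> has no representation.\<close>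

definition synthesis_norm ::
    "real \<Rightarrow> (nat \<Rightarrow> real^'n^'n) \<Rightarrow> real^'n^'n \<Rightarrow> (real^'n \<Rightarrow> complex)
      \<Rightarrow> (real^'n \<Rightarrow> complex) \<Rightarrow> ennreal" where
  "synthesis_norm p a b \<psi> f =
     Inf {ennreal (l1lp_norm p c) | c. in_l1lp p c \<and> synthesizes p a b \<psi> c f}"

end

theory Submission
  imports Defs
begin

text \<open>
  The lower bound is \<open>L\<^sup>p\<close>-boundedness of synthesis: at a single scale, Jensen's inequality with the
  weights \<open>\<bar>\<psi>(x - bk)\<bar>\<close>, followed by a tiling of space by the translates of \<open>b\<C>\<close>, bounds
  \<open>\<parallel>\<Sum>\<^sub>k c\<^sub>k \<psi>\<^sub>j\<^sub>,\<^sub>k\<parallel>\<^sub>p\<close> by \<open>\<bar>det b\<bar>\<^sup>-\<^sup>1 \<parallel>P\<bar>\<psi>\<bar>\<parallel>\<close> times the \<open>\<ell>\<^sup>p\<close> norm of \<open>c\<close>.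

  For the upper bound, let \<open>f\<close> be continuous with compact support. Synthesis at a fine scale \<open>j\<close> of
  the normalized samples of \<open>f\<close> on the lattice \<open>a\<^sub>j\<^sup>-\<^sup>1 b \<int>\<^sup>d\<close> is close to \<open>f(x) P\<psi>(a\<^sub>j x)\<close>, and the
  \<open>\<ell>\<^sup>p\<close> norm of the samples is close to \<open>\<bar>det b\<bar>\<^sup>1\<^sup>/\<^sup>q \<parallel>f\<parallel>\<^sub>p\<close>. The function \<open>P\<psi> - 1\<close> has mean zero over a
  period, so its dilates tend weakly to 0. Instead of appealing to Mazur's theorem, one averages over
  scales that are chosen inductively to be almost orthogonal: after truncating \<open>\<psi>\<close> to make \<open>P\<psi>\<close>
  bounded, the averages tend to 0 in \<open>L\<^sup>2\<close> and hence in \<open>L\<^sup>p\<close>. Averaging does not increase the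
  \<open>\<ell>\<^sup>1(\<ell>\<^sup>p)\<close> norm. Thus every \<open>f\<close> in \<open>L\<^sup>p\<close> is approximated, at arbitrarily fine scales, by
  syntheses with nearly the optimal norm; applying this repeatedly to the remainders gives \<open>f = Sc\<close>.
\<close>

subsection \<open>Linear changes of variables\<close>

text \<open>The hypothesis controls P|\<psi>| in L^p over a tile and no better, so for p < 2 the
  oscillation of P\<psi> need not be square integrable, and orthogonality cannot be applied to it
  directly. This is why the generator is cut along a sublevel set of its lattice sum: the sublevel
  set is invariant under the lattice, so the lattice sum of the truncation is bounded at every
  point. What is cut away is charged to the one-scale estimate behind the lower bound, which is
  therefore proved for a general generator. The price is that the truncated generator has integral
  only close to 1.

  Arbitrarily fine scales matter twice. They make the samples accurate, and they let each remainder
  be synthesized on scales that no earlier round has used, so that the coefficient norms of the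
  rounds add. Each round costs |det b|^(1/q) times the norm of the current remainder, which is small
  after the initial round; hence the total exceeds |det b|^(1/q) times the norm of f by as little as
  desired.\<close>

lemma det_shear:
  fixes m n :: "'n::finite"
  assumes "m \<noteq> n"
  shows "det (matrix (\<lambda>x::real^'n. \<chi> i. if i = m then x$m + x$n else x$i)) = 1"
proof -
  let ?h = "\<lambda>x::real^'n. \<chi> i. if i = m then x$m + x$n else x$i"
  have "matrix ?h = (\<chi> k. if k = m then row m (mat 1) + 1 *s row n (mat 1) else row k (mat 1))"
    using assms by (auto simp: matrix_def mat_def row_def axis_def vec_eq_iff)
  then show ?thesis
    using det_row_operation[OF assms, of "mat 1 :: real^'n^'n" 1] by (simp add: det_I)
qed

text \<open>The library version \<open>measure_linear_image\<close> needs a wellordered index type.\<close>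

lemma measure_linear_image_finite:
  fixes f :: "real^'n \<Rightarrow> real^'n"
  assumes "linear f" "S \<in> lmeasurable"
  shows "f ` S \<in> lmeasurable \<and> measure lebesgue (f ` S) = \<bar>det (matrix f)\<bar> * measure lebesgue S"
proof -
  have "\<forall>S\<in>lmeasurable. f ` S \<in> lmeasurable \<and>
      measure lebesgue (f ` S) = \<bar>det (matrix f)\<bar> * measure lebesgue S"
  proof (rule induct_linear_elementary[OF \<open>linear f\<close>, where
        P = "\<lambda>f. \<forall>S\<in>lmeasurable. f ` S \<in> lmeasurable \<and>
          measure lebesgue (f ` S) = \<bar>det (matrix f)\<bar> * measure lebesgue S"]; intro ballI)
    fix f g :: "real^'n \<Rightarrow> real^'n" and S :: "(real^'n) set"
    assume *: "linear f" "linear g" "S \<in> lmeasurable"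
      "\<forall>S\<in>lmeasurable. f ` S \<in> lmeasurable \<and>
          measure lebesgue (f ` S) = \<bar>det (matrix f)\<bar> * measure lebesgue S"
      "\<forall>S\<in>lmeasurable. g ` S \<in> lmeasurable \<and>
          measure lebesgue (g ` S) = \<bar>det (matrix g)\<bar> * measure lebesgue S"
    then show "(f \<circ> g) ` S \<in> lmeasurable \<and>
          measure lebesgue ((f \<circ> g) ` S) = \<bar>det (matrix (f \<circ> g))\<bar> * measure lebesgue S"
      by (simp add: image_comp[symmetric] matrix_compose det_mul abs_mult del: o_apply)
  next
    fix f :: "real^'n \<Rightarrow> real^'n" and i and S :: "(real^'n) set"
    assume f: "linear f" "\<And>x. f x $ i = 0" and "S \<in> lmeasurable"
    have "\<not> surj f"
    proof
      assume "surj f"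
      then obtain x where "f x = axis i 1" by (metis surjD)
      with f(2)[of x] show False by simp
    qed
    then have ninj: "\<not> inj f"
      using f(1) linear_injective_imp_surjective by blast
    then have "negligible (f ` S)"
      using f(1) negligible_linear_singular_image by blast
    moreover have "det (matrix f) = 0"
      using ninj det_nz_iff_inj[OF f(1)] by blast
    ultimately show "f ` S \<in> lmeasurable \<and>
        measure lebesgue (f ` S) = \<bar>det (matrix f)\<bar> * measure lebesgue S"
      by (simp add: negligible_iff_measure)
  next
    fix c :: "'n \<Rightarrow> real" and S :: "(real^'n) set"
    assume S: "S \<in> lmeasurable"
    have "det (matrix (\<lambda>x. \<chi> i. c i * x $ i)) = prod c UNIV"
      by (subst det_diagonal) (auto simp: matrix_def axis_def)
    then show "(\<lambda>x. \<chi> i. c i * x $ i) ` S \<in> lmeasurable \<and>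
        measure lebesgue ((\<lambda>x. \<chi> i. c i * x $ i) ` S) =
        \<bar>det (matrix (\<lambda>x. \<chi> i. c i * x $ i))\<bar> * measure lebesgue S"
      using measurable_stretch[OF S] measure_stretch[OF S] by simp
  next
    fix m n :: 'n and S :: "(real^'n) set"
    assume "m \<noteq> n" and S: "S \<in> lmeasurable"
    let ?t = "Transposition.transpose m n"
    let ?h = "\<lambda>x::real^'n. \<chi> i. x $ ?t i"
    have lin: "linear ?h"
      by (rule linearI) (simp_all add: plus_vec_def scaleR_vec_def)
    have "matrix ?h = (\<chi> i. (mat 1 :: real^'n^'n) $ ?t i)"
      by (auto simp: matrix_def mat_def axis_def vec_eq_iff)
    then have det: "\<bar>det (matrix ?h)\<bar> = 1"
      by (simp add: det_permute_rows permutes_swap_id sign_swap_id det_I abs_mult)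
    have im: "?h ` cbox a b = cbox (?h a) (?h b)" for a b
    proof (intro equalityI subsetI)
      fix y assume "y \<in> cbox (?h a) (?h b)"
      then have "?h y \<in> cbox a b"
        unfolding mem_box_cart by (simp; metis transpose_involutory)
      moreover have "y = ?h (?h y)" by (simp add: vec_eq_iff)
      ultimately show "y \<in> ?h ` cbox a b" by blast
    qed (auto simp: mem_box_cart)
    have "measure lebesgue (?h ` cbox a b) = 1 * measure lebesgue (cbox a b)" for a b
    proof (cases "cbox a b = {}")
      case False
      then have "cbox (?h a) (?h b) \<noteq> {}" using im by blast
      with False show ?thesis
        using prod.permute[OF permutes_swap_id, where S=UNIV and g="\<lambda>i. (b - a)$i", of m n, symmetric]
        by (simp add: im content_cbox_cart o_def)
    qed simp
    from measure_linear_sufficient[OF lin S this]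
    show "?h ` S \<in> lmeasurable \<and>
        measure lebesgue (?h ` S) = \<bar>det (matrix ?h)\<bar> * measure lebesgue S"
      using det by simp
  next
    fix m n :: 'n and S :: "(real^'n) set"
    assume mn: "m \<noteq> n" and S: "S \<in> lmeasurable"
    let ?h = "\<lambda>x::real^'n. \<chi> i. if i = m then x$m + x$n else x$i"
    have lin: "linear ?h"
      by (rule linearI) (auto simp: vec_eq_iff algebra_simps)
    have "measure lebesgue (?h ` cbox a b) = 1 * measure lebesgue (cbox a b)" for a b
    proof (cases "cbox a b = {}")
      case False
      \<comment> \<open>\<open>measure_shear_interval\<close> wants a nonnegative lower bound in
        coordinate \<open>n\<close>. Translating by \<open>v\<close> makes this bound 0, and by
        linearity the shear turns a translation into a translation.\<close>
      define v :: "real^'n" where "v = axis n (a $ n)"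
      have cb: "cbox a b = (+) v ` cbox (a - v) (b - v)"
        by (simp add: cbox_translation[symmetric])
      have "measure lebesgue (?h ` cbox a b) = measure lebesgue ((+) (?h v) ` ?h ` cbox (a - v) (b - v))"
        unfolding cb image_image by (simp only: linear_add[OF lin])
      also have "\<dots> = measure lebesgue (?h ` cbox (a - v) (b - v))"
        by (rule measure_translation)
      also have "\<dots> = measure lebesgue (cbox (a - v) (b - v))"
        using mn False cb by (intro measure_shear_interval) (auto simp: v_def)
      also have "\<dots> = measure lebesgue (cbox a b)"
        unfolding cb by (rule measure_translation[symmetric])
      finally show ?thesis by simp
    qed simp
    from measure_linear_sufficient[OF lin S this]
    show "?h ` S \<in> lmeasurable \<and>
        measure lebesgue (?h ` S) = \<bar>det (matrix ?h)\<bar> * measure lebesgue S"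
      using det_shear[OF mn] by simp
  qed
  with assms(2) show ?thesis by blast
qed

text \<open>Phrased as an identity of measures, the change of variables transfers at once to
  nonnegative integrals, integrability, Bochner integrals and almost-everywhere statements.\<close>

lemma
  fixes A :: "real^'n^'n" and t :: "real^'n"
  assumes "invertible A"
  shows measurable_affine_lebesgue: "(\<lambda>x. A *v x + t) \<in> lebesgue \<rightarrow>\<^sub>M lebesgue"
    and lebesgue_affine_matrix:
      "lebesgue = density (distr lebesgue lebesgue (\<lambda>x. A *v x + t)) (\<lambda>_. ennreal \<bar>det A\<bar>)"
proof -
  let ?T = "\<lambda>x. A *v x + t"
  obtain B where AB: "A ** B = mat 1" "B ** A = mat 1"
    using assms by (auto simp: invertible_def)
  let ?U = "\<lambda>x. B *v (x - t)"
  have UT: "?U (?T x) = x" "?T (?U x) = x" for x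
    by (simp_all add: matrix_vector_mul_assoc AB)
  \<comment> \<open>Preimages under the map are images under the inverse affine map, so facts about
    measurability and measure of images apply to them.\<close>
  have vim: "?T -` S = ?U ` S" for S
  proof (intro equalityI subsetI)
    fix x assume "x \<in> ?T -` S"
    then show "x \<in> ?U ` S" by (intro image_eqI[where x="?T x"]) (simp_all only: UT vimage_eq)
  next
    fix x assume "x \<in> ?U ` S"
    then obtain y where "y \<in> S" "x = ?U y" by blast
    then show "x \<in> ?T -` S" by (simp only: UT vimage_eq)
  qed
  have meas: "?T -` S \<in> sets lebesgue" if "S \<in> sets lebesgue" for S
  proof -
    have "(\<lambda>x. B *v x - B *v t) differentiable_on S"
      using differentiable_on_diff[OF linear_imp_differentiable_on[OF matrix_vector_mul_linear]
          differentiable_on_const] .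
    from differentiable_image_in_sets_lebesgue[OF that order_refl this]
    show ?thesis
      unfolding vim matrix_vector_mult_diff_distrib .
  qed
  then show mT: "?T \<in> lebesgue \<rightarrow>\<^sub>M lebesgue"
    by (intro measurableI) (simp_all only: space_completion space_lborel space_borel Int_UNIV_right UNIV_I)
  have det: "\<bar>det A\<bar> > 0"
    using assms by (simp add: invertible_det_nz)
  have aff: "(\<lambda>x. M *v x + s) ` S \<in> lmeasurable \<and>
      measure lebesgue ((\<lambda>x. M *v x + s) ` S) = \<bar>det M\<bar> * measure lebesgue S"
    if "S \<in> lmeasurable" for S and M :: "real^'n^'n" and s
  proof -
    have im: "(\<lambda>x. M *v x + s) ` S = (+) s ` (*v) M ` S"
      unfolding image_image by (simp only: add.commute)
    show ?thesis
      using measure_linear_image_finite[of "(*v) M" S] that measurable_translation[of "(*v) M ` S" s]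
      unfolding im measure_translation
      by (simp add: matrix_vector_mul_linear)
  qed
  have lm: "?T ` S \<in> lmeasurable \<and> measure lebesgue (?T ` S) = \<bar>det A\<bar> * measure lebesgue S"
    if "S \<in> lmeasurable" for S
    using aff[OF that] .
  have lm': "?T -` S \<in> lmeasurable" if "S \<in> lmeasurable" for S
    using aff[OF that, of B "- (B *v t)"]
    unfolding vim matrix_vector_mult_diff_distrib by simp
  show "lebesgue = density (distr lebesgue lebesgue ?T) (\<lambda>_. ennreal \<bar>det A\<bar>)"
  proof (rule measure_eqI)
    fix S :: "(real^'n) set" assume S: "S \<in> sets lebesgue"
    have TS: "?T ` (?T -` S) = S"
      unfolding vim image_image UT by simp
    have "emeasure lebesgue S = ennreal \<bar>det A\<bar> * emeasure lebesgue (?T -` S)"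
    proof (cases "?T -` S \<in> lmeasurable")
      case True
      then have "S \<in> lmeasurable" "measure lebesgue S = \<bar>det A\<bar> * measure lebesgue (?T -` S)"
        using lm[OF True] unfolding TS by auto
      then show ?thesis
        using True by (simp only: emeasure_eq_measure2 ennreal_mult measure_nonneg abs_ge_zero)
    next
      \<comment> \<open>By \<open>lm\<close> and \<open>lm'\<close> a set has finite measure exactly
        when its preimage has, so here both sides are infinite.\<close>
      case False
      then have "S \<notin> lmeasurable" using lm' by blast
      then have "emeasure lebesgue S = \<infinity>" "emeasure lebesgue (?T -` S) = \<infinity>"
        using False S meas[OF S] by (auto simp: fmeasurable_def less_top[symmetric])
      then show ?thesis using det by (simp add: ennreal_mult_top)
    qed
    moreover have "emeasure (density (distr lebesgue lebesgue ?T) (\<lambda>_. ennreal \<bar>det A\<bar>)) S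
        = ennreal \<bar>det A\<bar> * emeasure (distr lebesgue lebesgue ?T) S"
      using S by (intro emeasure_density_const) simp
    moreover have "emeasure (distr lebesgue lebesgue ?T) S = emeasure lebesgue (?T -` S)"
      using emeasure_distr[OF mT S] by (simp only: space_completion space_lborel space_borel Int_UNIV_right)
    ultimately show "emeasure lebesgue S = emeasure (density (distr lebesgue lebesgue ?T) (\<lambda>_. ennreal \<bar>det A\<bar>)) S"
      by (simp only:)
  qed simp
qed

lemma nn_integral_affine_matrix:
  fixes A :: "real^'n^'n"
  assumes "invertible A" "f \<in> borel_measurable lebesgue"
  shows "(\<integral>\<^sup>+x. f x \<partial>lebesgue) = ennreal \<bar>det A\<bar> * (\<integral>\<^sup>+x. f (A *v x + t) \<partial>lebesgue)"
  using assms measurable_affine_lebesgue[OF assms(1), of t]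
  by (subst lebesgue_affine_matrix[OF assms(1), of t])
     (simp add: nn_integral_density nn_integral_distr nn_integral_cmult)

lemma integrable_affine_matrix:
  fixes A :: "real^'n^'n" and f :: "_ \<Rightarrow> 'b::{banach, second_countable_topology}"
  assumes "invertible A" "f \<in> borel_measurable lebesgue"
  shows "integrable lebesgue (\<lambda>x. f (A *v x + t)) \<longleftrightarrow> integrable lebesgue f"
proof -
  have "integrable lebesgue f \<longleftrightarrow>
      integrable (density (distr lebesgue lebesgue (\<lambda>x. A *v x + t)) (\<lambda>_. ennreal \<bar>det A\<bar>)) f"
    using lebesgue_affine_matrix[OF assms(1), of t] by simp
  also have "\<dots> \<longleftrightarrow> integrable lebesgue (\<lambda>x. \<bar>det A\<bar> *\<^sub>R f (A *v x + t))"
    using assms measurable_affine_lebesgue[OF assms(1), of t]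
    by (subst integrable_density) (auto simp: integrable_distr_eq)
  also have "\<dots> \<longleftrightarrow> integrable lebesgue (\<lambda>x. f (A *v x + t))"
  proof
    assume "integrable lebesgue (\<lambda>x. \<bar>det A\<bar> *\<^sub>R f (A *v x + t))"
    from integrable_scaleR_right[OF this, of "inverse \<bar>det A\<bar>"]
    show "integrable lebesgue (\<lambda>x. f (A *v x + t))"
      using assms(1) by (simp add: invertible_det_nz)
  qed simp
  finally show ?thesis by simp
qed

lemma integral_affine_matrix:
  fixes A :: "real^'n^'n" and f :: "_ \<Rightarrow> 'b::{banach, second_countable_topology}"
  assumes "invertible A" "f \<in> borel_measurable lebesgue"
  shows "(\<integral>x. f x \<partial>lebesgue) = \<bar>det A\<bar> *\<^sub>R (\<integral>x. f (A *v x + t) \<partial>lebesgue)"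
  using assms measurable_affine_lebesgue[OF assms(1), of t]
  by (subst lebesgue_affine_matrix[OF assms(1), of t])
     (simp add: integral_density integral_distr)

lemma AE_affine_matrix:
  fixes A :: "real^'n^'n"
  assumes "invertible A" "AE x in lebesgue. P x"
  shows "AE x in lebesgue. P (A *v x + t)"
proof -
  have "AE x in density (distr lebesgue lebesgue (\<lambda>x. A *v x + t)) (\<lambda>_. ennreal \<bar>det A\<bar>). P x"
    using assms(2) arg_cong[OF lebesgue_affine_matrix[OF assms(1), of t], of "\<lambda>M. AE x in M. P x"]
    by blast
  then have "AE x in distr lebesgue lebesgue (\<lambda>x. A *v x + t). P x"
    using assms(1) by (subst (asm) AE_density) (auto simp: invertible_det_nz)
  then show ?thesis
    using AE_distrD[OF measurable_affine_lebesgue[OF assms(1)]] by blast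
qed

subsection \<open>Functions in \<open>L\<^sup>p\<close>\<close>

text \<open>The common source of the convexity inequalities below: the power function lies above its
  tangent at \<open>s\<close>. The case \<open>g = 0\<close> is separate because the convexity
  argument lives on the open half-line.\<close>

lemma powr_above_tangent:
  fixes g s p :: real
  assumes "1 \<le> p" "0 \<le> g" "0 < s"
  shows "s powr p + p * s powr (p - 1) * (g - s) \<le> g powr p"
proof (cases "g = 0")
  case True
  have "s powr (p - 1) * s = s powr p"
    using powr_mult_base[of s "p - 1"] assms by (simp add: mult.commute)
  then have "s powr p + p * s powr (p - 1) * (g - s) = (1 - p) * s powr p"
    using True by (simp add: algebra_simps)
  also have "\<dots> \<le> 0"
    using assms by (simp add: mult_nonpos_nonneg)
  finally show ?thesis using True by simp
next
  case False
  have "g powr p - s powr p \<ge> (p * s powr (p - 1)) * (g - s)"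
  proof (rule convex_on_imp_above_tangent[where A="{0<..}"])
    show "convex_on {0<..} (\<lambda>x. x powr p)" using assms by (intro powr_convex)
    show "((\<lambda>x. x powr p) has_real_derivative p * s powr (p - 1)) (at s within {0<..})"
      using assms by (auto intro!: derivative_eq_intros)
  qed (use assms False in \<open>auto simp: interior_open\<close>)
  then show ?thesis by simp
qed

text \<open>Jensen's inequality for the measure with density \<open>w\<close>, not normalized to
  mass 1. The tangent is taken at the weighted mean \<open>s\<close> of \<open>g\<close>, so that
  its linear part integrates to 0. It is applied to counting measure on the lattice.\<close>

lemma integral_powr_le_weighted:
  fixes g w :: "'a \<Rightarrow> real"
  assumes p: "1 \<le> p" and nn: "\<And>x. 0 \<le> g x" "\<And>x. 0 \<le> w x"
    and int: "integrable M w" "integrable M (\<lambda>x. g x * w x)" "integrable M (\<lambda>x. g x powr p * w x)"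
  shows "(\<integral>x. g x * w x \<partial>M) powr p \<le> (\<integral>x. w x \<partial>M) powr (p - 1) * (\<integral>x. g x powr p * w x \<partial>M)"
proof -
  define W where "W = (\<integral>x. w x \<partial>M)"
  define s where "s = (\<integral>x. g x * w x \<partial>M) / W"
  have W0: "0 \<le> W" unfolding W_def using nn by simp
  have I0: "0 \<le> (\<integral>x. g x * w x \<partial>M)" using nn by simp
  have R0: "0 \<le> W powr (p - 1) * (\<integral>x. g x powr p * w x \<partial>M)" using nn by simp
  show ?thesis
  proof (cases "(\<integral>x. g x * w x \<partial>M) = 0")
    case True then show ?thesis using R0 p by (simp add: W_def)
  next
    case False
    have "W \<noteq> 0"
    proof
      assume "W = 0"
      then have "AE x in M. w x = 0"
        using integral_nonneg_eq_0_iff_AE[OF int(1)] nn by (simp add: W_def)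
      then have "AE x in M. g x * w x = 0" by eventually_elim simp
      then have "(\<integral>x. g x * w x \<partial>M) = 0" by (rule integral_eq_zero_AE)
      with False show False by simp
    qed
    with W0 have W: "W > 0" by simp
    with False I0 have s: "s > 0" by (simp add: s_def)
    have "s powr p * W = (\<integral>x. s powr p * w x + p * s powr (p - 1) * (g x * w x - s * w x) \<partial>M)"
      using int W by (simp add: s_def W_def)
    also have "\<dots> \<le> (\<integral>x. g x powr p * w x \<partial>M)"
    proof (rule integral_mono)
      fix x
      have "(s powr p + p * s powr (p - 1) * (g x - s)) * w x \<le> g x powr p * w x"
        using p nn s by (intro mult_right_mono powr_above_tangent) auto
      then show "s powr p * w x + p * s powr (p - 1) * (g x * w x - s * w x) \<le> g x powr p * w x"
        by (simp add: algebra_simps)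
    qed (use int in auto)
    finally have "W powr (p - 1) * (s powr p * W) \<le> W powr (p - 1) * (\<integral>x. g x powr p * w x \<partial>M)"
      by (rule mult_left_mono) simp
    moreover have "W powr (p - 1) * (s powr p * W) = (s * W) powr p"
      using W s by (simp add: powr_mult powr_mult_base mult.commute mult.left_commute)
    moreover have "s * W = (\<integral>x. g x * w x \<partial>M)" using W by (simp add: s_def)
    ultimately show ?thesis by (simp add: W_def)
  qed
qed

lemma powr_convex_combination:
  fixes a b \<alpha> \<beta> p :: real
  assumes "1 \<le> p" "0 \<le> a" "0 \<le> b" "0 \<le> \<alpha>" "0 \<le> \<beta>" "\<alpha> + \<beta> = 1"
  shows "(\<alpha> * a + \<beta> * b) powr p \<le> \<alpha> * a powr p + \<beta> * b powr p"
proof (cases "\<alpha> * a + \<beta> * b = 0")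
  case True
  then show ?thesis using assms by simp
next
  case False
  define s where "s = \<alpha> * a + \<beta> * b"
  have s: "0 < s" using False assms by (simp add: s_def less_le)
  have \<beta>: "\<beta> = 1 - \<alpha>" using assms by simp
  have "\<alpha> * (s powr p + p * s powr (p - 1) * (a - s)) + \<beta> * (s powr p + p * s powr (p - 1) * (b - s))
      \<le> \<alpha> * a powr p + \<beta> * b powr p"
    using assms s by (intro add_mono mult_left_mono powr_above_tangent) auto
  moreover have "\<alpha> * (s powr p + p * s powr (p - 1) * (a - s)) + \<beta> * (s powr p + p * s powr (p - 1) * (b - s))
      = s powr p + p * s powr (p - 1) * (\<alpha> * a + \<beta> * b - s)"
    unfolding \<beta> by (simp add: algebra_simps)
  ultimately show ?thesis by (simp add: s_def)
qed

lemma powr_add_le: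
  fixes a b p :: real
  assumes "1 \<le> p" "0 \<le> a" "0 \<le> b"
  shows "(a + b) powr p \<le> 2 powr p * (a powr p + b powr p)"
proof -
  have "((1/2) * a + (1/2) * b) powr p \<le> (1/2) * a powr p + (1/2) * b powr p"
    using assms by (intro powr_convex_combination) auto
  also have "\<dots> \<le> a powr p + b powr p" using powr_ge_zero[of a p] powr_ge_zero[of b p] by linarith
  finally have *: "((a + b) / 2) powr p \<le> a powr p + b powr p" by (simp add: field_simps)
  have "(a + b) powr p = 2 powr p * ((a + b) / 2) powr p"
    using powr_mult[of 2 "(a + b) / 2" p] assms by (simp del: distrib_left_numeral)
  with * show ?thesis by simp
qed

lemma Lp_norm_nonneg [simp]: "0 \<le> Lp_norm p M f"
  by (simp add: Lp_norm_def)

lemma Lp_norm_powr: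
  assumes "1 \<le> p"
  shows "Lp_norm p M f powr p = (\<integral>x. norm (f x) powr p \<partial>M)"
  using assms by (simp add: Lp_norm_def powr_powr)

lemma Lp_norm_le_iff:
  assumes "1 \<le> p" "0 \<le> C"
  shows "Lp_norm p M f \<le> C \<longleftrightarrow> (\<integral>x. norm (f x) powr p \<partial>M) \<le> C powr p"
proof -
  have "Lp_norm p M f \<le> C \<longleftrightarrow> Lp_norm p M f powr p \<le> C powr p"
  proof
    assume "Lp_norm p M f powr p \<le> C powr p"
    then show "Lp_norm p M f \<le> C"
      using assms powr_less_mono2[of p C "Lp_norm p M f"] by fastforce
  qed (use assms in \<open>auto intro!: powr_mono2\<close>)
  then show ?thesis using assms by (simp add: Lp_norm_powr)
qed

lemma Lp_norm_cong_AE: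
  assumes "f \<in> borel_measurable M" "g \<in> borel_measurable M" "AE x in M. f x = g x"
  shows "Lp_norm p M f = Lp_norm p M g"
proof -
  have "(\<integral>x. norm (f x) powr p \<partial>M) = (\<integral>x. norm (g x) powr p \<partial>M)"
    using assms by (intro integral_cong_AE) auto
  then show ?thesis by (simp add: Lp_norm_def)
qed

lemma in_Lp_bound:
  assumes "g \<in> borel_measurable M" "in_Lp p M f" "AE x in M. norm (g x) \<le> norm (f x)" "1 \<le> p"
  shows "in_Lp p M g"
proof -
  have le: "AE x in M. norm (g x) powr p \<le> norm (f x) powr p"
    using assms(3) by eventually_elim (use assms(4) in \<open>auto intro!: powr_mono2\<close>)
  have f: "integrable M (\<lambda>x. norm (f x) powr p)" using assms(2) by (simp add: in_Lp_def)
  have "integrable M (\<lambda>x. norm (g x) powr p)"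
    by (rule Bochner_Integration.integrable_bound[OF f]) (use assms(1) le in auto)
  then show ?thesis using assms(1) by (simp add: in_Lp_def)
qed

context
  fixes p :: real and M :: "'a measure" and f g :: "'a \<Rightarrow> 'b::{real_normed_vector, second_countable_topology}"
  assumes p: "1 \<le> p" and f: "in_Lp p M f" and g: "in_Lp p M g"
begin

lemma in_Lp_add: "in_Lp p M (\<lambda>x. f x + g x)"
proof -
  have [measurable]: "f \<in> borel_measurable M" "g \<in> borel_measurable M"
    using f g by (auto simp: in_Lp_def)
  have i: "integrable M (\<lambda>x. 2 powr p * (norm (f x) powr p + norm (g x) powr p))"
    using f g by (auto simp: in_Lp_def)
  have "norm (f x + g x) powr p \<le> 2 powr p * (norm (f x) powr p + norm (g x) powr p)" for x
  proof -
    have "norm (f x + g x) powr p \<le> (norm (f x) + norm (g x)) powr p"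
      using p by (intro powr_mono2 norm_triangle_ineq) auto
    also have "\<dots> \<le> 2 powr p * (norm (f x) powr p + norm (g x) powr p)"
      using p by (intro powr_add_le) auto
    finally show ?thesis .
  qed
  then have "integrable M (\<lambda>x. norm (f x + g x) powr p)"
    by (intro Bochner_Integration.integrable_bound[OF i]) auto
  then show ?thesis by (simp add: in_Lp_def)
qed

text \<open>Minkowski's inequality without Hoelder: after scaling, \<open>f + g\<close> is
  \<open>s\<close> times a convex combination of two functions of norm 1, and convexity of the power
  is integrated. Zero norms are set apart because of the division.\<close>

lemma Lp_norm_triangle: "Lp_norm p M (\<lambda>x. f x + g x) \<le> Lp_norm p M f + Lp_norm p M g"
proof -
  have [measurable]: "f \<in> borel_measurable M" "g \<in> borel_measurable M"
    using f g by (auto simp: in_Lp_def)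
  have fi: "integrable M (\<lambda>x. norm (f x) powr p)" and gi: "integrable M (\<lambda>x. norm (g x) powr p)"
    using f g by (auto simp: in_Lp_def)
  define \<alpha> where "\<alpha> = Lp_norm p M f"
  define \<beta> where "\<beta> = Lp_norm p M g"
  have zero: "AE x in M. h x = 0" if "Lp_norm p M h = 0" "integrable M (\<lambda>x. norm (h x) powr p)"
    for h :: "'a \<Rightarrow> 'b"
  proof -
    have "(\<integral>x. norm (h x) powr p \<partial>M) = 0"
      using that(1) p by (simp add: Lp_norm_def)
    then have "AE x in M. norm (h x) powr p = 0"
      using integral_nonneg_eq_0_iff_AE[OF that(2)] by simp
    then show ?thesis by eventually_elim simp
  qed
  have nn: "\<alpha> \<ge> 0" "\<beta> \<ge> 0" by (auto simp: \<alpha>_def \<beta>_def)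
  consider "\<alpha> = 0" | "\<beta> = 0" | "\<alpha> > 0" "\<beta> > 0" using nn by linarith
  then show ?thesis
  proof cases
    case 1
    then have "AE x in M. f x + g x = g x"
      using zero[OF _ fi] by (simp add: \<alpha>_def)
    then have "Lp_norm p M (\<lambda>x. f x + g x) = Lp_norm p M g" by (intro Lp_norm_cong_AE) auto
    then show ?thesis by simp
  next
    case 2
    then have "AE x in M. f x + g x = f x"
      using zero[OF _ gi] by (simp add: \<beta>_def)
    then have "Lp_norm p M (\<lambda>x. f x + g x) = Lp_norm p M f" by (intro Lp_norm_cong_AE) auto
    then show ?thesis by simp
  next
    case 3
    define s where "s = \<alpha> + \<beta>"
    have s: "s > 0" using 3 by (simp add: s_def)
    have ineq: "norm (f x + g x) powr p \<le> s powr p *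
        (\<alpha> / s * (norm (f x) powr p / \<alpha> powr p) + \<beta> / s * (norm (g x) powr p / \<beta> powr p))" for x
    proof -
      have "norm (f x + g x) powr p \<le> (norm (f x) + norm (g x)) powr p"
        using p by (intro powr_mono2 norm_triangle_ineq) auto
      also have "norm (f x) + norm (g x) = s * (\<alpha> / s * (norm (f x) / \<alpha>) + \<beta> / s * (norm (g x) / \<beta>))"
        using 3 s by (simp add: field_simps)
      also have "\<dots> powr p = s powr p * (\<alpha> / s * (norm (f x) / \<alpha>) + \<beta> / s * (norm (g x) / \<beta>)) powr p"
        using 3 s by (intro powr_mult) 
      also have "\<dots> \<le> s powr p * (\<alpha> / s * (norm (f x) / \<alpha>) powr p + \<beta> / s * (norm (g x) / \<beta>) powr p)"
        using 3 s p by (intro mult_left_mono powr_convex_combination) (auto simp: s_def add_divide_distrib[symmetric])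
      finally show ?thesis using 3 by (simp add: powr_divide)
    qed
    have "(\<integral>x. norm (f x + g x) powr p \<partial>M) \<le> (\<integral>x. s powr p *
        (\<alpha> / s * (norm (f x) powr p / \<alpha> powr p) + \<beta> / s * (norm (g x) powr p / \<beta> powr p)) \<partial>M)"
      using in_Lp_add fi gi by (intro integral_mono ineq) (auto simp: in_Lp_def)
    also have "\<dots> = s powr p * (\<alpha> / s * ((\<integral>x. norm (f x) powr p \<partial>M) / \<alpha> powr p)
        + \<beta> / s * ((\<integral>x. norm (g x) powr p \<partial>M) / \<beta> powr p))"
      using fi gi by simp
    also have "\<dots> = s powr p * (\<alpha> / s + \<beta> / s)"
      using 3 p by (simp add: Lp_norm_powr[symmetric] \<alpha>_def[symmetric] \<beta>_def[symmetric])
    also have "\<dots> = s powr p"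
      using s by (simp add: s_def add_divide_distrib[symmetric])
    finally show ?thesis
      using s p by (subst Lp_norm_le_iff) (auto simp: s_def \<alpha>_def \<beta>_def)
  qed
qed

end

lemma in_Lp_zero [simp]: "in_Lp p M (\<lambda>x. 0)"
  by (simp add: in_Lp_def)

lemma Lp_norm_zero [simp]: "Lp_norm p M (\<lambda>x. 0) = 0"
  by (simp add: Lp_norm_def)

lemma in_Lp_sum:
  fixes f :: "'i \<Rightarrow> 'a \<Rightarrow> 'b::{real_normed_vector, second_countable_topology}"
  assumes "1 \<le> p" "\<And>i. i \<in> I \<Longrightarrow> in_Lp p M (f i)"
  shows "in_Lp p M (\<lambda>x. \<Sum>i\<in>I. f i x)"
  using assms(2) by (induction I rule: infinite_finite_induct) (auto intro!: in_Lp_add assms(1))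

lemma Lp_norm_sum:
  fixes f :: "'i \<Rightarrow> 'a \<Rightarrow> 'b::{real_normed_vector, second_countable_topology}"
  assumes "1 \<le> p" "\<And>i. i \<in> I \<Longrightarrow> in_Lp p M (f i)"
  shows "Lp_norm p M (\<lambda>x. \<Sum>i\<in>I. f i x) \<le> (\<Sum>i\<in>I. Lp_norm p M (f i))"
  using assms(2)
proof (induction I rule: infinite_finite_induct)
  case (insert i I)
  have "Lp_norm p M (\<lambda>x. f i x + (\<Sum>i\<in>I. f i x)) \<le> Lp_norm p M (f i) + Lp_norm p M (\<lambda>x. \<Sum>i\<in>I. f i x)"
    using insert assms(1) by (intro Lp_norm_triangle in_Lp_sum) auto
  with insert show ?case by simp
qed auto

lemma in_Lp_mult_left:
  fixes f :: "'a \<Rightarrow> complex"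
  assumes "in_Lp p M f"
  shows "in_Lp p M (\<lambda>x. c * f x)"
  using assms by (auto simp: in_Lp_def norm_mult powr_mult)

lemma Lp_norm_mult_left:
  fixes f :: "'a \<Rightarrow> complex"
  assumes "1 \<le> p"
  shows "Lp_norm p M (\<lambda>x. c * f x) = norm c * Lp_norm p M f"
  using assms by (simp add: Lp_norm_def norm_mult powr_mult powr_powr)

lemma in_Lp_diff:
  fixes f g :: "'a \<Rightarrow> complex"
  assumes "1 \<le> p" "in_Lp p M f" "in_Lp p M g"
  shows "in_Lp p M (\<lambda>x. f x - g x)"
  using in_Lp_add[OF assms(1,2) in_Lp_mult_left[OF assms(3), of "-1"]] by simp

lemma Lp_norm_minus_commute: 
  fixes f g :: "'a \<Rightarrow> 'b::real_normed_vector"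
  shows "Lp_norm p M (\<lambda>x. f x - g x) = Lp_norm p M (\<lambda>x. g x - f x)"
  by (simp add: Lp_norm_def norm_minus_commute)

lemma Lp_norm_triangle_diff:
  fixes f g h :: "'a \<Rightarrow> complex"
  assumes "1 \<le> p" "in_Lp p M (\<lambda>x. f x - g x)" "in_Lp p M (\<lambda>x. g x - h x)"
  shows "Lp_norm p M (\<lambda>x. f x - h x) \<le> Lp_norm p M (\<lambda>x. f x - g x) + Lp_norm p M (\<lambda>x. g x - h x)"
  using Lp_norm_triangle[OF assms] by simp

subsection \<open>Lattice sums and tilings\<close>

lemma integrable_count_space_iff_summable_complex:
  fixes f :: "'a \<Rightarrow> complex"
  shows "integrable (count_space A) f \<longleftrightarrow> f summable_on A"
  by (metis abs_summable_equivalent abs_summable_on_def summable_on_iff_abs_summable_on_complex)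

lemma integrable_count_space_iff_summable_real:
  fixes f :: "'a \<Rightarrow> real"
  shows "integrable (count_space A) f \<longleftrightarrow> f summable_on A"
  by (metis abs_summable_equivalent abs_summable_on_def summable_on_iff_abs_summable_on_real)

text \<open>For complex series unconditional and absolute convergence coincide, and where the series
  diverges both sides take the default value 0. Hence lattice sums inherit measurability, linearity
  and dominated convergence from Bochner integrals.\<close>

lemma infsum_eq_integral_complex:
  fixes f :: "'a \<Rightarrow> complex"
  shows "infsum f A = (\<integral>x. f x \<partial>count_space A)"
  by (metis abs_summable_on_def infsetsum_def infsetsum_infsum infsum_not_exists
      integrable_count_space_iff_summable_complex not_integrable_integral_eq)

lemma infsum_eq_integral_real:
  fixes f :: "'a \<Rightarrow> real"
  shows "infsum f A = (\<integral>x. f x \<partial>count_space A)"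
  by (metis abs_summable_on_def infsetsum_def infsetsum_infsum infsum_not_exists
      integrable_count_space_iff_summable_real not_integrable_integral_eq)

lemma borel_measurable_lattice_integral:
  fixes f :: "'i::countable \<Rightarrow> 'a \<Rightarrow> 'b::{banach, second_countable_topology}"
  assumes "\<And>k. f k \<in> borel_measurable M"
  shows "(\<lambda>x. \<integral>k. f k x \<partial>count_space UNIV) \<in> borel_measurable M"
proof -
  interpret sigma_finite_measure "count_space (UNIV :: 'i set)"
    by (rule sigma_finite_measure_count_space)
  have "(\<lambda>(x, k). f k x) \<in> borel_measurable (M \<Otimes>\<^sub>M count_space UNIV)"
    unfolding case_prod_beta
    by (rule measurable_compose_countable[where g=snd]) (auto intro: measurable_compose[OF measurable_fst assms])
  then show ?thesis by (rule borel_measurable_lebesgue_integral)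
qed

lemma borel_measurable_infsum_complex:
  fixes f :: "'i::countable \<Rightarrow> 'a \<Rightarrow> complex"
  assumes "\<And>k. f k \<in> borel_measurable M"
  shows "(\<lambda>x. \<Sum>\<^sub>\<infinity>k. f k x) \<in> borel_measurable M"
  unfolding infsum_eq_integral_complex using assms by (rule borel_measurable_lattice_integral)

lemma borel_measurable_infsum_real:
  fixes f :: "'i::countable \<Rightarrow> 'a \<Rightarrow> real"
  assumes "\<And>k. f k \<in> borel_measurable M"
  shows "(\<lambda>x. \<Sum>\<^sub>\<infinity>k. f k x) \<in> borel_measurable M"
  unfolding infsum_eq_integral_real using assms by (rule borel_measurable_lattice_integral)

lemma nn_integral_count_space_infsum:
  fixes f :: "'a \<Rightarrow> real"
  assumes "f summable_on A" "\<And>x. 0 \<le> f x"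
  shows "(\<integral>\<^sup>+x. ennreal (f x) \<partial>count_space A) = ennreal (\<Sum>\<^sub>\<infinity>x\<in>A. f x)"
  unfolding infsum_eq_integral_real using assms
  by (intro nn_integral_eq_integral) (auto simp: integrable_count_space_iff_summable_real)

lemma borel_measurable_affine_matrix:
  fixes A :: "real^'n^'n"
  assumes "invertible A" "f \<in> lebesgue \<rightarrow>\<^sub>M N"
  shows "(\<lambda>x. f (A *v x + t)) \<in> lebesgue \<rightarrow>\<^sub>M N"
  using measurable_compose[OF measurable_affine_lebesgue[OF assms(1)] assms(2)] .

lemma invertible_mat_1: "invertible (mat 1 :: real^'n^'n)"
  by (auto simp: invertible_def)

lemma borel_measurable_shift:
  fixes f :: "real^'n \<Rightarrow> 'b"
  assumes "f \<in> lebesgue \<rightarrow>\<^sub>M N"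
  shows "(\<lambda>x. f (x - t)) \<in> lebesgue \<rightarrow>\<^sub>M N"
  using borel_measurable_affine_matrix[OF invertible_mat_1 assms, of "-t"] by simp

lemma nn_integral_shift:
  fixes f :: "real^'n \<Rightarrow> ennreal"
  assumes "f \<in> borel_measurable lebesgue"
  shows "(\<integral>\<^sup>+x. f (x - t) \<partial>lebesgue) = (\<integral>\<^sup>+x. f x \<partial>lebesgue)"
  using nn_integral_affine_matrix[OF invertible_mat_1 assms, of "-t"] by (simp add: det_I)

section \<open>The lattice and its fundamental tile\<close>

abbreviation "lat b k \<equiv> b *v lattice_vec k"

lemma lattice_vec_uminus: "lattice_vec (- k) = - lattice_vec k"
  by (simp add: lattice_vec_def vec_eq_iff)

lemma lat_uminus:
  fixes b :: "real^'n^'n"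
  shows "lat b (- k) = - (lat b k)"
  unfolding lattice_vec_uminus by (rule linear_neg[OF matrix_vector_mul_linear])

lemma lattice_vec_add: "lattice_vec (k + l) = lattice_vec k + lattice_vec l"
  by (simp add: lattice_vec_def vec_eq_iff)

definition tile :: "real^'n^'n \<Rightarrow> (real^'n) set" where
  "tile b = (\<lambda>x. b *v x) ` unit_cube"

definition tile_index :: "real^'n^'n \<Rightarrow> real^'n \<Rightarrow> int^'n" where
  "tile_index b x = (\<chi> i. \<lfloor>(matrix_inv b *v x) $ i\<rfloor>)"

lemma matrix_inv_cancel:
  fixes b :: "real^'n^'n"
  assumes "invertible b"
  shows "matrix_inv b *v (b *v x) = x" "b *v (matrix_inv b *v x) = x"
proof -
  have "b ** matrix_inv b = mat 1 \<and> matrix_inv b ** b = mat 1"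
    using assms unfolding invertible_def matrix_inv_def by (rule someI_ex)
  then show "matrix_inv b *v (b *v x) = x" "b *v (matrix_inv b *v x) = x"
    by (simp_all add: matrix_vector_mul_assoc)
qed

lemma mem_tile_iff:
  fixes b :: "real^'n^'n"
  assumes "invertible b"
  shows "x \<in> tile b \<longleftrightarrow> matrix_inv b *v x \<in> unit_cube"
proof
  assume "x \<in> tile b"
  then show "matrix_inv b *v x \<in> unit_cube"
    using assms by (auto simp: tile_def matrix_inv_cancel)
next
  assume "matrix_inv b *v x \<in> unit_cube"
  then show "x \<in> tile b"
    unfolding tile_def using matrix_inv_cancel(2)[OF assms, of x] by (metis imageI)
qed

text \<open>Existence and uniqueness of the cell containing \<open>x\<close> in one equivalence. The
  cube is half-open, so in lattice coordinates the componentwise floor is the only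
  candidate.\<close>

lemma diff_mem_tile_iff:
  fixes b :: "real^'n^'n"
  assumes "invertible b"
  shows "x - lat b k \<in> tile b \<longleftrightarrow> k = tile_index b x"
proof -
  have "x - lat b k \<in> tile b \<longleftrightarrow> matrix_inv b *v x - lattice_vec k \<in> unit_cube"
    using assms by (simp add: mem_tile_iff matrix_vector_mult_diff_distrib matrix_inv_cancel)
  also have "\<dots> \<longleftrightarrow> (\<forall>i. k $ i = \<lfloor>(matrix_inv b *v x) $ i\<rfloor>)"
    unfolding unit_cube_def lattice_vec_def
    by (auto simp: algebra_simps eq_commute[of "k $ _"] floor_eq_iff)
  also have "\<dots> \<longleftrightarrow> k = tile_index b x"
    by (simp add: tile_index_def vec_eq_iff)
  finally show ?thesis .
qed

lemma unit_cube_lmeasurable: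
  "(unit_cube :: (real^'n) set) \<in> lmeasurable" "measure lebesgue (unit_cube :: (real^'n) set) = 1"
proof -
  have sub: "box 0 (1::real^'n) \<subseteq> unit_cube" "unit_cube \<subseteq> cbox 0 (1::real^'n)"
    by (auto simp: unit_cube_def mem_box_cart less_imp_le)
  have "convex (unit_cube :: (real^'n) set)"
  proof -
    have "unit_cube = (\<Inter>i. {x::real^'n. 0 \<le> x $ i} \<inter> {x. x $ i < 1})"
      by (auto simp: unit_cube_def)
    also have "convex \<dots>"
    proof (intro convex_INT convex_Int)
      fix i
      show "convex {x::real^'n. 0 \<le> x $ i}" "convex {x::real^'n. x $ i < 1}"
        using convex_halfspace_ge[of 0 "axis i 1 :: real^'n"] convex_halfspace_lt[of "axis i 1 :: real^'n" 1]
        by (simp_all add: inner_axis')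
    qed
    finally show ?thesis .
  qed
  moreover have "bounded (unit_cube :: (real^'n) set)"
    by (rule bounded_subset[OF bounded_cbox sub(2)])
  ultimately show lm: "(unit_cube :: (real^'n) set) \<in> lmeasurable"
    by (rule measurable_convex)
  have ne: "cbox 0 (1::real^'n) \<noteq> {}" by (simp add: interval_ne_empty_cart)
  have c: "measure lebesgue (cbox 0 (1::real^'n)) = 1"
    using content_cbox_cart[OF ne] by simp
  have bx: "measure lebesgue (box 0 (1::real^'n)) = measure lebesgue (cbox 0 (1::real^'n))"
    by (simp add: measure_lborel_box_eq measure_lborel_cbox_eq)
  have "measure lebesgue (box 0 (1::real^'n)) \<le> measure lebesgue (unit_cube :: (real^'n) set)"
    by (rule measure_mono_fmeasurable[OF sub(1) _ lm]) simp
  moreover have "measure lebesgue (unit_cube :: (real^'n) set) \<le> measure lebesgue (cbox 0 (1::real^'n))"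
    by (rule measure_mono_fmeasurable[OF sub(2) fmeasurableD[OF lm]]) simp
  ultimately show "measure lebesgue (unit_cube :: (real^'n) set) = 1"
    using c bx by linarith
qed

lemma tile_lmeasurable:
  "tile b \<in> lmeasurable" "measure lebesgue (tile b) = \<bar>det b\<bar>"
  using measure_linear_image_finite[OF matrix_vector_mul_linear[of b] unit_cube_lmeasurable(1)]
  by (simp_all add: tile_def unit_cube_lmeasurable(2))

lemma tile_sets [measurable]: "tile b \<in> sets lebesgue"
  using tile_lmeasurable(1) by (rule fmeasurableD)

lemma bounded_tile: "bounded (tile b)"
proof -
  have "unit_cube \<subseteq> cbox 0 (1::real^'n)"
    by (auto simp: unit_cube_def mem_box_cart less_imp_le)
  then show ?thesis unfolding tile_def
    by (metis bounded_cbox bounded_linear_image bounded_subset matrix_vector_mul_bounded_linear)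
qed

text \<open>Unfolding of an integral over the tiling, read from right to left. After Tonelli, a
  translation in each term moves the shift from \<open>h\<close> to the indicator of the tile, which
  is why \<open>- k\<close> appears; these indicators form a partition of unity, which is the fact
  \<open>one\<close>.\<close>

lemma nn_integral_tiling:
  fixes b :: "real^'n^'n"
  assumes b: "invertible b" and h: "h \<in> borel_measurable lebesgue"
  shows "(\<integral>\<^sup>+x. h x \<partial>lebesgue)
    = (\<integral>\<^sup>+x. (\<integral>\<^sup>+k. h (x - lat b k) \<partial>count_space UNIV) * indicator (tile b) x \<partial>lebesgue)"
proof -
  have [measurable]: "(\<lambda>x. h (x - t)) \<in> borel_measurable lebesgue" for t
    using h by (rule borel_measurable_shift)
  have [measurable]: "(\<lambda>x. indicator (tile b) (x - t) :: ennreal) \<in> borel_measurable lebesgue" for t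
    by (rule borel_measurable_shift) measurable
  note h[measurable]
  have one: "(\<integral>\<^sup>+k. h x * indicator (tile b) (x - lat b (- k)) \<partial>count_space UNIV) = h x" for x
  proof -
    have "indicator (tile b) (x - lat b (- k)) = (indicator {- tile_index b x} k :: ennreal)" for k
      using diff_mem_tile_iff[OF b, of x "-k"] by (auto simp: indicator_def split: if_splits) (metis minus_minus)
    then show ?thesis by (simp add: nn_integral_cmult)
  qed
  have "(\<integral>\<^sup>+x. (\<integral>\<^sup>+k. h (x - lat b k) \<partial>count_space UNIV) * indicator (tile b) x \<partial>lebesgue)
     = (\<integral>\<^sup>+x. (\<integral>\<^sup>+k. h (x - lat b k) * indicator (tile b) x \<partial>count_space UNIV) \<partial>lebesgue)"
    by (simp add: nn_integral_multc)
  also have "\<dots> = (\<integral>\<^sup>+k. (\<integral>\<^sup>+x. h (x - lat b k) * indicator (tile b) x \<partial>lebesgue) \<partial>count_space UNIV)"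
    by (rule nn_integral_count_space_nn_integral) auto
  also have "\<dots> = (\<integral>\<^sup>+k. (\<integral>\<^sup>+x. h x * indicator (tile b) (x - lat b (- k)) \<partial>lebesgue) \<partial>count_space UNIV)"
  proof (rule nn_integral_cong)
    fix k :: "int^'n"
    let ?t = "lat b k"
    have "(\<integral>\<^sup>+x. h (x - ?t) * indicator (tile b) x \<partial>lebesgue)
      = (\<integral>\<^sup>+x. h (x - ?t - (- ?t)) * indicator (tile b) (x - (- ?t)) \<partial>lebesgue)"
      using nn_integral_shift[of "\<lambda>x. h (x - ?t) * indicator (tile b) x" "- ?t"] by simp
    then show "(\<integral>\<^sup>+x. h (x - ?t) * indicator (tile b) x \<partial>lebesgue) =
      (\<integral>\<^sup>+x. h x * indicator (tile b) (x - lat b (- k)) \<partial>lebesgue)"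
      by (simp add: lat_uminus)
  qed
  also have "\<dots> = (\<integral>\<^sup>+x. (\<integral>\<^sup>+k. h x * indicator (tile b) (x - lat b (- k)) \<partial>count_space UNIV) \<partial>lebesgue)"
    by (rule nn_integral_count_space_nn_integral[symmetric]) auto
  finally show ?thesis by (simp only: one)
qed

section \<open>Lattice convolutions and the one-scale bound\<close>

lemma infsum_lattice_periodic:
  fixes f :: "real^'n \<Rightarrow> 'b::{comm_monoid_add, t2_space}" and b :: "real^'n^'n"
  shows "(\<Sum>\<^sub>\<infinity>k. f (x - lat b l - lat b k)) = (\<Sum>\<^sub>\<infinity>k. f (x - lat b k))"
proof -
  have "bij_betw (\<lambda>k. l + k) UNIV UNIV"
    by (rule bij_betwI[where g="\<lambda>k. k - l"]) auto
  from infsum_reindex_bij_betw[OF this, of "\<lambda>k. f (x - lat b k)"]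
  show ?thesis
    by (simp add: lattice_vec_add matrix_vector_mult_add_rdistrib algebra_simps)
qed

text \<open>Jensen's inequality at each \<open>x\<close>, with weights
  \<open>w (x - lat b k)\<close> of total mass \<open>u x\<close>, gives the factor
  \<open>u x powr (p - 1)\<close>. Since \<open>u\<close> is periodic, every \<open>k\<close>
  contributes the same integral \<open>I\<close>, which separates the coefficients from the
  generator. Unfolding \<open>I\<close> over the tile sums the weights once more and completes the
  power to \<open>u x powr p\<close>.\<close>

lemma
  fixes b :: "real^'n^'n" and c :: "int^'n \<Rightarrow> real" and w :: "real^'n \<Rightarrow> real"
  assumes b: "invertible b" and p: "1 \<le> p"
    and w: "w \<in> borel_measurable lebesgue" "\<And>x. 0 \<le> w x"
    and sw: "AE x in lebesgue. (\<lambda>k. w (x - lat b k)) summable_on UNIV"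
    and c: "\<And>k. 0 \<le> c k" "(\<lambda>k. c k powr p) summable_on UNIV"
  shows lattice_convolution_summable:
      "AE x in lebesgue. (\<lambda>k. c k * w (x - lat b k)) summable_on UNIV"
    and lattice_convolution_bound:
      "(\<integral>\<^sup>+x. ennreal ((\<Sum>\<^sub>\<infinity>k. c k * w (x - lat b k)) powr p) \<partial>lebesgue)
        \<le> ennreal (\<Sum>\<^sub>\<infinity>k. c k powr p) *
          (\<integral>\<^sup>+x. ennreal ((\<Sum>\<^sub>\<infinity>k. w (x - lat b k)) powr p) * indicator (tile b) x \<partial>lebesgue)"
proof -
  define L where "L k = lat b k" for k
  define u where "u x = (\<Sum>\<^sub>\<infinity>k. w (x - L k))" for x
  have u0: "0 \<le> u x" for x unfolding u_def by (rule infsum_nonneg) (rule w(2))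
  define C where "C = (\<Sum>\<^sub>\<infinity>k. c k powr p)"
  have C0: "0 \<le> C" unfolding C_def by (rule infsum_nonneg) simp
  \<comment> \<open>The coefficients are bounded by \<open>C powr (1/p)\<close>, so both weighted
    series converge wherever the lattice sum of \<open>w\<close> does.\<close>
  have cC: "c k powr p \<le> C" for k
    using finite_sum_le_infsum[OF c(2), of "{k}"] by (simp add: C_def)
  have cC1: "c k \<le> C powr (1/p)" for k
    using powr_mono2[OF _ _ cC, of "1/p" k] p c(1)[of k] by (simp add: powr_powr)
  have [measurable]: "(\<lambda>x. w (x - t)) \<in> borel_measurable lebesgue" for t
    using w(1) by (rule borel_measurable_shift)
  have um [measurable]: "u \<in> borel_measurable lebesgue"
    unfolding u_def by (rule borel_measurable_infsum_real) measurable
  have u_per: "u (x - L k) = u x" for x k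
    unfolding u_def L_def by (rule infsum_lattice_periodic)
  have s1: "(\<lambda>k. c k * w (x - L k)) summable_on UNIV"
    and s2: "(\<lambda>k. c k powr p * w (x - L k)) summable_on UNIV"
    if "(\<lambda>k. w (x - L k)) summable_on UNIV" for x
  proof -
    show "(\<lambda>k. c k * w (x - L k)) summable_on UNIV"
      using w(2) c(1) cC1
      by (intro summable_on_comparison_test[OF summable_on_cmult_right[OF that, of "C powr (1/p)"]])
        (auto intro!: mult_right_mono)
    show "(\<lambda>k. c k powr p * w (x - L k)) summable_on UNIV"
      using w(2) c(1) cC
      by (intro summable_on_comparison_test[OF summable_on_cmult_right[OF that, of C]])
        (auto intro!: mult_right_mono)
  qed
  show "AE x in lebesgue. (\<lambda>k. c k * w (x - lat b k)) summable_on UNIV"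
    using sw by eventually_elim (use s1 in \<open>simp add: L_def\<close>)
  define I where "I = (\<integral>\<^sup>+x. ennreal (u x powr (p - 1) * w x) \<partial>lebesgue)"
  have "(\<integral>\<^sup>+x. ennreal ((\<Sum>\<^sub>\<infinity>k. c k * w (x - L k)) powr p) \<partial>lebesgue)
    \<le> (\<integral>\<^sup>+x. (\<integral>\<^sup>+k. ennreal (c k powr p) * ennreal (u x powr (p - 1) * w (x - L k)) \<partial>count_space UNIV) \<partial>lebesgue)"
  proof (rule nn_integral_mono_AE)
    show "AE x in lebesgue. ennreal ((\<Sum>\<^sub>\<infinity>k. c k * w (x - L k)) powr p)
      \<le> (\<integral>\<^sup>+k. ennreal (c k powr p) * ennreal (u x powr (p - 1) * w (x - L k)) \<partial>count_space UNIV)"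
      using sw
    proof eventually_elim
      fix x assume "(\<lambda>k. w (x - lat b k)) summable_on UNIV"
      then have sx: "(\<lambda>k. w (x - L k)) summable_on UNIV" by (simp add: L_def)
      have "(\<Sum>\<^sub>\<infinity>k. c k * w (x - L k)) powr p \<le> u x powr (p - 1) * (\<Sum>\<^sub>\<infinity>k. c k powr p * w (x - L k))"
        unfolding u_def infsum_eq_integral_real
        using p c(1) w(2) sx s1[OF sx] s2[OF sx]
        by (intro integral_powr_le_weighted) (auto simp: integrable_count_space_iff_summable_real)
      also have "\<dots> = (\<Sum>\<^sub>\<infinity>k. c k powr p * (u x powr (p - 1) * w (x - L k)))"
        by (simp add: infsum_cmult_right'[symmetric] mult_ac)
      finally have "ennreal ((\<Sum>\<^sub>\<infinity>k. c k * w (x - L k)) powr p)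
         \<le> ennreal (\<Sum>\<^sub>\<infinity>k. c k powr p * (u x powr (p - 1) * w (x - L k)))"
        by (rule ennreal_leI)
      also have "\<dots> = (\<integral>\<^sup>+k. ennreal (c k powr p * (u x powr (p - 1) * w (x - L k))) \<partial>count_space UNIV)"
        using w(2) summable_on_cmult_right[OF s2[OF sx], of "u x powr (p - 1)"]
        by (intro nn_integral_count_space_infsum[symmetric]) (auto simp: mult_ac)
      finally show "ennreal ((\<Sum>\<^sub>\<infinity>k. c k * w (x - L k)) powr p)
          \<le> (\<integral>\<^sup>+k. ennreal (c k powr p) * ennreal (u x powr (p - 1) * w (x - L k)) \<partial>count_space UNIV)"
        using w(2) by (simp add: ennreal_mult)
    qed
  qed
  also have "\<dots> = (\<integral>\<^sup>+k. (\<integral>\<^sup>+x. ennreal (c k powr p) * ennreal (u x powr (p - 1) * w (x - L k)) \<partial>lebesgue) \<partial>count_space UNIV)"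
    by (rule nn_integral_count_space_nn_integral) auto
  also have "\<dots> = (\<integral>\<^sup>+k. ennreal (c k powr p) * I \<partial>count_space UNIV)"
  proof (rule nn_integral_cong)
    fix k
    have "(\<integral>\<^sup>+x. ennreal (u x powr (p - 1) * w (x - L k)) \<partial>lebesgue)
      = (\<integral>\<^sup>+x. ennreal (u (x - L k) powr (p - 1) * w (x - L k)) \<partial>lebesgue)"
      by (simp add: u_per)
    also have "\<dots> = I"
      unfolding I_def using w(1) by (intro nn_integral_shift[where f="\<lambda>x. ennreal (u x powr (p - 1) * w x)"]) measurable
    finally show "(\<integral>\<^sup>+x. ennreal (c k powr p) * ennreal (u x powr (p - 1) * w (x - L k)) \<partial>lebesgue)
      = ennreal (c k powr p) * I"
      by (subst nn_integral_cmult) auto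
  qed
  also have "\<dots> = ennreal C * I"
    using nn_integral_count_space_infsum[OF c(2)] by (simp add: nn_integral_multc C_def)
  also have "I = (\<integral>\<^sup>+x. (\<integral>\<^sup>+k. ennreal (u (x - L k) powr (p - 1) * w (x - L k)) \<partial>count_space UNIV) * indicator (tile b) x \<partial>lebesgue)"
    unfolding I_def L_def using w(1) by (intro nn_integral_tiling[OF b]) measurable
  also have "\<dots> = (\<integral>\<^sup>+x. ennreal (u x powr p) * indicator (tile b) x \<partial>lebesgue)"
  proof (rule nn_integral_cong_AE)
    show "AE x in lebesgue. (\<integral>\<^sup>+k. ennreal (u (x - L k) powr (p - 1) * w (x - L k)) \<partial>count_space UNIV) * indicator (tile b) x
      = ennreal (u x powr p) * indicator (tile b) x"
      using sw
    proof eventually_elim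
      fix x assume "(\<lambda>k. w (x - lat b k)) summable_on UNIV"
      then have sx: "(\<lambda>k. w (x - L k)) summable_on UNIV" by (simp add: L_def)
      have "(\<integral>\<^sup>+k. ennreal (u (x - L k) powr (p - 1) * w (x - L k)) \<partial>count_space UNIV)
        = ennreal (\<Sum>\<^sub>\<infinity>k. u x powr (p - 1) * w (x - L k))"
        unfolding u_per using summable_on_cmult_right[OF sx] w(2)
        by (intro nn_integral_count_space_infsum) auto
      also have "(\<Sum>\<^sub>\<infinity>k. u x powr (p - 1) * w (x - L k)) = u x * u x powr (p - 1)"
        by (simp add: infsum_cmult_right' u_def[symmetric])
      also have "\<dots> = u x powr p"
        using powr_mult_base[OF u0, of x "p - 1"] by simp
      finally show "(\<integral>\<^sup>+k. ennreal (u (x - L k) powr (p - 1) * w (x - L k)) \<partial>count_space UNIV) * indicator (tile b) x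
      = ennreal (u x powr p) * indicator (tile b) x" by simp
    qed
  qed
  finally show "(\<integral>\<^sup>+x. ennreal ((\<Sum>\<^sub>\<infinity>k. c k * w (x - lat b k)) powr p) \<partial>lebesgue)
        \<le> ennreal (\<Sum>\<^sub>\<infinity>k. c k powr p) *
          (\<integral>\<^sup>+x. ennreal ((\<Sum>\<^sub>\<infinity>k. w (x - lat b k)) powr p) * indicator (tile b) x \<partial>lebesgue)"
    by (simp add: L_def u_def C_def)
qed

text \<open>The periodization of the absolute value without its factor |det b|. The one-scale bound
  then has no determinant in it, and the factor returns only in the final theorem.\<close>

definition lattice_sum :: "real^'n^'n \<Rightarrow> (real^'n \<Rightarrow> complex) \<Rightarrow> real^'n \<Rightarrow> real" where
  "lattice_sum b \<psi> x = (\<Sum>\<^sub>\<infinity>k. norm (\<psi> (x - lat b k)))"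

abbreviation "tile_norm p b \<psi> \<equiv> Lp_norm p (lebesgue_on (tile b)) (lattice_sum b \<psi>)"

lemma lattice_sum_nonneg: "0 \<le> lattice_sum b \<psi> x"
  unfolding lattice_sum_def by (rule infsum_nonneg) simp

lemma borel_measurable_lattice_sum:
  assumes "\<psi> \<in> borel_measurable lebesgue"
  shows "lattice_sum b \<psi> \<in> borel_measurable lebesgue"
proof -
  have "(\<lambda>x. norm (\<psi> (x - t))) \<in> borel_measurable lebesgue" for t
    by (rule borel_measurable_shift) (use assms in measurable)
  then show ?thesis unfolding lattice_sum_def by (intro borel_measurable_infsum_real)
qed

text \<open>The normalization |det (a j)|^(1/p) makes dilation by \<open>a j\<close> an isometry of
  L^p, so the bound reduces to the lattice convolution of the moduli of the coefficients with the
  modulus of the generator. The generator is general because the estimate is needed both for the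
  given one and for its difference from a truncation.\<close>

lemma
  fixes a :: "nat \<Rightarrow> real^'n^'n" and b :: "real^'n^'n" and c :: "nat \<Rightarrow> int^'n \<Rightarrow> complex"
  assumes a: "invertible (a j)" and b: "invertible b" and p: "1 \<le> p"
    and \<psi>: "\<psi> \<in> borel_measurable lebesgue"
    and conv: "AE x in lebesgue. (\<lambda>k. norm (\<psi> (x - lat b k))) summable_on UNIV"
    and W: "in_Lp p (lebesgue_on (tile b)) (lattice_sum b \<psi>)"
    and c: "(\<lambda>k. norm (c j k) powr p) summable_on UNIV"
  shows synthesis_scale_summable:
      "AE x in lebesgue. (\<lambda>k. norm (c j k * affine_fun p a b \<psi> j k x)) summable_on UNIV"
    and in_Lp_synthesis_scale: "in_Lp p lebesgue (synthesis_scale p a b \<psi> c j)"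
    and Lp_norm_synthesis_scale: "Lp_norm p lebesgue (synthesis_scale p a b \<psi> c j)
      \<le> tile_norm p b \<psi> *
        (\<Sum>\<^sub>\<infinity>k. norm (c j k) powr p) powr (1 / p)"
proof -
  let ?D = "\<bar>det (a j)\<bar>" and ?L = "\<lambda>k. lat b k"
  define F where "F x = (\<Sum>\<^sub>\<infinity>k. norm (c j k) * norm (\<psi> (x - ?L k)))" for x
  have F0: "0 \<le> F x" for x unfolding F_def by (rule infsum_nonneg) simp
  have \<psi>s: "(\<lambda>x. norm (\<psi> (x - t))) \<in> borel_measurable lebesgue" for t
    by (rule borel_measurable_shift) (use \<psi> in measurable)
  have Fm [measurable]: "F \<in> borel_measurable lebesgue"
    unfolding F_def
    by (intro borel_measurable_infsum_real borel_measurable_times borel_measurable_const \<psi>s)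
  have D: "?D > 0" using a by (simp add: invertible_det_nz)
  have sm: "AE x in lebesgue. (\<lambda>k. norm (c j k) * norm (\<psi> (x - ?L k))) summable_on UNIV"
    using \<psi> by (intro lattice_convolution_summable[OF b p _ _ conv _ c]) auto
  have eq: "norm (c j k * affine_fun p a b \<psi> j k x) =
      ?D powr (1/p) * (norm (c j k) * norm (\<psi> (a j *v x - ?L k)))" for k x
    by (simp add: affine_fun_def norm_mult)
  have sm': "AE x in lebesgue. (\<lambda>k. norm (c j k) * norm (\<psi> (a j *v x - ?L k))) summable_on UNIV"
    using AE_affine_matrix[OF a sm, of 0] by simp
  then show sN: "AE x in lebesgue. (\<lambda>k. norm (c j k * affine_fun p a b \<psi> j k x)) summable_on UNIV"
    unfolding eq by eventually_elim (rule summable_on_cmult_right)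
  have m: "synthesis_scale p a b \<psi> c j \<in> borel_measurable lebesgue"
  proof -
    have "(\<lambda>x. \<psi> (a j *v x + t)) \<in> borel_measurable lebesgue" for t
      using a \<psi> by (rule borel_measurable_affine_matrix)
    from this[of "- ?L _"] show ?thesis
      unfolding synthesis_scale_def affine_fun_def
      by (intro borel_measurable_infsum_complex borel_measurable_times borel_measurable_const) simp
  qed
  have bound: "AE x in lebesgue. norm (synthesis_scale p a b \<psi> c j x) powr p \<le> ?D * F (a j *v x) powr p"
    using sN
  proof eventually_elim
    fix x assume "(\<lambda>k. norm (c j k * affine_fun p a b \<psi> j k x)) summable_on UNIV"
    then have "norm (synthesis_scale p a b \<psi> c j x) \<le> (\<Sum>\<^sub>\<infinity>k. norm (c j k * affine_fun p a b \<psi> j k x))"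
      unfolding synthesis_scale_def by (rule norm_infsum_bound)
    also have "\<dots> = ?D powr (1/p) * F (a j *v x)"
      unfolding eq F_def by (rule infsum_cmult_right')
    finally have "norm (synthesis_scale p a b \<psi> c j x) powr p \<le> (?D powr (1/p) * F (a j *v x)) powr p"
      using p by (intro powr_mono2) auto
    then show "norm (synthesis_scale p a b \<psi> c j x) powr p \<le> ?D * F (a j *v x) powr p"
      using p D F0 by (simp add: powr_mult powr_powr)
  qed
  let ?S = "(\<Sum>\<^sub>\<infinity>k. norm (c j k) powr p)"
  let ?N = "tile_norm p b \<psi>"
  have S0: "0 \<le> ?S" by (rule infsum_nonneg) simp
  have tile_int: "(\<integral>\<^sup>+x. ennreal (lattice_sum b \<psi> x powr p) * indicator (tile b) x \<partial>lebesgue) = ennreal (?N powr p)"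
  proof -
    have "ennreal (?N powr p) = ennreal (\<integral>x. lattice_sum b \<psi> x powr p \<partial>lebesgue_on (tile b))"
      using p lattice_sum_nonneg[of b \<psi>] by (simp add: Lp_norm_powr)
    also have "\<dots> = (\<integral>\<^sup>+x. ennreal (lattice_sum b \<psi> x powr p) \<partial>lebesgue_on (tile b))"
      using W lattice_sum_nonneg[of b \<psi>] by (intro nn_integral_eq_integral[symmetric]) (auto simp: in_Lp_def)
    finally show ?thesis by (simp add: nn_integral_restrict_space)
  qed
  have "(\<integral>\<^sup>+x. ennreal (norm (synthesis_scale p a b \<psi> c j x) powr p) \<partial>lebesgue)
     \<le> (\<integral>\<^sup>+x. ennreal (?D * F (a j *v x) powr p) \<partial>lebesgue)"
    using bound by (intro nn_integral_mono_AE) (auto elim!: eventually_mono intro: ennreal_leI)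
  also have "\<dots> = ennreal ?D * (\<integral>\<^sup>+x. ennreal (F (a j *v x + 0) powr p) \<partial>lebesgue)"
    using borel_measurable_affine_matrix[OF a Fm, of 0]
    by (subst nn_integral_cmult[symmetric]) (auto simp: ennreal_mult)
  also have "\<dots> = (\<integral>\<^sup>+x. ennreal (F x powr p) \<partial>lebesgue)"
    by (rule nn_integral_affine_matrix[OF a, symmetric]) measurable
  also have "\<dots> \<le> ennreal ?S * ennreal (?N powr p)"
    using lattice_convolution_bound[OF b p _ _ conv _ c] \<psi>
    unfolding F_def tile_int[symmetric] lattice_sum_def by simp
  also have "\<dots> = ennreal (?S * ?N powr p)" using S0 by (simp add: ennreal_mult)
  finally have le: "(\<integral>\<^sup>+x. ennreal (norm (synthesis_scale p a b \<psi> c j x) powr p) \<partial>lebesgue) \<le> ennreal (?S * ?N powr p)" .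
  have int: "integrable lebesgue (\<lambda>x. norm (synthesis_scale p a b \<psi> c j x) powr p)"
    using m le by (intro integrableI_bounded) (auto simp: less_top[symmetric] top_unique)
  with m show "in_Lp p lebesgue (synthesis_scale p a b \<psi> c j)" by (simp add: in_Lp_def)
  have "(\<integral>x. norm (synthesis_scale p a b \<psi> c j x) powr p \<partial>lebesgue) \<le> ?S * ?N powr p"
    using le S0 int by (simp add: nn_integral_eq_integral)
  also have "\<dots> = (?N * ?S powr (1/p)) powr p"
    using p S0 by (simp add: powr_mult powr_powr)
  finally show "Lp_norm p lebesgue (synthesis_scale p a b \<psi> c j) \<le> ?N * ?S powr (1 / p)"
    using p by (subst Lp_norm_le_iff) auto
qed

subsection \<open>Density of continuous functions with compact support\<close>

lemma Lp_norm_truncation_tendsto: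
  fixes f :: "'a \<Rightarrow> complex"
  assumes p: "1 \<le> p" and f: "in_Lp p M f" and A: "\<And>n. A n \<in> sets M"
    and ev: "\<And>x. x \<in> space M \<Longrightarrow> eventually (\<lambda>n. x \<in> A n) sequentially"
  shows "(\<lambda>n. Lp_norm p M (\<lambda>x. f x - indicator (A n) x * f x)) \<longlonglongrightarrow> 0"
proof -
  note A[measurable]
  have fm[measurable]: "f \<in> borel_measurable M" and fi: "integrable M (\<lambda>x. norm (f x) powr p)"
    using f by (auto simp: in_Lp_def)
  have "(\<lambda>n. \<integral>x. norm (f x - indicator (A n) x * f x) powr p \<partial>M) \<longlonglongrightarrow> (\<integral>x. 0 \<partial>M)"
  proof (rule integral_dominated_convergence[OF _ _ fi])
    show "AE x in M. (\<lambda>n. norm (f x - indicator (A n) x * f x) powr p) \<longlonglongrightarrow> 0"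
    proof (rule AE_I2)
      fix x assume "x \<in> space M"
      from ev[OF this] have "eventually (\<lambda>n. norm (f x - indicator (A n) x * f x) powr p = 0) sequentially"
        by eventually_elim simp
      then show "(\<lambda>n. norm (f x - indicator (A n) x * f x) powr p) \<longlonglongrightarrow> 0"
        by (rule tendsto_eventually)
    qed
    show "AE x in M. norm (norm (f x - indicator (A n) x * f x) powr p) \<le> norm (f x) powr p" for n
      using p by (auto simp: indicator_def intro!: AE_I2 powr_mono2)
  qed auto
  then have "(\<lambda>n. (\<integral>x. norm (f x - indicator (A n) x * f x) powr p \<partial>M) powr (1/p)) \<longlonglongrightarrow> 0 powr (1/p)"
    using p by (intro tendsto_powr2) auto
  then show ?thesis by (simp add: Lp_norm_def)
qed

definition cc_fun :: "('a::euclidean_space \<Rightarrow> complex) \<Rightarrow> bool" where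
  "cc_fun g \<longleftrightarrow> continuous_on UNIV g \<and> (\<exists>R. \<forall>x. R < norm x \<longrightarrow> g x = 0)"

lemma cc_fun_measurable [measurable_dest]:
  assumes "cc_fun g"
  shows "g \<in> borel_measurable lebesgue"
  using assms unfolding cc_fun_def
  by (intro continuous_imp_measurable_on_sets_lebesgue[where S=UNIV, simplified lebesgue_on_UNIV_eq]) auto

lemma cc_fun_support:
  assumes "cc_fun g"
  shows "\<exists>R>0. \<forall>x. g x \<noteq> 0 \<longrightarrow> x \<in> cball 0 R"
proof -
  obtain R where R: "\<And>x. R < norm x \<Longrightarrow> g x = 0" using assms by (auto simp: cc_fun_def)
  then have "x \<in> cball 0 (max R 1)" if "g x \<noteq> 0" for x
    using R[of x] that by fastforce
  then show ?thesis by (intro exI[of _ "max R 1"]) auto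
qed

lemma cc_fun_bounded:
  assumes "cc_fun g"
  shows "\<exists>M>0. \<forall>x. norm (g x) \<le> M"
proof -
  obtain R where R: "\<forall>x. g x \<noteq> 0 \<longrightarrow> x \<in> cball 0 R" using cc_fun_support[OF assms] by metis
  have "continuous_on (cball 0 R) g"
    using assms continuous_on_subset[of UNIV g] by (simp add: cc_fun_def)
  then have "bounded (g ` cball 0 R)"
    by (intro compact_imp_bounded compact_continuous_image) auto
  then obtain M where M: "M > 0" "\<forall>y \<in> g ` cball 0 R. norm y \<le> M"
    unfolding bounded_pos by metis
  have "norm (g x) \<le> M" for x
    using M R by (cases "g x = 0") auto
  with M(1) show ?thesis by blast
qed

lemma cc_fun_uniformly_continuous:
  assumes "cc_fun g" "e > 0"
  shows "\<exists>d>0. \<forall>x y. norm (x - y) < d \<longrightarrow> norm (g x - g y) < e"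
proof -
  obtain R where R: "\<And>x. g x \<noteq> 0 \<Longrightarrow> x \<in> cball 0 R"
    using cc_fun_support[OF assms(1)] by metis
  have "uniformly_continuous_on (cball 0 (R + 1)) g"
    using assms continuous_on_subset[of UNIV g] by (intro compact_uniformly_continuous) (auto simp: cc_fun_def)
  then obtain d where d: "d > 0"
    "\<And>x y. x \<in> cball 0 (R + 1) \<Longrightarrow> y \<in> cball 0 (R + 1) \<Longrightarrow> dist y x < d \<Longrightarrow> dist (g y) (g x) < e"
    using assms(2) unfolding uniformly_continuous_on_def by metis
  have "norm (g x - g y) < e" if xy: "norm (x - y) < min d 1" for x y
    proof (cases "g x = 0 \<and> g y = 0")
      case True then show ?thesis using assms(2) by simp
    next
      case False
      have tri: "norm x \<le> norm y + norm (x - y)" "norm y \<le> norm x + norm (x - y)"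
        using norm_triangle_sub[of x y] norm_triangle_sub[of y x] by (auto simp: norm_minus_commute)
      have "norm x \<le> R \<or> norm y \<le> R" using False R[of x] R[of y] by auto
      then have "x \<in> cball 0 (R + 1)" "y \<in> cball 0 (R + 1)"
        using tri xy by auto
      then show ?thesis using d(2)[of y x] xy by (simp add: dist_norm)
    qed
  then show ?thesis using d(1) by (intro exI[of _ "min d 1"]) auto
qed

lemma in_Lp_bounded_support:
  fixes g :: "'a \<Rightarrow> complex"
  assumes "1 \<le> p" "g \<in> borel_measurable M" "S \<in> fmeasurable M" "0 \<le> C"
    and "AE x in M. norm (g x) \<le> C * indicator S x"
  shows "in_Lp p M g" "Lp_norm p M g \<le> C * measure M S powr (1/p)"
proof -
  note assms(2)[measurable]
  have [measurable]: "S \<in> sets M" using assms(3) by (rule fmeasurableD)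
  have i: "integrable M (\<lambda>x. C powr p * indicator S x)"
    using assms(3) by (intro integrable_mult_right integrable_real_indicator) (auto simp: fmeasurable_def)
  have le: "AE x in M. norm (g x) powr p \<le> C powr p * indicator S x"
    using assms(5) by eventually_elim (use assms(1) in \<open>auto simp: indicator_def intro: powr_mono2 split: if_splits\<close>)
  have gi: "integrable M (\<lambda>x. norm (g x) powr p)"
    by (rule Bochner_Integration.integrable_bound[OF i]) (use le assms(4) in auto)
  then show "in_Lp p M g" using assms(2) by (simp add: in_Lp_def)
  have "(\<integral>x. norm (g x) powr p \<partial>M) \<le> (\<integral>x. C powr p * indicator S x \<partial>M)"
    by (rule integral_mono_AE[OF gi i le])
  also have "\<dots> = (C * measure M S powr (1/p)) powr p"
    using assms(1,4) by (simp add: powr_mult powr_powr)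
  finally show "Lp_norm p M g \<le> C * measure M S powr (1/p)"
    using assms(1,4) by (subst Lp_norm_le_iff) auto
qed

lemma cc_fun_in_Lp:
  fixes g :: "'a::euclidean_space \<Rightarrow> complex"
  assumes "cc_fun g" "1 \<le> p"
  shows "in_Lp p lebesgue g"
proof -
  obtain R where R: "\<And>x. g x \<noteq> 0 \<Longrightarrow> x \<in> cball 0 R"
    using cc_fun_support[OF assms(1)] by metis
  obtain M where M: "M > 0" "\<And>x. norm (g x) \<le> M"
    using cc_fun_bounded[OF assms(1)] by metis
  show ?thesis
  proof (rule in_Lp_bounded_support[where S="cball 0 R" and C=M])
    show "AE x in lebesgue. norm (g x) \<le> M * indicator (cball 0 R) x"
      using M R by (auto intro!: AE_I2 simp: indicator_def)
  qed (use assms M cc_fun_measurable in auto)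
qed

text \<open>Regularity of Lebesgue measure encloses \<open>A\<close> between a closed
  \<open>K\<close> and an open \<open>U\<close>. A Urysohn function that is 1 on \<open>K\<close>
  and 0 off \<open>U\<close> differs from the indicator only on \<open>U - K\<close>, and by at most
  1. Taking \<open>m\<close> as \<open>norm c + 1\<close> allows \<open>c = 0\<close>.\<close>

lemma L1_approx_indicator:
  fixes c :: complex and A :: "'a::euclidean_space set"
  assumes A: "A \<in> sets lebesgue" "emeasure lebesgue A < \<infinity>" and e: "e > 0"
  shows "\<exists>g. continuous_on UNIV g \<and> integrable lebesgue g \<and>
    (\<integral>x. norm (indicator A x *\<^sub>R c - g x) \<partial>lebesgue) < e"
proof -
  define m where "m = norm c + 1"
  define \<delta> where "\<delta> = e / (2 * m)"
  have nc: "m > 0" using norm_ge_zero[of c] by (simp add: m_def add_nonneg_pos)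
  have \<delta>: "\<delta> > 0" using e nc by (simp add: \<delta>_def)
  obtain U where U: "open U" "A \<subseteq> U" "U - A \<in> lmeasurable" "emeasure lebesgue (U - A) < ennreal \<delta>"
    using sets_lebesgue_outer_open[OF A(1) \<delta>] by blast
  obtain K where K: "closed K" "K \<subseteq> A" "A - K \<in> lmeasurable" "emeasure lebesgue (A - K) < ennreal \<delta>"
    using sets_lebesgue_inner_closed[OF A(1) \<delta>] by blast
  obtain h :: "'a \<Rightarrow> real" where h: "continuous_on UNIV h" "\<And>x. h x \<in> closed_segment 1 0"
      "\<And>x. x \<in> K \<Longrightarrow> h x = 1" "\<And>x. x \<in> - U \<Longrightarrow> h x = 0"
  proof -
    have "closed (- U)" "K \<inter> - U = {}" using U K by (auto simp: closed_Compl)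
    from Urysohn[OF K(1) this, of "1::real" 0] that show thesis by metis
  qed
  have h01: "0 \<le> h x" "h x \<le> 1" for x
    using h(2)[of x] by (auto simp: closed_segment_eq_real_ivl split: if_splits)
  have [measurable]: "h \<in> borel_measurable lebesgue"
    using continuous_imp_measurable_on_sets_lebesgue[OF h(1)] by (simp add: lebesgue_on_UNIV_eq)
  let ?S = "(U - A) \<union> (A - K)"
  have S: "?S \<in> lmeasurable" using U(3) K(3) by (rule fmeasurable.Un)
  have mS: "measure lebesgue ?S < 2 * \<delta>"
  proof -
    have "measure lebesgue ?S \<le> measure lebesgue (U - A) + measure lebesgue (A - K)"
      by (rule measure_Un_le) (use U K fmeasurableD in auto)
    also have "\<dots> < \<delta> + \<delta>"
      using U(3,4) K(3,4) \<delta> by (intro add_strict_mono) (simp_all only: emeasure_eq_measure2 ennreal_less_iff measure_nonneg)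
    finally show ?thesis by simp
  qed
  have Si: "integrable lebesgue (indicator ?S :: 'a \<Rightarrow> real)"
    using S by (intro integrable_real_indicator) (auto simp: fmeasurable_def)
  have Ai: "integrable lebesgue (indicator A :: 'a \<Rightarrow> real)"
    using A by (intro integrable_real_indicator) auto
  have diff: "\<bar>indicator A x - h x\<bar> \<le> indicator ?S x" for x
    using h01[of x] h(3,4)[of x] U(2) K(2) by (auto simp: indicator_def)
  have hi: "integrable lebesgue h"
  proof (rule Bochner_Integration.integrable_bound[OF Bochner_Integration.integrable_add[OF Ai Si]])
    show "AE x in lebesgue. norm (h x) \<le> norm (indicator A x + indicator ?S x :: real)"
      using diff h01 by (intro AE_I2) (smt (verit, best) indicator_pos_le real_norm_def)
  qed simp
  show ?thesis
  proof (intro exI conjI)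
    show "continuous_on UNIV (\<lambda>x. h x *\<^sub>R c)" using h(1) by (intro continuous_intros)
    show "integrable lebesgue (\<lambda>x. h x *\<^sub>R c)" using hi by simp
    have "(\<integral>x. norm (indicator A x *\<^sub>R c - h x *\<^sub>R c) \<partial>lebesgue) \<le> (\<integral>x. norm c * indicator ?S x \<partial>lebesgue)"
    proof (rule integral_mono)
      fix x
      have "norm (indicator A x *\<^sub>R c - h x *\<^sub>R c) = \<bar>indicator A x - h x\<bar> * norm c"
        by (simp add: scaleR_left_diff_distrib[symmetric])
      also have "\<dots> \<le> indicator ?S x * norm c" by (rule mult_right_mono[OF diff]) simp
      finally show "norm (indicator A x *\<^sub>R c - h x *\<^sub>R c) \<le> norm c * indicator ?S x"
        by (simp add: mult.commute)
    qed (use hi Ai Si in auto)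
    also have "\<dots> = norm c * measure lebesgue ?S" by simp
    also have "\<dots> \<le> m * measure lebesgue ?S" by (simp add: m_def mult_right_mono)
    also have "\<dots> < m * (2 * \<delta>)" using mS nc by (intro mult_strict_left_mono)
    also have "\<dots> = e" using nc by (simp add: \<delta>_def)
    finally show "(\<integral>x. norm (indicator A x *\<^sub>R c - h x *\<^sub>R c) \<partial>lebesgue) < e" .
  qed
qed

lemma L1_triangle:
  fixes f g h :: "'a \<Rightarrow> complex"
  assumes "integrable M f" "integrable M g" "integrable M h"
  shows "(\<integral>x. norm (f x - h x) \<partial>M) \<le> (\<integral>x. norm (f x - g x) \<partial>M) + (\<integral>x. norm (g x - h x) \<partial>M)"
proof -
  have "norm (f x - h x) \<le> norm (f x - g x) + norm (g x - h x)" for x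
    using norm_triangle_ineq[of "f x - g x" "g x - h x"] by simp
  then have "(\<integral>x. norm (f x - h x) \<partial>M) \<le> (\<integral>x. norm (f x - g x) + norm (g x - h x) \<partial>M)"
    using assms by (intro integral_mono) auto
  then show ?thesis using assms by simp
qed

lemma L1_approx_continuous:
  fixes f :: "'a::euclidean_space \<Rightarrow> complex"
  assumes "integrable lebesgue f" "e > 0"
  shows "\<exists>g. continuous_on UNIV g \<and> integrable lebesgue g \<and> (\<integral>x. norm (f x - g x) \<partial>lebesgue) < e"
  using assms
proof (induction arbitrary: e rule: integrable_induct)
  case (base A c)
  then show ?case by (intro L1_approx_indicator) auto
next
  case (add f1 f2)
  obtain g1 where g1: "continuous_on UNIV g1" "integrable lebesgue g1" "(\<integral>x. norm (f1 x - g1 x) \<partial>lebesgue) < e/2"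
    using add.IH(1)[of "e/2"] add.prems by auto
  obtain g2 where g2: "continuous_on UNIV g2" "integrable lebesgue g2" "(\<integral>x. norm (f2 x - g2 x) \<partial>lebesgue) < e/2"
    using add.IH(2)[of "e/2"] add.prems by auto
  show ?case
  proof (intro exI conjI)
    show "continuous_on UNIV (\<lambda>x. g1 x + g2 x)" using g1 g2 by (intro continuous_intros)
    show "integrable lebesgue (\<lambda>x. g1 x + g2 x)" using g1 g2 by simp
    have "(\<integral>x. norm (f1 x + f2 x - (g1 x + g2 x)) \<partial>lebesgue)
        \<le> (\<integral>x. norm (f1 x - g1 x) + norm (f2 x - g2 x) \<partial>lebesgue)"
      using add.hyps g1 g2 by (intro integral_mono) (auto intro: norm_diff_triangle_ineq)
    also have "\<dots> = (\<integral>x. norm (f1 x - g1 x) \<partial>lebesgue) + (\<integral>x. norm (f2 x - g2 x) \<partial>lebesgue)"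
      using add.hyps g1 g2 by simp
    finally show "(\<integral>x. norm (f1 x + f2 x - (g1 x + g2 x)) \<partial>lebesgue) < e"
      using g1(3) g2(3) by linarith
  qed
next
  case (lim f s)
  have [measurable]: "f \<in> borel_measurable lebesgue" "\<And>i. s i \<in> borel_measurable lebesgue"
    using lim.hyps by auto
  \<comment> \<open>The factor 3 in the majorant comes from the induction rule, which supplies
    approximants \<open>s i\<close> of modulus at most twice that of \<open>f\<close>.\<close>
  have "(\<lambda>i. \<integral>x. norm (f x - s i x) \<partial>lebesgue) \<longlonglongrightarrow> (\<integral>x. 0 \<partial>(lebesgue :: 'a measure))"
  proof (rule integral_dominated_convergence[where w="\<lambda>x. 3 * norm (f x)"])
    show "AE x in lebesgue. (\<lambda>i. norm (f x - s i x)) \<longlonglongrightarrow> 0"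
    proof (rule AE_I2)
      fix x :: 'a assume "x \<in> space lebesgue"
      from tendsto_diff[OF tendsto_const[of "f x"] lim.hyps(2)[OF this]]
      show "(\<lambda>i. norm (f x - s i x)) \<longlonglongrightarrow> 0" by (simp add: tendsto_norm_zero_iff)
    qed
    show "AE x in lebesgue. norm (norm (f x - s i x)) \<le> 3 * norm (f x)" for i
    proof (rule AE_I2)
      fix x :: 'a assume "x \<in> space lebesgue"
      from lim.hyps(3)[OF this, of i] norm_triangle_ineq4[of "f x" "s i x"]
      show "norm (norm (f x - s i x)) \<le> 3 * norm (f x)" by simp
    qed
    show "integrable lebesgue (\<lambda>x. 3 * norm (f x))" using lim.hyps(4) by simp
  qed auto
  then have "eventually (\<lambda>i. (\<integral>x. norm (f x - s i x) \<partial>lebesgue) < e/2) sequentially"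
    using lim.prems by (intro order_tendstoD(2)[where y=0]) auto
  from eventually_happens'[OF sequentially_bot this] obtain i where i: "(\<integral>x. norm (f x - s i x) \<partial>lebesgue) < e/2"
    by blast
  obtain g where g: "continuous_on UNIV g" "integrable lebesgue g" "(\<integral>x. norm (s i x - g x) \<partial>lebesgue) < e/2"
    using lim.IH[of "e/2" i] lim.prems by auto
  have "(\<integral>x. norm (f x - g x) \<partial>lebesgue) < e"
    using L1_triangle[OF lim.hyps(4) lim.hyps(1)[of i] g(2)] i g(3) by linarith
  with g show ?case by blast
qed

lemma L1_approx_cc_fun:
  fixes f :: "'a::euclidean_space \<Rightarrow> complex"
  assumes f: "integrable lebesgue f" and e: "e > 0"
  obtains g where "cc_fun g" "(\<integral>x. norm (f x - g x) \<partial>lebesgue) < e"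
proof -
  obtain g where g: "continuous_on UNIV g" "integrable lebesgue g" "(\<integral>x. norm (f x - g x) \<partial>lebesgue) < e/2"
    using L1_approx_continuous[OF f, of "e/2"] e by auto
  define ct :: "nat \<Rightarrow> 'a \<Rightarrow> real" where "ct n x = max 0 (min 1 (real n + 1 - norm x))" for n x
  have ct01: "0 \<le> ct n x" "ct n x \<le> 1" for n x by (auto simp: ct_def)
  have ctc: "continuous_on UNIV (ct n)" for n unfolding ct_def by (intro continuous_intros)
  have cont: "continuous_on UNIV (\<lambda>x. of_real (ct n x) * g x)" for n
    using ctc g(1) by (intro continuous_intros)
  have cc: "cc_fun (\<lambda>x. of_real (ct n x) * g x)" for n
    unfolding cc_fun_def using cont by (auto intro!: exI[of _ "real n + 1"] simp: ct_def)
  note [measurable] = cc_fun_measurable[OF cc] borel_measurable_integrable[OF g(2)]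
  have nle: "norm (g x - of_real (ct n x) * g x) \<le> norm (g x)" for n x
  proof -
    have "g x - of_real (ct n x) * g x = of_real (1 - ct n x) * g x" by (simp add: algebra_simps)
    then show ?thesis using ct01[of n x] by (simp only: norm_mult norm_of_real) (simp add: mult_left_le_one_le)
  qed
  have "(\<lambda>n. \<integral>x. norm (g x - of_real (ct n x) * g x) \<partial>lebesgue) \<longlonglongrightarrow> (\<integral>x. 0 \<partial>(lebesgue :: 'a measure))"
  proof (rule integral_dominated_convergence[where w="\<lambda>x. norm (g x)"])
    show "AE x in lebesgue. (\<lambda>n. norm (g x - of_real (ct n x) * g x)) \<longlonglongrightarrow> 0"
    proof (rule AE_I2)
      fix x :: 'a
      have "eventually (\<lambda>n. norm (g x - of_real (ct n x) * g x) = 0) sequentially"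
        using eventually_ge_at_top[of "nat \<lceil>norm x\<rceil>"]
      proof eventually_elim
        fix n assume "nat \<lceil>norm x\<rceil> \<le> n"
        then have "norm x \<le> real n" by linarith
        then have "ct n x = 1" by (simp add: ct_def)
        then show "norm (g x - of_real (ct n x) * g x) = 0" by simp
      qed
      then show "(\<lambda>n. norm (g x - of_real (ct n x) * g x)) \<longlonglongrightarrow> 0" by (rule tendsto_eventually)
    qed
  qed (use g nle in auto)
  then have "eventually (\<lambda>n. (\<integral>x. norm (g x - of_real (ct n x) * g x) \<partial>lebesgue) < e/2) sequentially"
    using e by (intro order_tendstoD(2)[where y=0]) auto
  from eventually_happens'[OF sequentially_bot this] obtain n where n: "(\<integral>x. norm (g x - of_real (ct n x) * g x) \<partial>lebesgue) < e/2"
    by blast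
  have gn: "integrable lebesgue (\<lambda>x. of_real (ct n x) * g x)"
    using cc_fun_in_Lp[OF cc, of 1 n] by (simp add: in_Lp_def integrable_norm_iff)
  have "(\<integral>x. norm (f x - of_real (ct n x) * g x) \<partial>lebesgue) < e"
    using L1_triangle[OF f g(2) gn] n g(3) by linarith
  with cc that show thesis by blast
qed

text \<open>Reduction to p = 1: between functions bounded by \<open>N\<close>, the p-th power of the
  difference is at most (2N)^(p-1) times the difference. An L^1 approximant need not respect the
  bound, so it is composed with the nearest-point projection \<open>\<pi>\<close> onto the disc of
  radius \<open>N\<close>. This map is 1-Lipschitz and fixes the values of \<open>h\<close>, so the
  error does not grow; it fixes 0, so the support stays bounded.\<close>

lemma Lp_approx_cc_fun:
  fixes f :: "'a::euclidean_space \<Rightarrow> complex"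
  assumes p: "1 \<le> p" and f: "in_Lp p lebesgue f" and e: "e > 0"
  obtains g where "cc_fun g" "Lp_norm p lebesgue (\<lambda>x. f x - g x) < e"
proof -
  have fm[measurable]: "f \<in> borel_measurable lebesgue" using f by (simp add: in_Lp_def)
  define A where "A n = {x. norm x \<le> real n \<and> norm (f x) \<le> real n}" for n
  have A[measurable]: "A n \<in> sets lebesgue" for n
  proof -
    have "A n = cball 0 (real n) \<inter> {x \<in> space lebesgue. norm (f x) \<le> real n}" by (auto simp: A_def)
    also have "\<dots> \<in> sets lebesgue"
    proof (rule sets.Int)
      show "{x \<in> space lebesgue. norm (f x) \<le> real n} \<in> sets lebesgue" by measurable
    qed simp
    finally show ?thesis .
  qed
  have "(\<lambda>n. Lp_norm p lebesgue (\<lambda>x. f x - indicator (A n) x * f x)) \<longlonglongrightarrow> 0"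
  proof (rule Lp_norm_truncation_tendsto[OF p f A])
    fix x
    show "eventually (\<lambda>n. x \<in> A n) sequentially"
      using eventually_ge_at_top[of "nat \<lceil>max (norm x) (norm (f x))\<rceil>"]
      by eventually_elim (auto simp: A_def nat_le_iff ceiling_le_iff)
  qed
  then have "eventually (\<lambda>n. Lp_norm p lebesgue (\<lambda>x. f x - indicator (A n) x * f x) < e/2) sequentially"
    using e by (intro order_tendstoD(2)[where y=0]) auto
  then have "eventually (\<lambda>n. Lp_norm p lebesgue (\<lambda>x. f x - indicator (A n) x * f x) < e/2 \<and> 1 \<le> n) sequentially"
    using eventually_ge_at_top by (rule eventually_conj)
  from eventually_happens'[OF sequentially_bot this] obtain n where n: "Lp_norm p lebesgue (\<lambda>x. f x - indicator (A n) x * f x) < e/2" "1 \<le> n"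
    by blast
  define N where "N = real n"
  have N: "N \<ge> 1" using n(2) by (simp add: N_def)
  define h where "h x = indicator (A n) x * f x" for x
  have hm[measurable]: "h \<in> borel_measurable lebesgue" unfolding h_def by measurable
  have hN: "norm (h x) \<le> N" for x by (auto simp: h_def A_def N_def indicator_def)
  have hb: "AE x in lebesgue. norm (h x) \<le> N * indicator (cball 0 N) x"
    by (auto simp: h_def A_def N_def indicator_def)
  have hLp: "in_Lp q lebesgue h" if "1 \<le> q" for q
    by (rule in_Lp_bounded_support(1)[OF that hm _ _ hb]) (use N in auto)
  have hi: "integrable lebesgue h"
    using hLp[of 1] by (simp add: in_Lp_def integrable_norm_iff)
  \<comment> \<open>Chosen to solve (2N)^(p-1) \<delta> = (e/2)^p.\<close>
  define \<delta> where "\<delta> = (e/2) powr p / (2 * N) powr (p - 1)"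
  have \<delta>: "\<delta> > 0" using e N by (simp add: \<delta>_def)
  obtain g where g: "cc_fun g" "(\<integral>x. norm (h x - g x) \<partial>lebesgue) < \<delta>"
    using L1_approx_cc_fun[OF hi \<delta>] by blast
  define \<pi> :: "complex \<Rightarrow> complex" where "\<pi> = closest_point (cball 0 N)"
  have ne: "cball (0::complex) N \<noteq> {}" using N by simp
  have \<pi>N: "norm (\<pi> z) \<le> N" for z
    using closest_point_in_set[OF _ ne, of z] by (simp add: \<pi>_def)
  have \<pi>id: "\<pi> z = z" if "norm z \<le> N" for z
    using that by (simp add: \<pi>_def closest_point_self)
  have \<pi>lip: "norm (\<pi> z - \<pi> w) \<le> norm (z - w)" for z w
    using closest_point_lipschitz[OF _ _ ne, of z w] by (simp add: \<pi>_def dist_norm)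
  define g' where "g' x = \<pi> (g x)" for x
  have g': "cc_fun g'"
  proof -
    have "continuous_on UNIV (\<pi> \<circ> g)"
      using g(1) ne unfolding cc_fun_def \<pi>_def by (intro continuous_on_compose continuous_on_closest_point) auto
    moreover have "\<exists>R. \<forall>x. R < norm x \<longrightarrow> g' x = 0"
      using g(1) \<pi>id[of 0] N unfolding cc_fun_def g'_def by (metis norm_zero zero_le_one order_trans)
    ultimately show ?thesis by (simp add: cc_fun_def g'_def[abs_def] o_def)
  qed
  note [measurable] = cc_fun_measurable[OF g'] cc_fun_measurable[OF g(1)]
  have d1: "norm (h x - g' x) \<le> norm (h x - g x)" for x
    using \<pi>lip[of "h x" "g x"] hN[of x] by (simp add: \<pi>id g'_def)
  have d2: "norm (h x - g' x) \<le> 2 * N" for x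
    using norm_triangle_ineq4[of "h x" "g' x"] hN[of x] \<pi>N[of "g x"] by (simp add: g'_def)
  have d3: "norm (h x - g' x) powr p \<le> (2 * N) powr (p - 1) * norm (h x - g x)" for x
  proof -
    have "norm (h x - g' x) powr p = norm (h x - g' x) powr (p - 1) * norm (h x - g' x)"
      using powr_mult_base[of "norm (h x - g' x)" "p - 1"] by (simp add: mult.commute)
    also have "\<dots> \<le> (2 * N) powr (p - 1) * norm (h x - g x)"
      using d1[of x] d2[of x] p by (intro mult_mono powr_mono2) auto
    finally show ?thesis .
  qed
  have gi: "integrable lebesgue g"
    using cc_fun_in_Lp[OF g(1), of 1] by (simp add: in_Lp_def integrable_norm_iff)
  have hg: "in_Lp p lebesgue (\<lambda>x. h x - g' x)"
    by (rule in_Lp_diff[OF p hLp[OF p] cc_fun_in_Lp[OF g' p]])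
  have "(\<integral>x. norm (h x - g' x) powr p \<partial>lebesgue) \<le> (\<integral>x. (2 * N) powr (p - 1) * norm (h x - g x) \<partial>lebesgue)"
    using hg hi gi by (intro integral_mono d3) (auto simp: in_Lp_def)
  also have "\<dots> = (2 * N) powr (p - 1) * (\<integral>x. norm (h x - g x) \<partial>lebesgue)" by simp
  also have "\<dots> \<le> (2 * N) powr (p - 1) * \<delta>" using g(2) by (intro mult_left_mono) auto
  also have "\<dots> = (e/2) powr p" using N by (simp add: \<delta>_def)
  finally have "Lp_norm p lebesgue (\<lambda>x. h x - g' x) \<le> e/2"
    using p e by (subst Lp_norm_le_iff) auto
  moreover have "Lp_norm p lebesgue (\<lambda>x. f x - g' x) \<le> Lp_norm p lebesgue (\<lambda>x. f x - h x) + Lp_norm p lebesgue (\<lambda>x. h x - g' x)"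
    by (rule Lp_norm_triangle_diff[OF p in_Lp_diff[OF p f hLp[OF p]] hg])
  moreover have "Lp_norm p lebesgue (\<lambda>x. f x - h x) < e/2" using n(1) by (simp add: h_def)
  ultimately have "Lp_norm p lebesgue (\<lambda>x. f x - g' x) < e" by linarith
  with g' that show thesis by blast
qed

subsection \<open>Dilates of periodic functions\<close>

lemma norm_diff_le_onorm_matrix_inv:
  fixes A :: "real^'n^'n"
  assumes "invertible A"
  shows "norm (x - y) \<le> onorm (\<lambda>x. matrix_inv A *v x) * norm (A *v x - A *v y)"
proof -
  have "x - y = matrix_inv A *v (A *v x - A *v y)"
    using assms by (simp add: matrix_vector_mult_diff_distrib matrix_inv_cancel)
  then show ?thesis
    using onorm[OF matrix_vector_mul_bounded_linear[of "matrix_inv A"], of "A *v x - A *v y"] by simp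
qed

text \<open>A displacement of at most \<open>T\<close> after dilation is one of at most
  \<open>T\<close> times the norm of the inverse matrix before it, hence eventually below the
  modulus of uniform continuity. It is also kept below 1, so that both values vanish when
  \<open>x\<close> is outside the ball of radius \<open>R + 1\<close>. The point \<open>t\<close> is
  arbitrary so that the same estimate serves cells of the tiling and supports of generators.\<close>

lemma sampling_error:
  fixes a :: "nat \<Rightarrow> real^'n^'n"
  assumes a_inv: "\<And>j. j \<ge> 1 \<Longrightarrow> invertible (a j)" and a_exp: "expanding a" and u: "cc_fun u"
    and R: "\<And>x. u x \<noteq> 0 \<Longrightarrow> x \<in> cball 0 R" and \<epsilon>: "\<epsilon> > 0"
  shows "eventually (\<lambda>j. \<forall>x t. norm (a j *v x - t) \<le> T \<longrightarrow>
    norm (u x - u (matrix_inv (a j) *v t)) \<le> \<epsilon> * indicator (cball 0 (R + 1)) x) sequentially"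
proof -
  obtain d where d: "d > 0" "\<And>x y. norm (x - y) < d \<Longrightarrow> norm (u x - u y) < \<epsilon>"
    using cc_fun_uniformly_continuous[OF u \<epsilon>] by metis
  have "(\<lambda>j. onorm (\<lambda>x. matrix_inv (a j) *v x) * T) \<longlonglongrightarrow> 0"
    using tendsto_mult_left_zero[OF a_exp[unfolded expanding_def]] .
  then have "eventually (\<lambda>j. onorm (\<lambda>x. matrix_inv (a j) *v x) * T < min d 1) sequentially"
    using d(1) by (intro order_tendstoD(2)[where y=0]) auto
  then show ?thesis using eventually_ge_at_top[of 1]
  proof eventually_elim
    case (elim j)
    have A: "invertible (a j)" using elim a_inv by simp
    show ?case
    proof (intro allI impI)
      fix x t assume xt: "norm (a j *v x - t) \<le> T"
      define y where "y = matrix_inv (a j) *v t"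
      have "norm (x - y) \<le> onorm (\<lambda>x. matrix_inv (a j) *v x) * norm (a j *v x - t)"
        using norm_diff_le_onorm_matrix_inv[OF A, of x y] A by (simp add: y_def matrix_inv_cancel)
      also have "\<dots> \<le> onorm (\<lambda>x. matrix_inv (a j) *v x) * T"
        using xt by (intro mult_left_mono onorm_pos_le matrix_vector_mul_bounded_linear)
      finally have near: "norm (x - y) < min d 1" using elim by linarith
      have "norm (u x - u y) \<le> \<epsilon> * indicator (cball 0 (R + 1)) x"
      proof (cases "x \<in> cball 0 (R + 1)")
        case True
        then show ?thesis using d(2)[of x y] near by (simp add: less_imp_le)
      next
        case False
        then have "u x = 0" using R[of x] by auto
        moreover have "u y = 0"
        proof (rule ccontr)
          assume "u y \<noteq> 0"
          then have "norm y \<le> R" using R by auto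
          then have "norm x \<le> R + 1"
            using near norm_triangle_sub[of x y] by linarith
          with False show False by simp
        qed
        ultimately show ?thesis using \<epsilon> by simp
      qed
      then show "norm (u x - u (matrix_inv (a j) *v t)) \<le> \<epsilon> * indicator (cball 0 (R + 1)) x"
        by (simp add: y_def)
    qed
  qed
qed

lemma finite_lattice_bounded:
  "finite {k :: int^'n. norm (lattice_vec k) \<le> B}"
proof -
  let ?I = "{- \<lceil>\<bar>B\<bar>\<rceil> .. \<lceil>\<bar>B\<bar>\<rceil>}"
  have "{k :: int^'n. norm (lattice_vec k) \<le> B} \<subseteq> (\<lambda>f. \<chi> i. f i) ` (UNIV \<rightarrow>\<^sub>E ?I)"
  proof
    fix k :: "int^'n" assume "k \<in> {k. norm (lattice_vec k) \<le> B}"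
    then have B: "norm (lattice_vec k) \<le> B" by simp
    have "k $ i \<in> ?I" for i
    proof -
      have "\<bar>real_of_int (k $ i)\<bar> \<le> B"
        using component_le_norm_cart[of "lattice_vec k" i] B by (simp add: lattice_vec_def)
      then show ?thesis by (simp add: abs_le_iff) linarith
    qed
    then have "(\<lambda>i. k $ i) \<in> UNIV \<rightarrow>\<^sub>E ?I" by auto
    then show "k \<in> (\<lambda>f. \<chi> i. f i) ` (UNIV \<rightarrow>\<^sub>E ?I)"
      by (intro image_eqI[where x="\<lambda>i. k $ i"]) (auto simp: vec_eq_iff)
  qed
  then show ?thesis
    by (rule finite_subset) (intro finite_imageI finite_PiE finite, auto)
qed

lemma integrable_indicator_fmeasurable:
  assumes "S \<in> fmeasurable M"
  shows "integrable M (indicator S :: _ \<Rightarrow> real)"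
  using fmeasurableD2[OF assms] fmeasurableD[OF assms]
  by (intro integrable_real_indicator) (simp_all only: less_top infinity_ennreal_def)

section \<open>Sampling on the dilated lattice\<close>

definition sample_point :: "real^'n^'n \<Rightarrow> real^'n^'n \<Rightarrow> int^'n \<Rightarrow> real^'n" where
  "sample_point A b k = matrix_inv A *v (lat b k)"

text \<open>Constant on each cell, that is, each preimage under \<open>A\<close> of a lattice
  translate of \<open>tile b\<close>, with the sample of \<open>u\<close> belonging to that cell as
  its value. It turns sums over samples into integrals.\<close>

definition step_fun :: "real^'n^'n \<Rightarrow> real^'n^'n \<Rightarrow> (real^'n \<Rightarrow> complex) \<Rightarrow> real^'n \<Rightarrow> complex" where
  "step_fun A b u x = u (sample_point A b (tile_index b (A *v x)))"

lemma finite_sampling_support: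
  fixes A b :: "real^'n^'n"
  assumes A: "invertible A" and b: "invertible b" and u: "cc_fun u"
  shows "finite {k. u (sample_point A b k) \<noteq> 0}"
proof -
  obtain R where R: "\<And>x. u x \<noteq> 0 \<Longrightarrow> x \<in> cball 0 R" using cc_fun_support[OF u] by metis
  let ?O = "onorm (\<lambda>x. matrix_inv b *v (A *v x))"
  have bl: "bounded_linear (\<lambda>x. matrix_inv b *v (A *v x))"
    using bounded_linear_compose[OF matrix_vector_mul_bounded_linear matrix_vector_mul_bounded_linear] .
  have "norm (lattice_vec k) \<le> ?O * R" if "u (sample_point A b k) \<noteq> 0" for k
  proof -
    have y: "norm (sample_point A b k) \<le> R" using R[OF that] by simp
    have "lattice_vec k = matrix_inv b *v (A *v sample_point A b k)"
      using A b by (simp add: sample_point_def matrix_inv_cancel)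
    then have "norm (lattice_vec k) \<le> ?O * norm (sample_point A b k)"
      using onorm[OF bl, of "sample_point A b k"] by simp
    also have "\<dots> \<le> ?O * R"
      using y onorm_pos_le[OF bl] by (rule mult_left_mono)
    finally show ?thesis .
  qed
  then have "{k. u (sample_point A b k) \<noteq> 0} \<subseteq> {k. norm (lattice_vec k) \<le> ?O * R}" by blast
  then show ?thesis using finite_lattice_bounded by (rule finite_subset)
qed

lemma indicator_tile_eq:
  assumes "invertible b"
  shows "indicator (tile b) (x - lat b k) = (if k = tile_index b x then 1 else 0)"
  using diff_mem_tile_iff[OF assms, of x k] by (simp add: indicator_def)

text \<open>At each point exactly one cell contributes, so any \<open>h\<close> with
  \<open>h 0 = 0\<close> may be applied term by term. It is used with the identity, for integrals,
  and with the p-th power of the modulus, for norms.\<close>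

lemma step_fun_eq_sum:
  fixes A b :: "real^'n^'n" and h :: "complex \<Rightarrow> 'a::real_algebra_1"
  assumes A: "invertible A" and b: "invertible b" and u: "cc_fun u" and h: "h 0 = 0"
  shows "h (step_fun A b u x) = (\<Sum>k | u (sample_point A b k) \<noteq> 0.
    h (u (sample_point A b k)) * indicator (tile b) (A *v x - lat b k))"
proof -
  have "(\<Sum>k | u (sample_point A b k) \<noteq> 0. h (u (sample_point A b k)) * indicator (tile b) (A *v x - lat b k))
    = (\<Sum>k | u (sample_point A b k) \<noteq> 0. if k = tile_index b (A *v x) then h (u (sample_point A b k)) else 0)"
    by (intro sum.cong) (auto simp: indicator_tile_eq[OF b])
  also have "\<dots> = h (step_fun A b u x)"
    using finite_sampling_support[OF A b u] h by (auto simp: step_fun_def)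
  finally show ?thesis by simp
qed

lemma
  fixes A b :: "real^'n^'n"
  assumes A: "invertible A" and b: "invertible b"
  shows integrable_cell: "integrable lebesgue (\<lambda>x. indicator (tile b) (A *v x - lat b k) :: real)"
    and integral_cell: "(\<integral>x. indicator (tile b) (A *v x - lat b k) \<partial>lebesgue) = \<bar>det b\<bar> / \<bar>det A\<bar>"
proof -
  have i: "integrable lebesgue (indicator (tile b) :: real^'n \<Rightarrow> real)"
    by (intro integrable_indicator_fmeasurable tile_lmeasurable)
  then show "integrable lebesgue (\<lambda>x. indicator (tile b) (A *v x - lat b k) :: real)"
    using integrable_affine_matrix[OF A borel_measurable_integrable[OF i], of "- (lat b k)"] by simp
  have "(\<integral>x. indicator (tile b) x \<partial>lebesgue) = measure lebesgue (tile b)" by simp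
  then have "\<bar>det b\<bar> = \<bar>det A\<bar> * (\<integral>x. indicator (tile b) (A *v x - lat b k) \<partial>lebesgue)"
    using integral_affine_matrix[OF A borel_measurable_integrable[OF i], of "- (lat b k)"]
    by (simp only: tile_lmeasurable(2) real_scaleR_def add_uminus_conv_diff)
  then show "(\<integral>x. indicator (tile b) (A *v x - lat b k) \<partial>lebesgue) = \<bar>det b\<bar> / \<bar>det A\<bar>"
    using A by (simp add: invertible_det_nz)
qed

lemma integrable_cell_complex:
  fixes A b :: "real^'n^'n"
  assumes A: "invertible A" and b: "invertible b"
  shows "integrable lebesgue (\<lambda>x. indicator (tile b) (A *v x - lat b k) :: complex)"
proof -
  have "integrable lebesgue (\<lambda>x. complex_of_real (indicator (tile b) (A *v x - lat b k)))"
    by (intro integrable_of_real integrable_cell A b)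
  moreover have "complex_of_real (indicator (tile b) x) = indicator (tile b) x" for x
    by (simp add: indicator_def)
  ultimately show ?thesis by simp
qed

lemma integrable_step_fun:
  fixes A b :: "real^'n^'n"
  assumes A: "invertible A" and b: "invertible b" and u: "cc_fun u"
  shows "integrable lebesgue (step_fun A b u)"
  unfolding step_fun_eq_sum[OF A b u, where h="\<lambda>x. x", OF refl, abs_def]
  by (intro Bochner_Integration.integrable_sum integrable_mult_right integrable_cell_complex A b)

lemma step_fun_error:
  assumes b: "invertible b" and T: "\<And>x. x \<in> tile b \<Longrightarrow> norm x \<le> T"
    and s: "\<And>x t. norm (A *v x - t) \<le> T \<Longrightarrow> norm (u x - u (matrix_inv A *v t)) \<le> e x"
  shows "norm (u x - step_fun A b u x) \<le> e x"
  unfolding step_fun_def sample_point_def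
  using T[of "A *v x - lat b (tile_index b (A *v x))"] diff_mem_tile_iff[OF b, of "A *v x"]
  by (intro s) simp

lemma integral_cell_periodic:
  fixes A b :: "real^'n^'n" and g :: "real^'n \<Rightarrow> complex"
  assumes A: "invertible A" and g: "g \<in> borel_measurable lebesgue"
    and per: "\<And>x k. g (x - lat b k) = g x"
    and mean: "(\<integral>x. indicator (tile b) x * g x \<partial>lebesgue) = 0"
  shows "(\<integral>x. indicator (tile b) (A *v x - lat b k) * g (A *v x) \<partial>lebesgue) = 0"
proof -
  have "(\<lambda>x. indicator (tile b) x * g x) \<in> borel_measurable lebesgue" using g by measurable
  from integral_affine_matrix[OF A this, of "- (lat b k)"]
  have "\<bar>det A\<bar> *\<^sub>R (\<integral>x. indicator (tile b) (A *v x - lat b k) * g (A *v x - lat b k) \<partial>lebesgue) = 0"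
    using mean by simp
  then show ?thesis using A unfolding per by (simp add: invertible_det_nz)
qed

text \<open>Besides measurability, only three properties of the oscillating function enter the
  averaging argument: boundedness, periodicity and mean zero over a tile. The instances are the
  centred periodizations of truncated generators.\<close>

locale periodic_oscillation =
  fixes a :: "nat \<Rightarrow> real^'n^'n" and b :: "real^'n^'n" and g :: "real^'n \<Rightarrow> complex" and M :: real
  assumes a_inv: "\<And>j. j \<ge> 1 \<Longrightarrow> invertible (a j)"
    and a_exp: "expanding a"
    and b_inv: "invertible b"
    and g_meas: "g \<in> borel_measurable lebesgue"
    and g_bound: "\<And>x. norm (g x) \<le> M"
    and g_per: "\<And>x k. g (x - lat b k) = g x"
    and g_mean: "(\<integral>x. indicator (tile b) x * g x \<partial>lebesgue) = 0"
begin

lemma M_nonneg: "0 \<le> M"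
  using norm_ge_zero g_bound order_trans by blast

lemma norm_mult_g_le: "norm (z * g x) \<le> M * norm z"
  unfolding norm_mult using mult_left_mono[OF g_bound[of x] norm_ge_zero[of z]] by (simp only: mult.commute)

lemma g_dilate_measurable: "j \<ge> 1 \<Longrightarrow> (\<lambda>x. g (a j *v x)) \<in> borel_measurable lebesgue"
  using borel_measurable_affine_matrix[OF a_inv g_meas, of j 0] by simp

lemma integrable_mult_g:
  assumes "j \<ge> 1" "integrable lebesgue u"
  shows "integrable lebesgue (\<lambda>x. u x * g (a j *v x))"
proof (rule Bochner_Integration.integrable_bound[where f="\<lambda>x. M * norm (u x)"])
  show "(\<lambda>x. u x * g (a j *v x)) \<in> borel_measurable lebesgue"
    using g_dilate_measurable[OF assms(1)] borel_measurable_integrable[OF assms(2)] by measurable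
  show "AE x in lebesgue. norm (u x * g (a j *v x)) \<le> norm (M * norm (u x))"
    using norm_mult_g_le M_nonneg by (intro AE_I2) simp
qed (use assms in auto)

lemma norm_integral_mult_g:
  assumes "j \<ge> 1" "integrable lebesgue u"
  shows "norm (\<integral>x. u x * g (a j *v x) \<partial>lebesgue) \<le> M * (\<integral>x. norm (u x) \<partial>lebesgue)"
proof -
  have "norm (\<integral>x. u x * g (a j *v x) \<partial>lebesgue) \<le> (\<integral>x. norm (u x * g (a j *v x)) \<partial>lebesgue)"
    by (rule integral_norm_bound)
  also have "\<dots> \<le> (\<integral>x. M * norm (u x) \<partial>lebesgue)"
    using integrable_mult_g[OF assms] assms(2) by (intro integral_mono norm_mult_g_le) auto
  finally have "norm (\<integral>x. u x * g (a j *v x) \<partial>lebesgue) \<le> (\<integral>x. M * norm (u x) \<partial>lebesgue)" .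
  then show ?thesis by simp
qed

text \<open>Each cell of scale \<open>j\<close> carries a full period of the dilated
  \<open>g\<close>, so against the step function of \<open>u\<close> the integral vanishes exactly.
  What remains is the uniformly small difference between \<open>u\<close> and its step function,
  supported in a fixed ball.\<close>

lemma riemann_lebesgue_cc:
  assumes u: "cc_fun u"
  shows "(\<lambda>j. \<integral>x. u x * g (a j *v x) \<partial>lebesgue) \<longlonglongrightarrow> 0"
proof (rule LIMSEQ_I)
  fix r :: real assume r: "r > 0"
  obtain R where R: "\<And>x. u x \<noteq> 0 \<Longrightarrow> x \<in> cball 0 R" using cc_fun_support[OF u] by metis
  obtain T where T: "\<And>x. x \<in> tile b \<Longrightarrow> norm x \<le> T"
    using bounded_tile[of b] unfolding bounded_iff by metis
  let ?B = "cball 0 (R + 1) :: (real^'n) set"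
  define \<epsilon> where "\<epsilon> = r / ((M + 1) * (measure lebesgue ?B + 1))"
  have den: "(M + 1) * (measure lebesgue ?B + 1) > 0"
    using M_nonneg by (intro mult_pos_pos add_nonneg_pos) auto
  have \<epsilon>: "\<epsilon> > 0" using r den by (simp add: \<epsilon>_def)
  have um[measurable]: "u \<in> borel_measurable lebesgue" using u by (rule cc_fun_measurable)
  have ui: "integrable lebesgue u"
    using cc_fun_in_Lp[OF u, of 1] by (simp add: in_Lp_def integrable_norm_iff)
  have "eventually (\<lambda>j. \<forall>x t. norm (a j *v x - t) \<le> T \<longrightarrow>
      norm (u x - u (matrix_inv (a j) *v t)) \<le> \<epsilon> * indicator ?B x) sequentially"
    using a_inv a_exp u R \<epsilon> by (rule sampling_error)
  then have "eventually (\<lambda>j. norm (\<integral>x. u x * g (a j *v x) \<partial>lebesgue) < r) sequentially"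
    using eventually_ge_at_top[of 1]
  proof eventually_elim
    case (elim j)
    let ?A = "a j"
    have A: "invertible ?A" using elim a_inv by simp
    define K where "K = {k. u (sample_point ?A b k) \<noteq> 0}"
    define v where "v = step_fun ?A b u"
    have v_eq: "v x = (\<Sum>k\<in>K. u (sample_point ?A b k) * indicator (tile b) (?A *v x - lat b k))" for x
      unfolding v_def K_def using step_fun_eq_sum[OF A b_inv u, where h="\<lambda>x. x"] by simp
    have vi: "integrable lebesgue v"
      unfolding v_def by (rule integrable_step_fun[OF A b_inv u])
    have diff: "norm (u x - v x) \<le> \<epsilon> * indicator ?B x" for x
      unfolding v_def using elim T by (intro step_fun_error[OF b_inv]) auto
    have vg: "(\<integral>x. v x * g (?A *v x) \<partial>lebesgue) = 0"
    proof -
      let ?I = "\<lambda>k x. indicator (tile b) (?A *v x - lat b k) :: complex"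
      have "(\<integral>x. v x * g (?A *v x) \<partial>lebesgue) = (\<integral>x. (\<Sum>k\<in>K. u (sample_point ?A b k) * (?I k x * g (?A *v x))) \<partial>lebesgue)"
        by (simp add: v_eq sum_distrib_right mult.assoc)
      also have "\<dots> = (\<Sum>k\<in>K. u (sample_point ?A b k) * (\<integral>x. ?I k x * g (?A *v x) \<partial>lebesgue))"
        using integrable_mult_g[OF elim(2) integrable_cell_complex[OF A b_inv]] by (simp add: Bochner_Integration.integral_sum)
      also have "\<dots> = 0"
        using integral_cell_periodic[OF A g_meas g_per g_mean] by simp
      finally show ?thesis .
    qed
    have "(\<integral>x. u x * g (?A *v x) \<partial>lebesgue) = (\<integral>x. (u x - v x) * g (?A *v x) \<partial>lebesgue)"
      using integrable_mult_g[OF elim(2) ui] integrable_mult_g[OF elim(2) vi] vg by (simp add: left_diff_distrib)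
    also have "norm \<dots> \<le> M * (\<integral>x. norm (u x - v x) \<partial>lebesgue)"
      by (intro norm_integral_mult_g elim(2) Bochner_Integration.integrable_diff ui vi)
    also have "\<dots> \<le> M * (\<integral>x. \<epsilon> * indicator ?B x \<partial>lebesgue)"
      using M_nonneg ui vi
      by (intro mult_left_mono integral_mono diff integrable_mult_right integrable_indicator_fmeasurable) auto
    also have "\<dots> = M * measure lebesgue ?B * \<epsilon>" by simp
    also have "\<dots> < (M + 1) * (measure lebesgue ?B + 1) * \<epsilon>"
      using M_nonneg \<epsilon>
      by (intro mult_strict_right_mono) (auto simp: algebra_simps intro!: add_pos_nonneg add_nonneg_nonneg)
    also have "\<dots> = r"
    proof -
      have "D * (r / D) = r" if "D > 0" for D :: real using that by simp
      from this[OF den] show ?thesis unfolding \<epsilon>_def .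
    qed
    finally show ?case .
  qed
  then show "\<exists>no. \<forall>n\<ge>no. norm ((\<integral>x. u x * g (a n *v x) \<partial>lebesgue) - 0) < r"
    by (simp add: eventually_sequentially)
qed

lemma riemann_lebesgue:
  assumes u: "integrable lebesgue u"
  shows "(\<lambda>j. \<integral>x. u x * g (a j *v x) \<partial>lebesgue) \<longlonglongrightarrow> 0"
proof (rule LIMSEQ_I)
  fix r :: real assume r: "r > 0"
  have \<delta>: "r / (2 * (M + 1)) > 0" using r M_nonneg by simp
  obtain v where v: "cc_fun v" "(\<integral>x. norm (u x - v x) \<partial>lebesgue) < r / (2 * (M + 1))"
    using L1_approx_cc_fun[OF u \<delta>] by metis
  have vi: "integrable lebesgue v"
    using cc_fun_in_Lp[OF v(1), of 1] by (simp add: in_Lp_def integrable_norm_iff cc_fun_measurable[OF v(1)])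
  have "eventually (\<lambda>j. norm (\<integral>x. v x * g (a j *v x) \<partial>lebesgue) < r/2) sequentially"
    using tendsto_norm_zero[OF riemann_lebesgue_cc[OF v(1)]] r by (intro order_tendstoD(2)[where y=0]) auto
  then have "eventually (\<lambda>j. norm (\<integral>x. u x * g (a j *v x) \<partial>lebesgue) < r) sequentially"
    using eventually_ge_at_top[of 1]
  proof eventually_elim
    case (elim j)
    have "(\<integral>x. u x * g (a j *v x) \<partial>lebesgue) = (\<integral>x. (u x - v x) * g (a j *v x) \<partial>lebesgue) + (\<integral>x. v x * g (a j *v x) \<partial>lebesgue)"
      using integrable_mult_g[OF elim(2) u] integrable_mult_g[OF elim(2) vi] by (simp add: left_diff_distrib)
    moreover have "norm (\<integral>x. (u x - v x) * g (a j *v x) \<partial>lebesgue) \<le> r/2"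
    proof -
      have "norm (\<integral>x. (u x - v x) * g (a j *v x) \<partial>lebesgue) \<le> M * (\<integral>x. norm (u x - v x) \<partial>lebesgue)"
        using u vi by (intro norm_integral_mult_g elim) auto
      also have "\<dots> \<le> (M + 1) * (r / (2 * (M + 1)))"
        using v(2) M_nonneg by (intro mult_mono) auto
      also have "\<dots> = r/2" using M_nonneg by (simp add: field_simps)
      finally show ?thesis .
    qed
    ultimately show ?case
      using elim(1) norm_triangle_ineq[of "\<integral>x. (u x - v x) * g (a j *v x) \<partial>lebesgue" "\<integral>x. v x * g (a j *v x) \<partial>lebesgue"]
      by simp
  qed
  then show "\<exists>no. \<forall>n\<ge>no. norm ((\<integral>x. u x * g (a n *v x) \<partial>lebesgue) - 0) < r"
    by (simp add: eventually_sequentially)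
qed

text \<open>The scales are chosen one after the other: by the Riemann-Lebesgue lemma a sufficiently fine
  scale is nearly orthogonal to the sum of all the previous ones.\<close>

lemma almost_orthogonal:
  assumes f: "cc_fun f"
  shows "\<exists>C\<ge>0. \<forall>n. \<exists>F. finite F \<and> card F = n \<and> F \<subseteq> {max 1 j0..} \<and>
    (\<integral>x. (norm (\<Sum>j\<in>F. f x * g (a j *v x)))\<^sup>2 \<partial>lebesgue) \<le> real n * C"
proof -
  obtain Mf where Mf: "Mf > 0" "\<And>x. norm (f x) \<le> Mf" using cc_fun_bounded[OF f] by metis
  have fm[measurable]: "f \<in> borel_measurable lebesgue" using f by (rule cc_fun_measurable)
  have fi: "integrable lebesgue f"
    using cc_fun_in_Lp[OF f, of 1] by (simp add: in_Lp_def integrable_norm_iff)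
  define G where "G j x = f x * g (a j *v x)" for j x
  have Gm: "G j \<in> borel_measurable lebesgue" if "j \<ge> 1" for j
    unfolding G_def using g_dilate_measurable[OF that] by measurable
  have Gb: "norm (G j x) \<le> Mf * M" for j x
    unfolding G_def norm_mult using Mf g_bound by (intro mult_mono) auto
  have Gi: "integrable lebesgue (G j)" if "j \<ge> 1" for j
    unfolding G_def using integrable_mult_g[OF that fi] .
  have sq: "integrable lebesgue (\<lambda>x. cnj (h1 x) * h2 x)"
    if "integrable lebesgue h2" "h1 \<in> borel_measurable lebesgue" "\<And>x. norm (h1 x) \<le> B"
    for h1 h2 :: "real^'n \<Rightarrow> complex" and B
  proof (rule Bochner_Integration.integrable_bound[where f="\<lambda>x. B * norm (h2 x)"])
    have "cnj \<in> borel_measurable borel"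
      by (intro borel_measurable_continuous_onI continuous_intros)
    then show "(\<lambda>x. cnj (h1 x) * h2 x) \<in> borel_measurable lebesgue"
      by (intro borel_measurable_times borel_measurable_integrable[OF that(1)] measurable_compose[OF that(2)])
    show "AE x in lebesgue. norm (cnj (h1 x) * h2 x) \<le> norm (B * norm (h2 x))"
    proof (rule AE_I2)
      fix x
      have "0 \<le> B" using that(3)[of x] norm_ge_zero order_trans by blast
      then show "norm (cnj (h1 x) * h2 x) \<le> norm (B * norm (h2 x))"
        using that(3)[of x] by (simp add: norm_mult mult_right_mono)
    qed
  qed (use that in auto)
  have nsq: "(norm z)\<^sup>2 = Re (cnj z * z)" for z
    by (subst cmod_power2) (simp add: power2_eq_square)
  \<comment> \<open>\<open>C - 1\<close> bounds the squared L^2 norm of every single term. The extra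
    1 pays for the cross term that each new scale brings.\<close>
  define C where "C = Mf * M * (M * (\<integral>x. norm (f x) \<partial>lebesgue)) + 1"
  have C0: "C \<ge> 0" using Mf M_nonneg by (simp add: C_def)
  have G2: "(\<integral>x. (norm (G j x))\<^sup>2 \<partial>lebesgue) \<le> C - 1" if "j \<ge> 1" for j
  proof -
    have "(\<integral>x. (norm (G j x))\<^sup>2 \<partial>lebesgue) \<le> (\<integral>x. Mf * M * (M * norm (f x)) \<partial>lebesgue)"
    proof (rule integral_mono)
      show "integrable lebesgue (\<lambda>x. (norm (G j x))\<^sup>2)"
        unfolding nsq using sq[OF Gi[OF that] Gm[OF that] Gb] by (intro integrable_Re)
      fix x
      have "norm (G j x) \<le> M * norm (f x)"
        unfolding G_def by (rule norm_mult_g_le)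
      then show "(norm (G j x))\<^sup>2 \<le> Mf * M * (M * norm (f x))"
        unfolding power2_eq_square using Gb[of j x] Mf(1) M_nonneg by (intro mult_mono) auto
    qed (use fi in auto)
    then show ?thesis by (simp add: C_def)
  qed
  have "\<exists>F. finite F \<and> card F = n \<and> F \<subseteq> {max 1 j0..} \<and>
    (\<integral>x. (norm (\<Sum>j\<in>F. G j x))\<^sup>2 \<partial>lebesgue) \<le> real n * C" for n
  proof (induction n)
    case 0
    show ?case by (intro exI[of _ "{}"]) simp
  next
    case (Suc n)
    then obtain F where F: "finite F" "card F = n" "F \<subseteq> {max 1 j0..}"
      "(\<integral>x. (norm (\<Sum>j\<in>F. G j x))\<^sup>2 \<partial>lebesgue) \<le> real n * C" by blast
    define h where "h x = (\<Sum>j\<in>F. G j x)" for x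
    have F1: "j \<ge> 1" if "j \<in> F" for j using F(3) that by auto
    have hm: "h \<in> borel_measurable lebesgue" unfolding h_def using Gm F1 by (intro borel_measurable_sum) auto
    have hi: "integrable lebesgue h" unfolding h_def using Gi F1 by (intro Bochner_Integration.integrable_sum) auto
    have hb: "norm (h x) \<le> real (card F) * (Mf * M)" for x
      unfolding h_def using Gb by (intro sum_norm_bound)
    \<comment> \<open>The inner product of the old sum \<open>h\<close> with the term of scale
      \<open>j\<close> is the integral of this fixed function against the dilate of
      \<open>g\<close>, so it tends to 0 as \<open>j\<close> grows.\<close>
    have ui: "integrable lebesgue (\<lambda>x. cnj (h x) * f x)" by (rule sq[OF fi hm hb])
    have "eventually (\<lambda>j. norm (\<integral>x. cnj (h x) * f x * g (a j *v x) \<partial>lebesgue) < 1/2) sequentially"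
      using tendsto_norm_zero[OF riemann_lebesgue[OF ui]] by (intro order_tendstoD(2)[where y=0]) auto
    \<comment> \<open>A scale above all of \<open>F\<close> is new, so the cardinality really
      increases; inserting 0 covers the empty \<open>F\<close>.\<close>
    then have "eventually (\<lambda>j. norm (\<integral>x. cnj (h x) * f x * g (a j *v x) \<partial>lebesgue) < 1/2 \<and>
        max (max 1 j0) (Suc (Max (insert 0 F))) \<le> j) sequentially"
      using eventually_ge_at_top by (rule eventually_conj)
    from eventually_happens'[OF sequentially_bot this] obtain j where
      j: "norm (\<integral>x. cnj (h x) * f x * g (a j *v x) \<partial>lebesgue) < 1/2" 
        "max 1 j0 \<le> j" "Max (insert 0 F) < j" by auto
    have j1: "j \<ge> 1" using j by simp
    have jF: "j \<notin> F" using j(3) F(1) by auto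
    have cross: "cnj (h x) * f x * g (a j *v x) = cnj (h x) * G j x" for x by (simp add: G_def)
    have iGG: "integrable lebesgue (\<lambda>x. cnj (G j x) * G j x)" by (rule sq[OF Gi[OF j1] Gm[OF j1] Gb])
    have ihG: "integrable lebesgue (\<lambda>x. cnj (h x) * G j x)" by (rule sq[OF Gi[OF j1] hm hb])
    have ihh: "integrable lebesgue (\<lambda>x. cnj (h x) * h x)" by (rule sq[OF hi hm hb])
    have expand: "(norm (\<Sum>j\<in>insert j F. G j x))\<^sup>2 =
        (norm (h x))\<^sup>2 + (norm (G j x))\<^sup>2 + 2 * Re (cnj (h x) * G j x)" for x
      using F(1) jF by (simp add: h_def[symmetric] cmod_power2) (simp add: power2_eq_square algebra_simps)
    have lin: "(\<integral>x. A x + B x + 2 * D x \<partial>lebesgue) =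
        (\<integral>x. A x \<partial>lebesgue) + (\<integral>x. B x \<partial>lebesgue) + 2 * (\<integral>x. D x \<partial>lebesgue)"
      if "integrable lebesgue A" "integrable lebesgue B" "integrable lebesgue D"
      for A B D :: "real^'n \<Rightarrow> real"
      using that by simp
    have "(\<integral>x. (norm (\<Sum>j\<in>insert j F. G j x))\<^sup>2 \<partial>lebesgue)
       = (\<integral>x. (norm (h x))\<^sup>2 \<partial>lebesgue) + (\<integral>x. (norm (G j x))\<^sup>2 \<partial>lebesgue)
         + 2 * (\<integral>x. Re (cnj (h x) * G j x) \<partial>lebesgue)"
      unfolding expand unfolding nsq by (rule lin[OF integrable_Re[OF ihh] integrable_Re[OF iGG] integrable_Re[OF ihG]])
    also have "(\<integral>x. Re (cnj (h x) * G j x) \<partial>lebesgue) = Re (\<integral>x. cnj (h x) * G j x \<partial>lebesgue)"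
      by (rule integral_Re[OF ihG])
    also have "\<dots> \<le> 1/2"
      using j(1) complex_Re_le_cmod[of "\<integral>x. cnj (h x) * G j x \<partial>lebesgue"] unfolding cross by linarith
    finally have "(\<integral>x. (norm (\<Sum>j\<in>insert j F. G j x))\<^sup>2 \<partial>lebesgue) \<le> real n * C + (C - 1) + 2 * (1/2)"
      using F(4) G2[OF j1] unfolding h_def by linarith
    then show ?case
      using F jF j by (intro exI[of _ "insert j F"]) (auto simp: algebra_simps)
  qed
  then show ?thesis using C0 unfolding G_def by blast
qed

text \<open>Interpolation between the uniform bound \<open>N\<close> and the L^2 bound, for p on
  either side of 2. Where the average \<open>h\<close> is at most \<open>\<delta>\<close>, its p-th
  power is at most \<open>\<delta> powr p\<close> on a fixed ball; elsewhere it is at most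
  \<open>N powr p\<close>, hence at most \<open>Q\<close> times the square of \<open>h\<close>.
  Almost orthogonality bounds the integral of that square by \<open>C / n\<close> for
  \<open>n\<close> scales.\<close>

lemma oscillation_average_small:
  assumes p: "1 \<le> p" and f: "cc_fun f" and e: "e > 0"
  shows "\<exists>F. finite F \<and> F \<noteq> {} \<and> F \<subseteq> {max 1 j0..} \<and>
    Lp_norm p lebesgue (\<lambda>x. inverse (of_nat (card F)) * (\<Sum>j\<in>F. f x * g (a j *v x))) < e"
proof -
  obtain Mf where Mf: "Mf > 0" "\<And>x. norm (f x) \<le> Mf" using cc_fun_bounded[OF f] by metis
  obtain R where R: "\<And>x. f x \<noteq> 0 \<Longrightarrow> x \<in> cball 0 R" using cc_fun_support[OF f] by metis
  let ?B = "cball 0 R :: (real^'n) set"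
  have fm[measurable]: "f \<in> borel_measurable lebesgue" using f by (rule cc_fun_measurable)
  have fi: "integrable lebesgue f"
    using cc_fun_in_Lp[OF f, of 1] by (simp add: in_Lp_def integrable_norm_iff)
  obtain C where C: "C \<ge> 0" "\<And>n. \<exists>F. finite F \<and> card F = n \<and> F \<subseteq> {max 1 j0..} \<and>
    (\<integral>x. (norm (\<Sum>j\<in>F. f x * g (a j *v x)))\<^sup>2 \<partial>lebesgue) \<le> real n * C"
    using almost_orthogonal[OF f, of j0] by blast
  define N where "N = Mf * M"
  have N: "N \<ge> 0" using Mf M_nonneg by (simp add: N_def)
  define \<mu> where "\<mu> = measure lebesgue ?B"
  have \<mu>: "\<mu> \<ge> 0" by (simp add: \<mu>_def)
  \<comment> \<open>With this value the part where \<open>h\<close> is small contributes at most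
    (e/2)^p, and \<open>gap\<close> is what is left for the L^2 part. The \<open>+ 1\<close> keeps
    the denominator positive whatever the measure of the ball.\<close>
  define \<delta> where "\<delta> = (e / 2) / (\<mu> + 1) powr (1/p)"
  have \<delta>: "\<delta> > 0" using e \<mu> by (simp add: \<delta>_def)
  have \<delta>\<mu>: "\<delta> powr p * \<mu> \<le> (e/2) powr p"
  proof -
    have "\<delta> powr p * \<mu> \<le> \<delta> powr p * (\<mu> + 1)" by (intro mult_left_mono) auto
    moreover have "\<delta> powr p = (e/2) powr p / (\<mu> + 1)"
      using p e \<mu> unfolding \<delta>_def by (subst powr_divide) (auto simp: powr_powr)
    ultimately have "\<delta> powr p * \<mu> \<le> (e/2) powr p / (\<mu> + 1) * (\<mu> + 1)" by simp
    also have "\<dots> = (e/2) powr p" using \<mu> by simp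
    finally show ?thesis .
  qed
  define Q where "Q = N powr p / \<delta>\<^sup>2"
  have Q: "Q \<ge> 0" by (simp add: Q_def)
  have gap: "e powr p - (e/2) powr p > 0" using powr_less_mono2[of p "e/2" e] e p by simp
  obtain n where n: "Q * C / (e powr p - (e/2) powr p) < real n" "n \<ge> 1"
    by (metis reals_Archimedean2 le_less_linear less_one of_nat_less_0_iff of_nat_mono order_less_le_trans zero_less_one nat_le_linear)
  then have n': "Q * C / real n < e powr p - (e/2) powr p"
    using gap by (simp add: field_simps)
  obtain F where F: "finite F" "card F = n" "F \<subseteq> {max 1 j0..}"
    "(\<integral>x. (norm (\<Sum>j\<in>F. f x * g (a j *v x)))\<^sup>2 \<partial>lebesgue) \<le> real n * C" using C(2)[of n] by blast
  have F1: "j \<ge> 1" if "j \<in> F" for j using F(3) that by auto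
  define s where "s x = (\<Sum>j\<in>F. f x * g (a j *v x))" for x
  define h where "h x = inverse (of_nat (card F)) * s x" for x
  have sm[measurable]: "s \<in> borel_measurable lebesgue"
    unfolding s_def using g_dilate_measurable F1 by (intro borel_measurable_sum borel_measurable_times fm) auto
  have hm[measurable]: "h \<in> borel_measurable lebesgue" unfolding h_def by measurable
  have snorm: "norm (s x) \<le> real n * N" for x
  proof -
    have "norm (f x * g (a j *v x)) \<le> N" for j
      unfolding N_def norm_mult using Mf g_bound by (intro mult_mono) auto
    then show ?thesis unfolding s_def F(2)[symmetric] by (intro sum_norm_bound)
  qed
  have hn: "norm (h x) = norm (s x) / real n" for x
    using n(2) by (simp add: h_def F(2) norm_mult norm_inverse divide_inverse mult.commute)
  have hN: "norm (h x) \<le> N" for x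
    using snorm[of x] n(2) by (simp add: hn field_simps)
  have h0: "norm (h x) = 0" if "x \<notin> ?B" for x
  proof -
    have "f x = 0" using R[of x] that by auto
    then show ?thesis by (simp add: h_def s_def)
  qed
  have pt: "norm (h x) powr p \<le> \<delta> powr p * indicator ?B x + Q * (norm (h x))\<^sup>2" for x
  proof (cases "norm (h x) \<le> \<delta>")
    case True
    then have "norm (h x) powr p \<le> \<delta> powr p * indicator ?B x"
      using p h0[of x] by (cases "x \<in> ?B") (auto intro: powr_mono2)
    also have "\<dots> \<le> \<delta> powr p * indicator ?B x + Q * (norm (h x))\<^sup>2" using Q by simp
    finally show ?thesis .
  next
    case False
    then have "1 \<le> (norm (h x) / \<delta>)\<^sup>2" using \<delta> by (simp add: one_le_power)
    then have "N powr p * 1 \<le> N powr p * (norm (h x) / \<delta>)\<^sup>2" by (rule mult_left_mono) simp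
    moreover have "norm (h x) powr p \<le> N powr p" using p hN by (intro powr_mono2) auto
    ultimately have "norm (h x) powr p \<le> Q * (norm (h x))\<^sup>2"
      by (simp add: Q_def power_divide)
    then show ?thesis by (simp add: add_increasing)
  qed
  have hB: "AE x in lebesgue. norm (h x) \<le> N * indicator ?B x"
    using hN h0 by (intro AE_I2) (auto simp: indicator_def)
  have hp: "in_Lp p lebesgue h" and h2: "in_Lp 2 lebesgue h"
    using in_Lp_bounded_support(1)[OF _ hm lmeasurable_cball N hB] p by auto
  have "(\<integral>x. norm (h x) powr p \<partial>lebesgue) \<le> (\<integral>x. \<delta> powr p * indicator ?B x + Q * (norm (h x))\<^sup>2 \<partial>lebesgue)"
    using hp h2
    by (intro integral_mono pt Bochner_Integration.integrable_add integrable_mult_right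
          integrable_indicator_fmeasurable) (auto simp: in_Lp_def)
  also have "\<dots> = \<delta> powr p * \<mu> + Q * (\<integral>x. (norm (h x))\<^sup>2 \<partial>lebesgue)"
    using h2 unfolding \<mu>_def
    by (subst Bochner_Integration.integral_add)
      (auto simp: in_Lp_def intro!: integrable_mult_right integrable_indicator_fmeasurable)
  also have "(\<integral>x. (norm (h x))\<^sup>2 \<partial>lebesgue) = (\<integral>x. (norm (s x))\<^sup>2 \<partial>lebesgue) / (real n)\<^sup>2"
    by (simp add: hn power_divide)
  also have "\<dots> \<le> real n * C / (real n)\<^sup>2"
    using F(4) by (intro divide_right_mono) (auto simp: s_def)
  also have "real n * C / (real n)\<^sup>2 = C / real n" by (simp add: power2_eq_square)
  finally have "(\<integral>x. norm (h x) powr p \<partial>lebesgue) \<le> \<delta> powr p * \<mu> + Q * (C / real n)"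
    using Q by (simp add: mult_left_mono)
  also have "\<dots> < e powr p" using \<delta>\<mu> n' by simp
  finally have "Lp_norm p lebesgue h powr p < e powr p" using p by (simp add: Lp_norm_powr)
  then have "Lp_norm p lebesgue h < e"
    using powr_mono2[of p e "Lp_norm p lebesgue h"] e p by fastforce
  then have "Lp_norm p lebesgue (\<lambda>x. inverse (of_nat (card F)) * (\<Sum>j\<in>F. f x * g (a j *v x))) < e"
    by (simp add: h_def[abs_def] s_def)
  then show ?thesis using F n(2) by (intro exI[of _ F]) auto
qed

end

subsection \<open>Truncation of the generator\<close>

lemma summable_lattice_periodic:
  fixes f :: "real^'n \<Rightarrow> 'b::{comm_monoid_add, t2_space}" and b :: "real^'n^'n"
  shows "(\<lambda>k. f (x - lat b l - lat b k)) summable_on UNIV \<longleftrightarrow>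
    (\<lambda>k. f (x - lat b k)) summable_on UNIV"
proof -
  have "bij_betw (\<lambda>k. l + k) UNIV UNIV"
    by (rule bij_betwI[where g="\<lambda>k. k - l"]) auto
  from summable_on_reindex_bij_betw[OF this, of "\<lambda>k. f (x - lat b k)"]
  show ?thesis
    by (simp add: lattice_vec_add matrix_vector_mult_add_rdistrib algebra_simps)
qed

lemma lattice_sum_mono:
  assumes "(\<lambda>k. norm (\<psi> (x - lat b k))) summable_on UNIV" "\<And>x. norm (\<phi> x) \<le> norm (\<psi> x)"
  shows "(\<lambda>k. norm (\<phi> (x - lat b k))) summable_on UNIV" "lattice_sum b \<phi> x \<le> lattice_sum b \<psi> x"
proof -
  show *: "(\<lambda>k. norm (\<phi> (x - lat b k))) summable_on UNIV"
    by (rule summable_on_comparison_test[OF assms(1)]) (use assms(2) in auto)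
  show "lattice_sum b \<phi> x \<le> lattice_sum b \<psi> x"
    unfolding lattice_sum_def by (rule infsum_mono[OF * assms(1)]) (rule assms(2))
qed

text \<open>Completeness of Lebesgue measure makes every set of full measure measurable, however it
  is defined. It is applied to the set of points where the lattice series converges.\<close>

lemma null_complement_sets_lebesgue:
  assumes "AE x in lebesgue. x \<in> S"
  shows "S \<in> sets lebesgue"
proof -
  obtain N where N: "\<And>x. x \<in> space lebesgue - N \<Longrightarrow> x \<in> S" "N \<in> null_sets lebesgue"
    using AE_E3[OF assms] by blast
  have "- S \<subseteq> N" using N(1) by auto
  from null_setsD2[OF null_sets_completion_subset[OF this N(2)]]
  have "space lebesgue - (- S) \<in> sets lebesgue" by (rule sets.compl_sets)
  moreover have "space lebesgue - (- S) = S" by auto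
  ultimately show ?thesis by (simp only:)
qed

text \<open>Unfolding for complex integrands. If \<open>x\<close> lies in the tile and
  \<open>\<phi>\<close> does not vanish at \<open>x - lat b k\<close>, then \<open>lat b k\<close>
  has norm at most \<open>T + R\<close>, which confines \<open>k\<close> to the finite set
  \<open>K\<close>, the same for all such \<open>x\<close>; finite sums then replace
  Tonelli.\<close>

lemma integral_tile_periodization:
  fixes b :: "real^'n^'n" and \<phi> :: "real^'n \<Rightarrow> complex"
  assumes b: "invertible b" and \<phi>: "integrable lebesgue \<phi>" and R: "\<And>x. \<phi> x \<noteq> 0 \<Longrightarrow> norm x \<le> R"
  shows "(\<integral>x. indicator (tile b) x * (\<Sum>\<^sub>\<infinity>k. \<phi> (x - lat b k)) \<partial>lebesgue) = (\<integral>x. \<phi> x \<partial>lebesgue)"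
    "integrable lebesgue (\<lambda>x. indicator (tile b) x * (\<Sum>\<^sub>\<infinity>k. \<phi> (x - lat b k)))"
proof -
  let ?L = "\<lambda>k. lat b k"
  obtain T where T: "\<And>x. x \<in> tile b \<Longrightarrow> norm x \<le> T"
    using bounded_tile[of b] unfolding bounded_iff by metis
  define K where "K = {k :: int^'n. norm (lattice_vec k) \<le> onorm (\<lambda>x. matrix_inv b *v x) * (T + R)}"
  have finK: "finite K" unfolding K_def by (rule finite_lattice_bounded)
  have inK: "k \<in> K" if "x \<in> tile b" "\<phi> (x - ?L k) \<noteq> 0" for x k
  proof -
    have "norm (?L k) \<le> T + R"
      using norm_triangle_ineq4[of x "x - ?L k"] T[OF that(1)] R[OF that(2)] by simp
    moreover have "norm (lattice_vec k) \<le> onorm (\<lambda>x. matrix_inv b *v x) * norm (?L k)"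
      using onorm[OF matrix_vector_mul_bounded_linear[of "matrix_inv b"], of "?L k"] b
      by (simp add: matrix_inv_cancel)
    moreover have "onorm (\<lambda>x. matrix_inv b *v x) * norm (?L k) \<le> onorm (\<lambda>x. matrix_inv b *v x) * (T + R)"
      using calculation(1) by (intro mult_left_mono onorm_pos_le matrix_vector_mul_bounded_linear)
    ultimately show ?thesis by (simp add: K_def)
  qed
  have fin: "indicator (tile b) x * (\<Sum>\<^sub>\<infinity>k. \<phi> (x - ?L k)) = (\<Sum>k\<in>K. indicator (tile b) x * \<phi> (x - ?L k))" for x
  proof (cases "x \<in> tile b")
    case True
    have "(\<Sum>\<^sub>\<infinity>k. \<phi> (x - ?L k)) = (\<Sum>\<^sub>\<infinity>k\<in>K. \<phi> (x - ?L k))"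
      using inK[OF True] by (intro infsum_cong_neutral) auto
    then show ?thesis using finK True by (simp add: sum_distrib_left)
  qed simp
  have \<phi>m: "\<phi> \<in> borel_measurable lebesgue" using \<phi> by auto
  let ?I = "indicator (tile b) :: real^'n \<Rightarrow> complex"
  have shift: "integrable lebesgue (\<lambda>x. ?I x * \<phi> (x - t))" for t
  proof (rule Bochner_Integration.integrable_bound)
    show "integrable lebesgue (\<lambda>x. \<phi> (x - t))"
      using integrable_affine_matrix[OF invertible_mat_1 \<phi>m, of "- t"] \<phi> by simp
    show "(\<lambda>x. ?I x * \<phi> (x - t)) \<in> borel_measurable lebesgue"
      using borel_measurable_shift[OF \<phi>m, of t] by measurable
  qed (auto simp: indicator_def)
  show "integrable lebesgue (\<lambda>x. ?I x * (\<Sum>\<^sub>\<infinity>k. \<phi> (x - ?L k)))"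
    unfolding fin by (intro Bochner_Integration.integrable_sum shift)
  have "(\<integral>x. ?I x * (\<Sum>\<^sub>\<infinity>k. \<phi> (x - ?L k)) \<partial>lebesgue) = (\<Sum>k\<in>K. \<integral>x. ?I x * \<phi> (x - ?L k) \<partial>lebesgue)"
    unfolding fin by (intro Bochner_Integration.integral_sum shift)
  also have "\<dots> = (\<Sum>k\<in>K. \<integral>x. ?I (x + ?L k) * \<phi> x \<partial>lebesgue)"
  proof (rule sum.cong[OF refl])
    fix k
    have "(\<lambda>x. ?I x * \<phi> (x - ?L k)) \<in> borel_measurable lebesgue" using shift by auto
    from integral_affine_matrix[OF invertible_mat_1 this, of "?L k"]
    show "(\<integral>x. ?I x * \<phi> (x - ?L k) \<partial>lebesgue) = (\<integral>x. ?I (x + ?L k) * \<phi> x \<partial>lebesgue)"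
      by (simp add: det_I)
  qed
  also have "\<dots> = (\<integral>x. (\<Sum>k\<in>K. ?I (x + ?L k) * \<phi> x) \<partial>lebesgue)"
  proof (rule Bochner_Integration.integral_sum[symmetric])
    fix k
    have "(\<lambda>x. ?I x * \<phi> (x - ?L k)) \<in> borel_measurable lebesgue" using shift by auto
    from integrable_affine_matrix[OF invertible_mat_1 this, of "?L k"] shift[of "?L k"]
    show "integrable lebesgue (\<lambda>x. ?I (x + ?L k) * \<phi> x)" by simp
  qed
  also have "\<dots> = (\<integral>x. \<phi> x \<partial>lebesgue)"
  proof (rule Bochner_Integration.integral_cong[OF refl])
    fix x
    show "(\<Sum>k\<in>K. ?I (x + ?L k) * \<phi> x) = \<phi> x"
    proof (cases "\<phi> x = 0")
      case False
      \<comment> \<open>The substitution has shifted the tile instead of the function, which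
        reverses the sign: \<open>x + lat b k\<close> lies in the tile exactly for this
        index.\<close>
      define k0 where "k0 = - tile_index b x"
      have I: "?I (x + ?L k) = (if k = k0 then 1 else 0)" for k
        using diff_mem_tile_iff[OF b, of x "- k"] unfolding lat_uminus k0_def
        by (simp add: indicator_def) (metis minus_minus)
      have "x + ?L k0 \<in> tile b" using I[of k0] by (simp add: indicator_def split: if_splits)
      then have "k0 \<in> K" using False inK[of "x + ?L k0" k0] by simp
      then show ?thesis unfolding I using finK by (simp add: if_distrib[of "\<lambda>z. z * _"] cong: if_cong)
    qed simp
  qed
  finally show "(\<integral>x. ?I x * (\<Sum>\<^sub>\<infinity>k. \<phi> (x - ?L k)) \<partial>lebesgue) = (\<integral>x. \<phi> x \<partial>lebesgue)" .
qed

locale affine_synthesis =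
  fixes a :: "nat \<Rightarrow> real^'n^'n" and b :: "real^'n^'n" and \<psi> :: "real^'n \<Rightarrow> complex" and p :: real
  assumes a_inv: "\<And>j. j \<ge> 1 \<Longrightarrow> invertible (a j)"
    and a_exp: "expanding a"
    and b_inv: "invertible b"
    and p: "1 \<le> p"
    and \<psi>_meas: "\<psi> \<in> borel_measurable lebesgue"
    and \<psi>_conv: "AE x in lebesgue. (\<lambda>k. norm (\<psi> (x - lat b k))) summable_on UNIV"
    and \<psi>_sum: "in_Lp p (lebesgue_on (tile b)) (lattice_sum b \<psi>)"
    and \<psi>_int: "(\<integral>x. \<psi> x \<partial>lebesgue) = 1"
begin

abbreviation "nrm f \<equiv> Lp_norm p lebesgue f"
abbreviation "S \<equiv> synthesis_scale p a b \<psi>"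
abbreviation "convergent_at x \<equiv> (\<lambda>k. norm (\<psi> (x - lat b k))) summable_on UNIV"

text \<open>A function that is not integrable has Bochner integral 0 by default, so the value 1
  forces integrability.\<close>

lemma \<psi>_integrable: "integrable lebesgue \<psi>"
  using \<psi>_int not_integrable_integral_eq by fastforce

lemma dominated_conv:
  fixes \<phi> :: "real^'n \<Rightarrow> complex"
  assumes "\<And>x. norm (\<phi> x) \<le> norm (\<psi> x)"
  shows "AE x in lebesgue. (\<lambda>k. norm (\<phi> (x - lat b k))) summable_on UNIV"
  using \<psi>_conv by eventually_elim (rule lattice_sum_mono(1)[OF _ assms])

lemma AE_lattice_sum_mono:
  fixes \<phi> :: "real^'n \<Rightarrow> complex"
  assumes "\<And>x. norm (\<phi> x) \<le> norm (\<psi> x)"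
  shows "AE x in lebesgue_on (tile b). norm (lattice_sum b \<phi> x) \<le> norm (lattice_sum b \<psi> x)"
proof -
  have "AE x in lebesgue. norm (lattice_sum b \<phi> x) \<le> norm (lattice_sum b \<psi> x)"
    using \<psi>_conv
    by eventually_elim (simp add: lattice_sum_mono(2)[OF _ assms] lattice_sum_nonneg)
  then show ?thesis by (subst AE_restrict_space_iff) (auto elim: eventually_mono)
qed

lemma dominated_in_Lp:
  fixes \<phi> :: "real^'n \<Rightarrow> complex"
  assumes "\<And>x. norm (\<phi> x) \<le> norm (\<psi> x)" "\<phi> \<in> borel_measurable lebesgue"
  shows "in_Lp p (lebesgue_on (tile b)) (lattice_sum b \<phi>)"
  by (rule in_Lp_bound[OF measurable_restrict_space1[OF borel_measurable_lattice_sum[OF assms(2)]]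
        \<psi>_sum AE_lattice_sum_mono[OF assms(1)] p])

text \<open>Summability is required explicitly because \<^const>\<open>lattice_sum\<close> is 0 where the series
  diverges; it makes \<open>lattice_sum b (trunc n)\<close> bounded by \<open>n\<close> at every point.\<close>

definition core :: "nat \<Rightarrow> (real^'n) set" where
  "core n = cball 0 (real n) \<inter> {x. convergent_at x \<and> lattice_sum b \<psi> x \<le> real n}"

definition trunc :: "nat \<Rightarrow> real^'n \<Rightarrow> complex" where
  "trunc n x = indicator (core n) x * \<psi> x"

lemma core_sets [measurable]: "core n \<in> sets lebesgue"
proof -
  note borel_measurable_lattice_sum[OF \<psi>_meas, measurable]
  have "{x \<in> space lebesgue. lattice_sum b \<psi> x \<le> real n} \<in> sets lebesgue" by measurable
  moreover have "{x. convergent_at x} \<in> sets lebesgue"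
    using \<psi>_conv by (intro null_complement_sets_lebesgue) simp
  moreover have "core n = cball 0 (real n) \<inter> ({x. convergent_at x}
      \<inter> {x \<in> space lebesgue. lattice_sum b \<psi> x \<le> real n})"
    by (auto simp: core_def)
  ultimately show ?thesis by (simp only: sets.Int lmeasurable_cball fmeasurableD)
qed

lemma eventually_mem_core:
  assumes "convergent_at x"
  shows "eventually (\<lambda>n. x \<in> core n) sequentially"
  using eventually_ge_at_top[of "nat \<lceil>max (norm x) (lattice_sum b \<psi> x)\<rceil>"]
  by eventually_elim (use assms in \<open>auto simp: core_def nat_le_iff ceiling_le_iff\<close>)

lemma trunc_meas: "trunc n \<in> borel_measurable lebesgue"
  unfolding trunc_def using \<psi>_meas by measurable

lemma norm_trunc_le: "norm (trunc n x) \<le> norm (\<psi> x)" "norm (\<psi> x - trunc n x) \<le> norm (\<psi> x)"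
  by (auto simp: trunc_def indicator_def)

lemma norm_trunc_support: "trunc n x \<noteq> 0 \<Longrightarrow> norm x \<le> real n"
  by (auto simp: trunc_def core_def indicator_def split: if_splits)

text \<open>Convergence and the bound on the lattice sum hold at all points of a lattice orbit or at
  none. In the former case the lattice sum of \<open>trunc n\<close> is dominated by that of \<psi>;
  in the latter every translate is cut away and the sum is 0.\<close>

lemma trunc_lattice_sum:
  "(\<lambda>k. norm (trunc n (x - lat b k))) summable_on UNIV" (is ?A)
  "lattice_sum b (trunc n) x \<le> real n" (is ?B)
proof -
  let ?s = "convergent_at x"
  have "?A \<and> ?B"
  proof (cases "?s \<and> lattice_sum b \<psi> x \<le> real n")
    case True
    then show ?thesis
      using lattice_sum_mono[of \<psi> x b "trunc n", OF _ norm_trunc_le(1)] by auto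
  next
    case False
    have "lattice_sum b \<psi> (x - lat b k) = lattice_sum b \<psi> x" for k
      unfolding lattice_sum_def by (rule infsum_lattice_periodic[where f="\<lambda>x. norm (\<psi> x)"])
    then have "x - lat b k \<notin> core n" for k
      using False summable_lattice_periodic[where f="\<lambda>x. norm (\<psi> x)", of x b k] by (auto simp: core_def)
    then have "trunc n (x - lat b k) = 0" for k by (simp add: trunc_def)
    then show ?thesis by (simp add: lattice_sum_def)
  qed
  then show ?A ?B by auto
qed

lemma lattice_sum_diff_trunc_tendsto:
  assumes "convergent_at x"
  shows "(\<lambda>n. lattice_sum b (\<lambda>x. \<psi> x - trunc n x) x) \<longlonglongrightarrow> 0"
proof -
  have "(\<lambda>n. \<integral>k. norm (\<psi> (x - lat b k) - trunc n (x - lat b k)) \<partial>count_space UNIV)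
      \<longlonglongrightarrow> (\<integral>k. 0 \<partial>count_space (UNIV :: (int^'n) set))"
  proof (rule integral_dominated_convergence[where w="\<lambda>k. norm (\<psi> (x - lat b k))"])
    show "integrable (count_space UNIV) (\<lambda>k. norm (\<psi> (x - lat b k)))"
      using assms by (simp add: integrable_count_space_iff_summable_real)
    show "AE k in count_space UNIV. (\<lambda>n. norm (\<psi> (x - lat b k) - trunc n (x - lat b k))) \<longlonglongrightarrow> 0"
    proof (rule AE_I2)
      fix k
      have "(\<lambda>l. norm (\<psi> (x - lat b k - lat b l))) summable_on UNIV"
        using assms summable_lattice_periodic[where f="\<lambda>x. norm (\<psi> x)", of x b k] by simp
      from eventually_mem_core[OF this]
      have "eventually (\<lambda>n. norm (\<psi> (x - lat b k) - trunc n (x - lat b k)) = 0) sequentially"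
        by eventually_elim (simp add: trunc_def)
      then show "(\<lambda>n. norm (\<psi> (x - lat b k) - trunc n (x - lat b k))) \<longlonglongrightarrow> 0"
        by (rule tendsto_eventually)
    qed
  qed (use norm_trunc_le in auto)
  then show ?thesis by (simp add: lattice_sum_def infsum_eq_integral_real)
qed

text \<open>Dominated convergence is used at two levels: over the lattice at each point of
  convergence, and over the tile with the p-th power of \<open>lattice_sum b \<psi>\<close> as
  majorant.\<close>

lemma Lp_norm_diff_trunc_tendsto:
  "(\<lambda>n. tile_norm p b (\<lambda>x. \<psi> x - trunc n x)) \<longlonglongrightarrow> 0"
proof -
  let ?M = "lebesgue_on (tile b)" and ?E = "\<lambda>n. lattice_sum b (\<lambda>x. \<psi> x - trunc n x)"
  have Em: "?E n \<in> borel_measurable ?M" for n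
    using \<psi>_meas trunc_meas by (intro measurable_restrict_space1 borel_measurable_lattice_sum borel_measurable_diff)
  have Wm: "lattice_sum b \<psi> \<in> borel_measurable ?M"
    using \<psi>_meas by (intro measurable_restrict_space1 borel_measurable_lattice_sum)
  have "(\<lambda>n. \<integral>x. norm (?E n x) powr p \<partial>?M) \<longlonglongrightarrow> (\<integral>x. 0 \<partial>?M)"
  proof (rule integral_dominated_convergence[where w="\<lambda>x. norm (lattice_sum b \<psi> x) powr p"])
    show "integrable ?M (\<lambda>x. norm (lattice_sum b \<psi> x) powr p)" using \<psi>_sum by (simp add: in_Lp_def)
    have "AE x in lebesgue. (\<lambda>n. norm (?E n x) powr p) \<longlonglongrightarrow> 0"
      using \<psi>_conv
    proof eventually_elim
      fix x assume "convergent_at x"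
      from tendsto_norm_zero[OF lattice_sum_diff_trunc_tendsto[OF this]]
      have "(\<lambda>n. norm (?E n x) powr p) \<longlonglongrightarrow> 0 powr p" using p by (intro tendsto_powr2) auto
      then show "(\<lambda>n. norm (?E n x) powr p) \<longlonglongrightarrow> 0" by simp
    qed
    then show "AE x in ?M. (\<lambda>n. norm (?E n x) powr p) \<longlonglongrightarrow> 0"
      by (subst AE_restrict_space_iff) (auto elim: eventually_mono)
    show "AE x in ?M. norm (norm (?E n x) powr p) \<le> norm (lattice_sum b \<psi> x) powr p" for n
      using AE_lattice_sum_mono[OF norm_trunc_le(2)[of _ n]] by eventually_elim (use p in \<open>auto intro!: powr_mono2\<close>)
    show "(\<lambda>x. norm (?E n x) powr p) \<in> borel_measurable ?M" for n
      using Em[of n] by measurable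
  qed simp
  then have "(\<lambda>n. (\<integral>x. norm (?E n x) powr p \<partial>?M) powr (1/p)) \<longlonglongrightarrow> 0 powr (1/p)"
    using p by (intro tendsto_powr2) auto
  then show ?thesis by (simp add: Lp_norm_def)
qed

lemma integral_trunc_tendsto: "(\<lambda>n. \<integral>x. trunc n x \<partial>lebesgue) \<longlonglongrightarrow> 1"
proof -
  have "(\<lambda>n. \<integral>x. trunc n x \<partial>lebesgue) \<longlonglongrightarrow> (\<integral>x. \<psi> x \<partial>lebesgue)"
  proof (rule integral_dominated_convergence[where w="\<lambda>x. norm (\<psi> x)"])
    show "AE x in lebesgue. (\<lambda>n. trunc n x) \<longlonglongrightarrow> \<psi> x"
      using \<psi>_conv
    proof eventually_elim
      fix x assume "convergent_at x"
      from eventually_mem_core[OF this] have "eventually (\<lambda>n. trunc n x = \<psi> x) sequentially"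
        by eventually_elim (simp add: trunc_def)
      then show "(\<lambda>n. trunc n x) \<longlonglongrightarrow> \<psi> x" by (rule tendsto_eventually)
    qed
  qed (use \<psi>_integrable \<psi>_meas trunc_meas norm_trunc_le in auto)
  then show ?thesis by (simp add: \<psi>_int)
qed

lemma trunc_integrable: "integrable lebesgue (trunc n)"
  by (rule Bochner_Integration.integrable_bound[OF \<psi>_integrable trunc_meas]) (simp add: norm_trunc_le)

definition trunc_mean :: "nat \<Rightarrow> complex" where
  "trunc_mean n = (\<integral>x. trunc n x \<partial>lebesgue)"

text \<open>The periodization of \<open>trunc n\<close> minus its mean over a tile. The factor |det
  b| is the volume of the tile, so this mean equals the integral of \<open>trunc n\<close>.\<close>

definition oscillation :: "nat \<Rightarrow> real^'n \<Rightarrow> complex" where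
  "oscillation n x = of_real \<bar>det b\<bar> * (\<Sum>\<^sub>\<infinity>k. trunc n (x - lat b k)) - trunc_mean n"

lemma periodic_oscillation_trunc:
  "periodic_oscillation a b (oscillation n) (\<bar>det b\<bar> * real n + norm (trunc_mean n))"
proof
  show "oscillation n \<in> borel_measurable lebesgue"
    unfolding oscillation_def
    by (intro borel_measurable_diff borel_measurable_times borel_measurable_const
        borel_measurable_infsum_complex borel_measurable_shift trunc_meas)
  show "norm (oscillation n x) \<le> \<bar>det b\<bar> * real n + norm (trunc_mean n)" for x
  proof -
    have "norm (\<Sum>\<^sub>\<infinity>k. trunc n (x - lat b k)) \<le> lattice_sum b (trunc n) x"
      unfolding lattice_sum_def by (rule norm_infsum_bound[OF trunc_lattice_sum(1)])
    also have "\<dots> \<le> real n" by (rule trunc_lattice_sum(2))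
    finally have "norm (of_real \<bar>det b\<bar> * (\<Sum>\<^sub>\<infinity>k. trunc n (x - lat b k))) \<le> \<bar>det b\<bar> * real n"
      by (simp add: norm_mult mult_left_mono)
    then show ?thesis
      unfolding oscillation_def using norm_triangle_ineq4 order_trans add_right_mono by blast
  qed
  show "oscillation n (x - lat b k) = oscillation n x" for x k
    unfolding oscillation_def infsum_lattice_periodic ..
  let ?I = "indicator (tile b) :: real^'n \<Rightarrow> complex"
  have I: "integrable lebesgue ?I" "(\<integral>x. ?I x \<partial>lebesgue) = of_real \<bar>det b\<bar>"
  proof -
    have eq: "?I = (\<lambda>x. of_real (indicator (tile b) x))" by (auto simp: indicator_def)
    have "integrable lebesgue (indicator (tile b) :: real^'n \<Rightarrow> real)"
      by (intro integrable_indicator_fmeasurable tile_lmeasurable)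
    then show "integrable lebesgue ?I" unfolding eq by (rule integrable_of_real)
    have "(\<integral>x. indicator (tile b) x \<partial>lebesgue) = measure lebesgue (tile b)" by simp
    then show "(\<integral>x. ?I x \<partial>lebesgue) = of_real \<bar>det b\<bar>"
      unfolding eq by (simp only: integral_complex_of_real tile_lmeasurable(2))
  qed
  note per = integral_tile_periodization[OF b_inv trunc_integrable norm_trunc_support]
  have "(\<integral>x. ?I x * oscillation n x \<partial>lebesgue)
      = (\<integral>x. of_real \<bar>det b\<bar> * (?I x * (\<Sum>\<^sub>\<infinity>k. trunc n (x - lat b k))) - trunc_mean n * ?I x \<partial>lebesgue)"
    by (simp add: oscillation_def algebra_simps)
  also have "\<dots> = of_real \<bar>det b\<bar> * trunc_mean n - trunc_mean n * of_real \<bar>det b\<bar>"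
    using per(2)[of n] I by (simp add: per(1) trunc_mean_def[symmetric])
  finally show "(\<integral>x. ?I x * oscillation n x \<partial>lebesgue) = 0" by simp
qed (use a_inv a_exp b_inv in auto)

end

subsection \<open>Approximation by finitely many scales\<close>

lemma
  fixes E :: "nat \<Rightarrow> 'a \<Rightarrow> complex"
  assumes p: "1 \<le> p" and F: "finite F" "F \<noteq> {}" and E: "\<And>j. j \<in> F \<Longrightarrow> in_Lp p M (E j)"
    and C: "\<And>j. j \<in> F \<Longrightarrow> Lp_norm p M (E j) \<le> C"
  shows in_Lp_average: "in_Lp p M (\<lambda>x. inverse (of_nat (card F)) * (\<Sum>j\<in>F. E j x))"
    and Lp_norm_average: "Lp_norm p M (\<lambda>x. inverse (of_nat (card F)) * (\<Sum>j\<in>F. E j x)) \<le> C"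
proof -
  have n: "real (card F) > 0" using F by (simp add: card_gt_0_iff)
  show "in_Lp p M (\<lambda>x. inverse (of_nat (card F)) * (\<Sum>j\<in>F. E j x))"
    using p E by (intro in_Lp_mult_left in_Lp_sum) auto
  have "Lp_norm p M (\<lambda>x. \<Sum>j\<in>F. E j x) \<le> (\<Sum>j\<in>F. Lp_norm p M (E j))"
    using p E by (rule Lp_norm_sum)
  also have "\<dots> \<le> real (card F) * C" using C by (rule sum_bounded_above)
  finally show "Lp_norm p M (\<lambda>x. inverse (of_nat (card F)) * (\<Sum>j\<in>F. E j x)) \<le> C"
    unfolding Lp_norm_mult_left[OF p] using n by (simp add: norm_inverse) (simp add: field_simps)
qed

section \<open>Coefficients obtained by sampling\<close>

definition lp_norm :: "real \<Rightarrow> ('k \<Rightarrow> complex) \<Rightarrow> real" where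
  "lp_norm p c = (\<Sum>\<^sub>\<infinity>k. norm (c k) powr p) powr (1 / p)"

lemma lp_norm_nonneg [simp]: "0 \<le> lp_norm p c"
  by (simp add: lp_norm_def)

lemma lp_norm_zero [simp]: "lp_norm p (\<lambda>k. 0) = 0"
  by (simp add: lp_norm_def)

lemma lp_norm_mult_left:
  assumes "1 \<le> p"
  shows "lp_norm p (\<lambda>k. z * c k) = norm z * lp_norm p c"
proof -
  have "(\<Sum>\<^sub>\<infinity>k. norm (z * c k) powr p) = norm z powr p * (\<Sum>\<^sub>\<infinity>k. norm (c k) powr p)"
    by (simp add: norm_mult powr_mult infsum_cmult_right')
  then show ?thesis
    using assms by (simp add: lp_norm_def powr_mult infsum_nonneg powr_powr)
qed

text \<open>The normalization makes the synthesis of the samples approximate \<open>f\<close> times the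
  periodization of \<open>\<psi>\<close>, dilated by \<open>A\<close>.\<close>

definition sample_coeff ::
    "real \<Rightarrow> real^'n^'n \<Rightarrow> real^'n^'n \<Rightarrow> (real^'n \<Rightarrow> complex) \<Rightarrow> int^'n \<Rightarrow> complex" where
  "sample_coeff p A b f k = of_real (\<bar>det b\<bar> / \<bar>det A\<bar> powr (1 / p)) * f (sample_point A b k)"

lemma infsum_finite_support:
  fixes f :: "'k \<Rightarrow> 'b::{topological_comm_monoid_add, t2_space}"
  assumes "finite K" "\<And>k. k \<notin> K \<Longrightarrow> f k = 0"
  shows "f summable_on UNIV" "infsum f UNIV = sum f K"
proof -
  have "f summable_on UNIV \<longleftrightarrow> f summable_on K"
    using assms(2) by (intro summable_on_cong_neutral) auto
  then show "f summable_on UNIV" using assms(1) by (simp add: summable_on_finite)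
  have "infsum f UNIV = infsum f K"
    using assms(2) by (intro infsum_cong_neutral) auto
  then show "infsum f UNIV = sum f K" using assms(1) by simp
qed

context
  fixes A b :: "real^'n^'n" and f :: "real^'n \<Rightarrow> complex" and p :: real
  assumes A: "invertible A" and b: "invertible b" and f: "cc_fun f" and p: "1 \<le> p"
begin

lemma sample_coeff_summable: "(\<lambda>k. norm (sample_coeff p A b f k) powr p) summable_on UNIV"
  using finite_sampling_support[OF A b f] by (rule infsum_finite_support(1)) (simp add: sample_coeff_def)

lemma step_fun_measurable: "step_fun A b f \<in> borel_measurable lebesgue"
  using integrable_step_fun[OF A b f] by auto

lemma step_fun_powr:
  "norm (step_fun A b f x) powr p = (\<Sum>k | f (sample_point A b k) \<noteq> 0.
    norm (f (sample_point A b k)) powr p * indicator (tile b) (A *v x - lat b k))"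
  using step_fun_eq_sum[OF A b f, where h="\<lambda>z. norm z powr p"] by simp

lemma step_fun_in_Lp: "in_Lp p lebesgue (step_fun A b f)"
  unfolding in_Lp_def step_fun_powr
  by (intro conjI step_fun_measurable Bochner_Integration.integrable_sum integrable_mult_right integrable_cell A b)

text \<open>Each sample is the value of the step function on one cell of volume |det b| / |det A|,
  while the p-th power of the normalization is |det b|^p / |det A|. The quotient |det b|^(p-1) is
  the origin of the constant |det b|^(1/q).\<close>

lemma lp_norm_sample_coeff:
  "lp_norm p (sample_coeff p A b f) = \<bar>det b\<bar> powr (1 - 1 / p) * Lp_norm p lebesgue (step_fun A b f)"
proof -
  let ?K = "{k. f (sample_point A b k) \<noteq> 0}" and ?B = "\<bar>det b\<bar>" and ?D = "\<bar>det A\<bar>"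
  have B: "?B > 0" and D: "?D > 0" using A b by (auto simp: invertible_det_nz)
  have int: "(\<integral>x. norm (step_fun A b f x) powr p \<partial>lebesgue) = (\<Sum>k\<in>?K. norm (f (sample_point A b k)) powr p * (?B / ?D))"
  proof -
    have "(\<integral>x. norm (step_fun A b f x) powr p \<partial>lebesgue) = (\<Sum>k\<in>?K. \<integral>x.
      norm (f (sample_point A b k)) powr p * indicator (tile b) (A *v x - lat b k) \<partial>lebesgue)"
      unfolding step_fun_powr
      by (intro Bochner_Integration.integral_sum integrable_mult_right integrable_cell A b)
    then show ?thesis by (simp only: integral_mult_right_zero integral_cell[OF A b])
  qed
  have Bp: "?B powr p = ?B powr (p - 1) * ?B"
    using powr_mult_base[of ?B "p - 1"] B by (simp add: mult.commute)
  have norm_c: "norm (sample_coeff p A b f k) powr p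
      = ?B powr (p - 1) * (norm (f (sample_point A b k)) powr p * (?B / ?D))" for k
    using p B D by (simp add: sample_coeff_def norm_mult norm_divide powr_mult powr_divide powr_powr Bp)
  have "(\<Sum>\<^sub>\<infinity>k. norm (sample_coeff p A b f k) powr p) = (\<Sum>k\<in>?K. norm (sample_coeff p A b f k) powr p)"
    using finite_sampling_support[OF A b f] by (rule infsum_finite_support(2)) (simp add: sample_coeff_def)
  also have "\<dots> = ?B powr (p - 1) * (\<integral>x. norm (step_fun A b f x) powr p \<partial>lebesgue)"
    unfolding norm_c int by (rule sum_distrib_left[symmetric])
  finally have "(\<Sum>\<^sub>\<infinity>k. norm (sample_coeff p A b f k) powr p) powr (1/p)
    = (?B powr (p - 1)) powr (1/p) * Lp_norm p lebesgue (step_fun A b f)"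
    by (simp add: powr_mult Lp_norm_def)
  also have "(?B powr (p - 1)) powr (1/p) = ?B powr (1 - 1/p)"
    using p by (simp add: powr_powr diff_divide_distrib)
  finally show ?thesis by (simp add: lp_norm_def)
qed

end

context affine_synthesis
begin

definition coeff :: "(real^'n \<Rightarrow> complex) \<Rightarrow> nat \<Rightarrow> int^'n \<Rightarrow> complex" where
  "coeff f j = sample_coeff p (a j) b f"

text \<open>The powers of |det (a j)| in the coefficients and in the affine functions cancel. The
  form with the infinite sum is compared with the periodization; the finite form gives linearity in
  the generator without questions of convergence.\<close>

lemma synthesis_scale_coeff:
  assumes j: "j \<ge> 1" and f: "cc_fun f"
  shows "synthesis_scale p a b \<phi> (coeff f) j x =
    (\<Sum>\<^sub>\<infinity>k. of_real \<bar>det b\<bar> * f (sample_point (a j) b k) * \<phi> (a j *v x - lat b k))"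
    "synthesis_scale p a b \<phi> (coeff f) j x = (\<Sum>k | f (sample_point (a j) b k) \<noteq> 0.
      of_real \<bar>det b\<bar> * f (sample_point (a j) b k) * \<phi> (a j *v x - lat b k))"
proof -
  have D: "\<bar>det (a j)\<bar> > 0" using a_inv[OF j] by (auto simp: invertible_det_nz)
  have "coeff f j k * affine_fun p a b \<phi> j k x =
    of_real \<bar>det b\<bar> * f (sample_point (a j) b k) * \<phi> (a j *v x - lat b k)" for k
    using D by (simp add: coeff_def sample_coeff_def affine_fun_def)
  then show *: "synthesis_scale p a b \<phi> (coeff f) j x =
    (\<Sum>\<^sub>\<infinity>k. of_real \<bar>det b\<bar> * f (sample_point (a j) b k) * \<phi> (a j *v x - lat b k))"
    by (simp add: synthesis_scale_def)
  show "synthesis_scale p a b \<phi> (coeff f) j x = (\<Sum>k | f (sample_point (a j) b k) \<noteq> 0.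
      of_real \<bar>det b\<bar> * f (sample_point (a j) b k) * \<phi> (a j *v x - lat b k))"
    unfolding * using finite_sampling_support[OF a_inv[OF j] b_inv f]
    by (rule infsum_finite_support(2)) simp
qed

lemma synthesis_scale_coeff_diff:
  assumes "j \<ge> 1" "cc_fun f"
  shows "S (coeff f) j x =
    synthesis_scale p a b (\<lambda>x. \<psi> x - \<phi> x) (coeff f) j x + synthesis_scale p a b \<phi> (coeff f) j x"
  unfolding synthesis_scale_coeff(2)[OF assms] by (simp add: sum.distrib[symmetric] algebra_simps)

text \<open>Only lattice points within \<open>N\<close> of \<open>a j *v x\<close> contribute, and
  for these the sample is close to \<open>f x\<close>. Replacing every sample by \<open>f x\<close>
  leaves \<open>f x\<close> times the dilated periodization of \<open>trunc N\<close>, which splits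
  into the oscillation and the mean; the lattice sum bound \<open>N\<close> controls the
  replacement.\<close>

lemma trunc_synthesis_error:
  assumes j: "j \<ge> 1" and f: "cc_fun f" and T: "real N \<le> T" and \<epsilon>: "0 \<le> \<epsilon>"
    and s: "\<And>x t. norm (a j *v x - t) \<le> T \<Longrightarrow> norm (f x - f (matrix_inv (a j) *v t)) \<le> \<epsilon> * indicator B x"
  shows "norm (synthesis_scale p a b (trunc N) (coeff f) j x - f x * oscillation N (a j *v x) - trunc_mean N * f x)
    \<le> \<bar>det b\<bar> * real N * \<epsilon> * indicator B x"
proof -
  let ?\<phi> = "\<lambda>k. trunc N (a j *v x - lat b k)" and ?y = "sample_point (a j) b"
  have s1: "(\<lambda>k. norm (?\<phi> k)) summable_on UNIV" by (rule trunc_lattice_sum)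
  have s2: "(\<lambda>k. f (?y k) * ?\<phi> k) summable_on UNIV"
    using finite_sampling_support[OF a_inv[OF j] b_inv f] by (rule infsum_finite_support(1)) simp
  have s3: "(\<lambda>k. f x * ?\<phi> k) summable_on UNIV"
    using abs_summable_summable[OF s1] by (rule summable_on_cmult_right)
  have termwise: "norm (f (?y k) * ?\<phi> k - f x * ?\<phi> k) \<le> \<epsilon> * indicator B x * norm (?\<phi> k)" for k
  proof (cases "?\<phi> k = 0")
    case False
    then have "norm (a j *v x - lat b k) \<le> T" using norm_trunc_support T by fastforce
    from s[OF this] have "norm (f (?y k) - f x) \<le> \<epsilon> * indicator B x"
      by (simp add: sample_point_def norm_minus_commute)
    then have "norm (f (?y k) - f x) * norm (?\<phi> k) \<le> \<epsilon> * indicator B x * norm (?\<phi> k)"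
      by (rule mult_right_mono) simp
    then show ?thesis by (simp add: norm_mult[symmetric] left_diff_distrib)
  qed simp
  have s4: "(\<lambda>k. \<epsilon> * indicator B x * norm (?\<phi> k)) summable_on UNIV"
    using s1 by (rule summable_on_cmult_right)
  have s5: "(\<lambda>k. norm (f (?y k) * ?\<phi> k - f x * ?\<phi> k)) summable_on UNIV"
    by (rule summable_on_comparison_test[OF s4]) (rule termwise, rule norm_ge_zero)
  let ?S = "\<Sum>\<^sub>\<infinity>k. f (?y k) * ?\<phi> k - f x * ?\<phi> k"
  have "norm ?S \<le> (\<Sum>\<^sub>\<infinity>k. norm (f (?y k) * ?\<phi> k - f x * ?\<phi> k))"
    by (rule norm_infsum_bound[OF s5])
  also have "\<dots> \<le> (\<Sum>\<^sub>\<infinity>k. \<epsilon> * indicator B x * norm (?\<phi> k))"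
    by (rule infsum_mono[OF s5 s4 termwise])
  also have "\<dots> = \<epsilon> * indicator B x * lattice_sum b (trunc N) (a j *v x)"
    unfolding lattice_sum_def by (rule infsum_cmult_right')
  also have "\<dots> \<le> \<epsilon> * indicator B x * real N"
    using \<epsilon> by (intro mult_left_mono trunc_lattice_sum) (simp add: indicator_def)
  finally have S: "\<bar>det b\<bar> * norm ?S \<le> \<bar>det b\<bar> * (\<epsilon> * indicator B x * real N)"
    by (rule mult_left_mono) simp
  have split: "?S = (\<Sum>\<^sub>\<infinity>k. f (?y k) * ?\<phi> k) - f x * (\<Sum>\<^sub>\<infinity>k. ?\<phi> k)"
    unfolding infsum_cmult_right'[symmetric] unfolding infsum_eq_integral_complex
    by (rule Bochner_Integration.integral_diff)
      (rule s2[folded integrable_count_space_iff_summable_complex],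
        rule s3[folded integrable_count_space_iff_summable_complex])
  have "synthesis_scale p a b (trunc N) (coeff f) j x - f x * oscillation N (a j *v x) - trunc_mean N * f x
    = of_real \<bar>det b\<bar> * ?S"
    unfolding synthesis_scale_coeff(1)[OF j f] oscillation_def split
    by (simp add: infsum_cmult_right' mult.assoc algebra_simps)
  then have "norm (synthesis_scale p a b (trunc N) (coeff f) j x - f x * oscillation N (a j *v x) - trunc_mean N * f x)
    = \<bar>det b\<bar> * norm ?S"
    by (simp only: norm_mult norm_of_real abs_idempotent)
  with S show ?thesis by (simp only: mult_ac)
qed

text \<open>The constant |det b|^(1/q), written through p so that p = 1 gives exponent 0.\<close>

definition D :: real where "D = \<bar>det b\<bar> powr (1 - 1 / p)"

lemma D_pos: "D > 0"
  using b_inv by (simp add: D_def invertible_det_nz)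

lemma trunc_choice:
  assumes "\<eta> > 0"
  obtains N where "tile_norm p b (\<lambda>x. \<psi> x - trunc N x) < \<eta>"
    "norm (1 - trunc_mean N) < \<eta>"
proof -
  have "eventually (\<lambda>n. tile_norm p b (\<lambda>x. \<psi> x - trunc n x) < \<eta>) sequentially"
    using Lp_norm_diff_trunc_tendsto assms by (intro order_tendstoD(2)[where y=0]) auto
  moreover have "eventually (\<lambda>n. norm (1 - trunc_mean n) < \<eta>) sequentially"
  proof -
    have "(\<lambda>n. norm (1 - trunc_mean n)) \<longlonglongrightarrow> norm (1 - 1 :: complex)"
      unfolding trunc_mean_def by (intro tendsto_intros integral_trunc_tendsto)
    then show ?thesis using assms by (intro order_tendstoD(2)[where y=0]) auto
  qed
  ultimately have "eventually (\<lambda>n. tile_norm p b (\<lambda>x. \<psi> x - trunc n x) < \<eta>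
     \<and> norm (1 - trunc_mean n) < \<eta>) sequentially" by (rule eventually_conj)
  from eventually_happens'[OF sequentially_bot this] that show thesis by blast
qed

text \<open>Four errors of size \<epsilon>/4 arise: \<open>G1\<close> from truncating the generator,
  \<open>G2\<close> from sampling, \<open>G3\<close> from the oscillation, \<open>G4\<close> from
  \<open>trunc_mean N\<close> not being 1. Only \<open>G3\<close> requires averaging;
  \<open>G1\<close> and \<open>G2\<close> are averages of terms already small at each scale. The
  parameters are fixed in the order \<open>N\<close>, \<open>\<epsilon>1\<close>, \<open>j1\<close>,
  \<open>F\<close>, as each depends on the preceding ones.\<close>

lemma approx_cc_fun:
  assumes f: "cc_fun f" and \<epsilon>: "\<epsilon> > 0" and j0: "1 \<le> j0"
  shows "\<exists>c F. finite F \<and> F \<subseteq> {j0..} \<and> (\<forall>j. j \<notin> F \<longrightarrow> c j = (\<lambda>k. 0)) \<and>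
    (\<forall>j. (\<lambda>k. norm (c j k) powr p) summable_on UNIV) \<and>
    (\<Sum>j\<in>F. lp_norm p (c j)) \<le> D * (nrm f + \<epsilon>) \<and>
    nrm (\<lambda>x. f x - (\<Sum>j\<in>F. S c j x)) \<le> \<epsilon>"
proof -
  define Nf where "Nf = nrm f"
  have Nf: "Nf \<ge> 0" by (simp add: Nf_def)
  have fLp: "in_Lp p lebesgue f" using f p by (rule cc_fun_in_Lp)
  \<comment> \<open>This tolerance is multiplied by a coefficient norm of at most
    \<open>D * (Nf + 1)\<close> in the truncation error and by \<open>Nf\<close> in the error of the
    mean.\<close>
  define \<eta> where "\<eta> = \<epsilon> / (4 * ((D + 1) * (Nf + 1)))"
  have den: "(D + 1) * (Nf + 1) > 0" using D_pos Nf by (intro mult_pos_pos) auto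
  have \<eta>: "\<eta> > 0" using \<epsilon> den by (simp add: \<eta>_def)
  have \<eta>4: "\<eta> * ((D + 1) * (Nf + 1)) = \<epsilon> / 4"
  proof -
    have "\<epsilon> / (4 * d) * d = \<epsilon> / 4" if "d > 0" for d :: real using that by simp
    from this[OF den] show ?thesis unfolding \<eta>_def .
  qed
  have \<eta>1: "\<eta> * (D * (Nf + 1)) \<le> \<epsilon> / 4"
    unfolding \<eta>4[symmetric] using \<eta> Nf by (intro mult_left_mono mult_right_mono) auto
  have \<eta>2: "\<eta> * Nf \<le> \<epsilon> / 4"
  proof -
    have "1 * Nf \<le> (D + 1) * (Nf + 1)" using Nf D_pos by (intro mult_mono) auto
    then show ?thesis unfolding \<eta>4[symmetric] using \<eta> by (intro mult_left_mono) auto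
  qed
  obtain N where N: "tile_norm p b (\<lambda>x. \<psi> x - trunc N x) < \<eta>"
    "norm (1 - trunc_mean N) < \<eta>" using trunc_choice[OF \<eta>] by blast
  interpret osc: periodic_oscillation a b "oscillation N" "\<bar>det b\<bar> * real N + norm (trunc_mean N)"
    by (rule periodic_oscillation_trunc)
  obtain R where R: "\<And>x. f x \<noteq> 0 \<Longrightarrow> x \<in> cball 0 R" using cc_fun_support[OF f] by metis
  let ?B = "cball 0 (R + 1) :: (real^'n) set"
  define \<beta> where "\<beta> = measure lebesgue ?B powr (1 / p)"
  have \<beta>: "\<beta> \<ge> 0" by (simp add: \<beta>_def)
  define q where "q = \<bar>det b\<bar> * real N"
  have q: "q \<ge> 0" by (simp add: q_def)
  \<comment> \<open>The cap at 1 secures the coefficient bound \<open>D * (Nf + 1)\<close> on which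
    \<open>\<eta>\<close> relies. The factor \<open>\<beta>\<close> is the L^p norm of the indicator
    of the ball, and \<open>q\<close> bounds the dilated periodization of
    \<open>trunc N\<close>.\<close>
  define \<epsilon>1 where "\<epsilon>1 = min 1 \<epsilon> / (4 * ((\<beta> + 1) * (q + 1)))"
  have den1: "(\<beta> + 1) * (q + 1) > 0" using \<beta> q by (intro mult_pos_pos) auto
  have \<epsilon>1: "\<epsilon>1 > 0" using \<epsilon> den1 by (simp add: \<epsilon>1_def)
  have \<epsilon>14: "\<epsilon>1 * ((\<beta> + 1) * (q + 1)) = min 1 \<epsilon> / 4"
  proof -
    have "z / (4 * d) * d = z / 4" if "d > 0" for d z :: real using that by simp
    from this[OF den1] show ?thesis unfolding \<epsilon>1_def .
  qed
  have e1: "\<epsilon>1 * \<beta> \<le> min 1 \<epsilon> / 4"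
  proof -
    have "\<beta> * 1 \<le> (\<beta> + 1) * (q + 1)" using \<beta> q by (intro mult_mono) auto
    then show ?thesis unfolding \<epsilon>14[symmetric] using \<epsilon>1 by (intro mult_left_mono) auto
  qed
  have e2: "q * \<epsilon>1 * \<beta> \<le> \<epsilon> / 4"
  proof -
    have "\<beta> * q \<le> (\<beta> + 1) * (q + 1)" using \<beta> q by (intro mult_mono) auto
    then have "\<epsilon>1 * (\<beta> * q) \<le> min 1 \<epsilon> / 4" unfolding \<epsilon>14[symmetric] using \<epsilon>1 by (intro mult_left_mono) auto
    then show ?thesis by (simp add: mult_ac min_def split: if_splits)
  qed
  obtain T0 where T0: "\<And>x. x \<in> tile b \<Longrightarrow> norm x \<le> T0"
    using bounded_tile[of b] unfolding bounded_iff by metis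
  \<comment> \<open>One radius for both uses of the sampling estimate: \<open>T0\<close> compares
    points of one cell in the step function, and \<open>N\<close> covers the support of
    \<open>trunc N\<close> in the synthesis.\<close>
  define T where "T = max T0 (real N)"
  have T_tile: "norm x \<le> T" if "x \<in> tile b" for x
    using T0[OF that] by (simp add: T_def)
  have "eventually (\<lambda>j. \<forall>x t. norm (a j *v x - t) \<le> T \<longrightarrow>
      norm (f x - f (matrix_inv (a j) *v t)) \<le> \<epsilon>1 * indicator ?B x) sequentially"
    using a_inv a_exp f R \<epsilon>1 by (rule sampling_error)
  then obtain j1 where j1: "\<And>j x t. j \<ge> j1 \<Longrightarrow> norm (a j *v x - t) \<le> T \<Longrightarrow>
      norm (f x - f (matrix_inv (a j) *v t)) \<le> \<epsilon>1 * indicator ?B x"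
    unfolding eventually_sequentially by blast
  have "\<epsilon> / 4 > 0" using \<epsilon> by simp
  from osc.oscillation_average_small[OF p f this, of "max j0 j1"] obtain F where
    F: "finite F" "F \<noteq> {}" "F \<subseteq> {max 1 (max j0 j1)..}"
    and Fosc: "nrm (\<lambda>x. inverse (of_nat (card F)) * (\<Sum>j\<in>F. f x * oscillation N (a j *v x))) < \<epsilon> / 4"
    by blast
  have Fj: "j \<ge> 1" "j \<ge> j0" "j \<ge> j1" if "j \<in> F" for j using F(3) that by auto
  let ?\<iota> = "inverse (of_nat (card F)) :: complex"
  have n: "real (card F) > 0" using F by (simp add: card_gt_0_iff)
  define c where "c j = (if j \<in> F then (\<lambda>k. ?\<iota> * coeff f j k) else (\<lambda>k. 0))" for j

  have step: "nrm (step_fun (a j) b f) \<le> Nf + min 1 \<epsilon>" if "j \<in> F" for j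
  proof -
    note A = a_inv[OF Fj(1)[OF that]]
    have sLp: "in_Lp p lebesgue (step_fun (a j) b f)" by (rule step_fun_in_Lp[OF A b_inv f p])
    have err: "norm (f x - step_fun (a j) b f x) \<le> \<epsilon>1 * indicator ?B x" for x
      by (rule step_fun_error[where T=T and e="\<lambda>x. \<epsilon>1 * indicator ?B x", OF b_inv T_tile j1[OF Fj(3)[OF that]]])
    have dLp: "in_Lp p lebesgue (\<lambda>x. step_fun (a j) b f x - f x)"
      by (rule in_Lp_diff[OF p sLp fLp])
    have "AE x in lebesgue. norm (step_fun (a j) b f x - f x) \<le> \<epsilon>1 * indicator ?B x"
      using err by (simp add: norm_minus_commute)
    moreover have "(\<lambda>x. step_fun (a j) b f x - f x) \<in> borel_measurable lebesgue"
      using dLp unfolding in_Lp_def by (rule conjunct1)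
    ultimately have "nrm (\<lambda>x. step_fun (a j) b f x - f x) \<le> \<epsilon>1 * \<beta>"
      using in_Lp_bounded_support(2)[where g="\<lambda>x. step_fun (a j) b f x - f x" and S="?B" and C=\<epsilon>1
          and M=lebesgue and p=p] p \<epsilon>1 unfolding \<beta>_def by simp
    moreover have "nrm (step_fun (a j) b f)
        \<le> Nf + nrm (\<lambda>x. step_fun (a j) b f x - f x)"
      using Lp_norm_triangle[OF p fLp dLp] by (simp add: Nf_def)
    moreover have "min 1 \<epsilon> / 4 \<le> min 1 \<epsilon>" using \<epsilon> by (simp add: min_def)
    ultimately show ?thesis using e1 by linarith
  qed
  have lp: "lp_norm p (coeff f j) \<le> D * (Nf + min 1 \<epsilon>)" if "j \<in> F" for j
    unfolding coeff_def lp_norm_sample_coeff[OF a_inv[OF Fj(1)[OF that]] b_inv f p] D_def[symmetric]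
    using step[OF that] D_pos by (intro mult_left_mono) auto
  have csum: "(\<lambda>k. norm (coeff f j k) powr p) summable_on UNIV" if "j \<in> F" for j
    unfolding coeff_def by (rule sample_coeff_summable[OF a_inv[OF Fj(1)[OF that]] b_inv f p])

  define E1 where "E1 j x = synthesis_scale p a b (\<lambda>x. \<psi> x - trunc N x) (coeff f) j x" for j x
  define E2 where "E2 j x = synthesis_scale p a b (trunc N) (coeff f) j x
    - f x * oscillation N (a j *v x) - trunc_mean N * f x" for j x
  have dm: "(\<lambda>x. \<psi> x - trunc N x) \<in> borel_measurable lebesgue"
    by (rule borel_measurable_diff[OF \<psi>_meas trunc_meas])
  have dle: "norm (\<psi> x - trunc N x) \<le> norm (\<psi> x)" for x by (rule norm_trunc_le(2))
  have E1: "in_Lp p lebesgue (E1 j)" "nrm (E1 j) \<le> \<epsilon> / 4" if "j \<in> F" for j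
  proof -
    note hyps = a_inv[OF Fj(1)[OF that]] b_inv p dm dominated_conv[OF dle] dominated_in_Lp[OF dle dm] csum[OF that]
    show "in_Lp p lebesgue (E1 j)"
      unfolding E1_def[abs_def] using in_Lp_synthesis_scale[where a=a and b=b and p=p and \<psi>="\<lambda>x. \<psi> x - trunc N x" and j=j and c="coeff f", OF hyps] by simp
    have "nrm (E1 j) \<le>
      tile_norm p b (\<lambda>x. \<psi> x - trunc N x) * lp_norm p (coeff f j)"
      using Lp_norm_synthesis_scale[where a=a and b=b and p=p and \<psi>="\<lambda>x. \<psi> x - trunc N x" and j=j and c="coeff f", OF hyps] unfolding E1_def[abs_def] lp_norm_def by simp
    also have "\<dots> \<le> \<eta> * (D * (Nf + 1))"
    proof (intro mult_mono)
      have "D * (Nf + min 1 \<epsilon>) \<le> D * (Nf + 1)" using D_pos by (intro mult_left_mono) auto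
      then show "lp_norm p (coeff f j) \<le> D * (Nf + 1)" using lp[OF that] by linarith
    qed (use N(1) \<eta> in simp_all)
    finally show "nrm (E1 j) \<le> \<epsilon> / 4" using \<eta>1 by linarith
  qed
  have E2: "in_Lp p lebesgue (E2 j)" "nrm (E2 j) \<le> \<epsilon> / 4" if "j \<in> F" for j
  proof -
    note A = a_inv[OF Fj(1)[OF that]]
    have tle: "norm (trunc N x) \<le> norm (\<psi> x)" for x by (rule norm_trunc_le(1))
    have sm: "synthesis_scale p a b (trunc N) (coeff f) j \<in> borel_measurable lebesgue"
      using in_Lp_synthesis_scale[where a=a and b=b and p=p and \<psi>="trunc N" and j=j and c="coeff f", OF A b_inv p trunc_meas dominated_conv[OF tle]
          dominated_in_Lp[OF tle trunc_meas] csum[OF that]] by (simp add: in_Lp_def)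
    have m: "E2 j \<in> borel_measurable lebesgue"
      unfolding E2_def[abs_def]
      by (intro borel_measurable_diff borel_measurable_times borel_measurable_const sm
          osc.g_dilate_measurable Fj(1) that cc_fun_measurable f)
    have b2: "AE x in lebesgue. norm (E2 j x) \<le> q * \<epsilon>1 * indicator ?B x"
      unfolding E2_def q_def
      by (intro AE_I2) (rule trunc_synthesis_error[where T=T, OF Fj(1)[OF that] f _ less_imp_le[OF \<epsilon>1]
          j1[OF Fj(3)[OF that]]], simp_all add: T_def)
    have q1: "0 \<le> q * \<epsilon>1" using q \<epsilon>1 by simp
    show "in_Lp p lebesgue (E2 j)" by (rule in_Lp_bounded_support(1)[OF p m lmeasurable_cball q1 b2])
    show "nrm (E2 j) \<le> \<epsilon> / 4"
      using in_Lp_bounded_support(2)[OF p m lmeasurable_cball q1 b2] e2 unfolding \<beta>_def by linarith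
  qed
  have E3: "in_Lp p lebesgue (\<lambda>x. f x * oscillation N (a j *v x))" if "j \<in> F" for j
  proof -
    let ?M = "complex_of_real (\<bar>det b\<bar> * real N + norm (trunc_mean N))"
    have m: "(\<lambda>x. f x * oscillation N (a j *v x)) \<in> borel_measurable lebesgue"
      by (intro borel_measurable_times osc.g_dilate_measurable Fj(1) that cc_fun_measurable f)
    have "norm ?M = \<bar>det b\<bar> * real N + norm (trunc_mean N)" unfolding norm_of_real by simp
    then have "norm (f x * oscillation N (a j *v x)) \<le> norm (?M * f x)" for x
      using osc.norm_mult_g_le[of "f x" "a j *v x"] by (simp only: norm_mult[of ?M])
    then have "AE x in lebesgue. norm (f x * oscillation N (a j *v x)) \<le> norm (?M * f x)" by simp
    from in_Lp_bound[OF m in_Lp_mult_left[OF fLp] this p] show ?thesis .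
  qed

  have sc: "S c j x = ?\<iota> * (E1 j x + E2 j x + f x * oscillation N (a j *v x) + trunc_mean N * f x)"
    if "j \<in> F" for j x
  proof -
    have "S c j x = ?\<iota> * S (coeff f) j x"
      using that by (simp add: synthesis_scale_def c_def mult.assoc infsum_cmult_right')
    also have "S (coeff f) j x = E1 j x + synthesis_scale p a b (trunc N) (coeff f) j x"
      unfolding E1_def by (rule synthesis_scale_coeff_diff[OF Fj(1)[OF that] f])
    finally show ?thesis by (simp add: E2_def)
  qed
  define G1 where "G1 x = ?\<iota> * (\<Sum>j\<in>F. E1 j x)" for x
  define G2 where "G2 x = ?\<iota> * (\<Sum>j\<in>F. E2 j x)" for x
  define G3 where "G3 x = ?\<iota> * (\<Sum>j\<in>F. f x * oscillation N (a j *v x))" for x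
  define G4 where "G4 x = (trunc_mean N - 1) * f x" for x
  have G1: "in_Lp p lebesgue G1" "nrm G1 \<le> \<epsilon> / 4"
    unfolding G1_def[abs_def] using in_Lp_average[OF p F(1,2) E1] Lp_norm_average[OF p F(1,2) E1] by auto
  have G2: "in_Lp p lebesgue G2" "nrm G2 \<le> \<epsilon> / 4"
    unfolding G2_def[abs_def] using in_Lp_average[OF p F(1,2) E2] Lp_norm_average[OF p F(1,2) E2] by auto
  have G3: "in_Lp p lebesgue G3" "nrm G3 \<le> \<epsilon> / 4"
    unfolding G3_def[abs_def] using p E3 Fosc by (auto intro!: in_Lp_mult_left in_Lp_sum)
  have G4: "in_Lp p lebesgue G4" "nrm G4 \<le> \<epsilon> / 4"
  proof -
    show "in_Lp p lebesgue G4" unfolding G4_def[abs_def] by (rule in_Lp_mult_left[OF fLp])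
    have "nrm G4 = norm (1 - trunc_mean N) * Nf"
      unfolding G4_def[abs_def] Lp_norm_mult_left[OF p] Nf_def by (simp add: norm_minus_commute)
    also have "\<dots> \<le> \<eta> * Nf" using N(2) Nf by (intro mult_right_mono) auto
    finally show "nrm G4 \<le> \<epsilon> / 4" using \<eta>2 by linarith
  qed
  \<comment> \<open>The term \<open>trunc_mean N * f x\<close> is the same at every scale, so
    averaging reproduces it; its distance from \<open>f x\<close> is \<open>G4 x\<close>.\<close>
  have sumF: "(\<Sum>j\<in>F. S c j x) - f x = (G1 x + G2 x) + (G3 x + G4 x)" for x
  proof -
    have "(\<Sum>j\<in>F. S c j x) = G1 x + G2 x + G3 x + ?\<iota> * (of_nat (card F) * (trunc_mean N * f x))"
      using sc by (simp add: G1_def G2_def G3_def sum_distrib_left[symmetric] sum.distrib distrib_left)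
    also have "?\<iota> * (of_nat (card F) * (trunc_mean N * f x)) = trunc_mean N * f x"
      using n by (simp add: mult.assoc[symmetric])
    finally show ?thesis by (simp add: G4_def algebra_simps)
  qed
  have "nrm (\<lambda>x. f x - (\<Sum>j\<in>F. S c j x))
      = nrm (\<lambda>x. (G1 x + G2 x) + (G3 x + G4 x))"
    using Lp_norm_minus_commute[of p lebesgue f "\<lambda>x. \<Sum>j\<in>F. S c j x"]
    by (simp only: sumF)
  also have "\<dots> \<le> nrm (\<lambda>x. G1 x + G2 x) + nrm (\<lambda>x. G3 x + G4 x)"
    by (intro Lp_norm_triangle p in_Lp_add G1 G2 G3 G4)
  also have "\<dots> \<le> (nrm G1 + nrm G2) + (nrm G3 + nrm G4)"
    by (intro add_mono Lp_norm_triangle p G1 G2 G3 G4)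
  finally have res: "nrm (\<lambda>x. f x - (\<Sum>j\<in>F. S c j x)) \<le> \<epsilon>"
    using G1(2) G2(2) G3(2) G4(2) by linarith

  have norms: "(\<Sum>j\<in>F. lp_norm p (c j)) \<le> D * (Nf + \<epsilon>)"
  proof -
    have "(\<Sum>j\<in>F. lp_norm p (c j)) = (\<Sum>j\<in>F. norm ?\<iota> * lp_norm p (coeff f j))"
      by (intro sum.cong) (simp_all add: c_def lp_norm_mult_left[OF p])
    also have "\<dots> \<le> real (card F) * (norm ?\<iota> * (D * (Nf + min 1 \<epsilon>)))"
      using lp by (intro sum_bounded_above mult_left_mono) auto
    also have "\<dots> = D * (Nf + min 1 \<epsilon>)"
      using n by (simp add: norm_inverse)
    also have "\<dots> \<le> D * (Nf + \<epsilon>)" using D_pos by (intro mult_left_mono) auto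
    finally show ?thesis .
  qed
  have summ: "(\<lambda>k. norm (c j k) powr p) summable_on UNIV" for j
  proof (cases "j \<in> F")
    case True
    have "(\<lambda>k. norm ?\<iota> powr p * norm (coeff f j k) powr p) summable_on UNIV"
      using csum[OF True] by (rule summable_on_cmult_right)
    with True show ?thesis by (simp add: c_def norm_mult powr_mult)
  qed (simp add: c_def)
  have supp: "F \<subseteq> {j0..}" "\<forall>j. j \<notin> F \<longrightarrow> c j = (\<lambda>k. 0)"
    using Fj(2) by (auto simp: c_def)
  show ?thesis
    by (rule exI[of _ c], rule exI[of _ F]) (intro conjI allI F(1) supp summ norms[unfolded Nf_def] res)
qed

end

subsection \<open>Exact representations\<close>

lemma synthesis_scale_cong:
  "c j = c' j \<Longrightarrow> synthesis_scale p a b \<psi> c j = synthesis_scale p a b \<psi> c' j"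
  by (simp add: synthesis_scale_def fun_eq_iff)

lemma synthesis_scale_zero:
  "c j = (\<lambda>k. 0) \<Longrightarrow> synthesis_scale p a b \<psi> c j = (\<lambda>x. 0)"
  by (simp add: synthesis_scale_def fun_eq_iff)

context affine_synthesis
begin

definition W :: real where
  "W = tile_norm p b \<psi>"

lemma W_nonneg: "0 \<le> W"
  by (simp add: W_def)

lemma
  assumes "1 \<le> j" "(\<lambda>k. norm (c j k) powr p) summable_on UNIV"
  shows scale_in_Lp: "in_Lp p lebesgue (S c j)"
    and scale_Lp_norm: "nrm (S c j) \<le> W * lp_norm p (c j)"
    and scale_summable: "AE x in lebesgue. (\<lambda>k. norm (c j k * affine_fun p a b \<psi> j k x)) summable_on UNIV"
proof -
  show "in_Lp p lebesgue (S c j)"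
    by (rule in_Lp_synthesis_scale[where a=a and j=j and c=c, OF a_inv[OF assms(1)] b_inv p \<psi>_meas \<psi>_conv \<psi>_sum assms(2)])
  show "nrm (S c j) \<le> W * lp_norm p (c j)"
    unfolding W_def lp_norm_def
    by (rule Lp_norm_synthesis_scale[where a=a and j=j and c=c, OF a_inv[OF assms(1)] b_inv p \<psi>_meas \<psi>_conv \<psi>_sum assms(2)])
  show "AE x in lebesgue. (\<lambda>k. norm (c j k * affine_fun p a b \<psi> j k x)) summable_on UNIV"
    by (rule synthesis_scale_summable[where a=a and j=j and c=c, OF a_inv[OF assms(1)] b_inv p \<psi>_meas \<psi>_conv \<psi>_sum assms(2)])
qed

lemma approx_Lp:
  assumes f: "in_Lp p lebesgue f" and \<epsilon>: "\<epsilon> > 0" and j0: "1 \<le> j0"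
  shows "\<exists>c F. finite F \<and> F \<subseteq> {j0..} \<and> (\<forall>j. j \<notin> F \<longrightarrow> c j = (\<lambda>k. 0)) \<and>
    (\<forall>j. (\<lambda>k. norm (c j k) powr p) summable_on UNIV) \<and>
    (\<Sum>j\<in>F. lp_norm p (c j)) \<le> D * (nrm f + \<epsilon>) \<and>
    nrm (\<lambda>x. f x - (\<Sum>j\<in>F. S c j x)) \<le> \<epsilon>"
proof -
  have \<epsilon>2: "\<epsilon> / 2 > 0" using \<epsilon> by simp
  obtain g where g: "cc_fun g" "nrm (\<lambda>x. f x - g x) < \<epsilon> / 2"
    using Lp_approx_cc_fun[OF p f \<epsilon>2] by blast
  have gLp: "in_Lp p lebesgue g" using cc_fun_in_Lp[OF g(1) p] .
  obtain c F where cF: "finite F" "F \<subseteq> {j0..}" "\<forall>j. j \<notin> F \<longrightarrow> c j = (\<lambda>k. 0)"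
    "\<forall>j. (\<lambda>k. norm (c j k) powr p) summable_on UNIV"
    "(\<Sum>j\<in>F. lp_norm p (c j)) \<le> D * (nrm g + \<epsilon> / 2)"
    "nrm (\<lambda>x. g x - (\<Sum>j\<in>F. S c j x)) \<le> \<epsilon> / 2"
    using approx_cc_fun[OF g(1) \<epsilon>2 j0] by blast
  have SLp: "in_Lp p lebesgue (\<lambda>x. \<Sum>j\<in>F. S c j x)"
    using cF(2,4) j0 by (intro in_Lp_sum p scale_in_Lp) auto
  have "nrm (\<lambda>x. f x + (g x - f x)) \<le> nrm f + nrm (\<lambda>x. g x - f x)"
    by (rule Lp_norm_triangle[OF p f in_Lp_diff[OF p gLp f]])
  then have "nrm g \<le> nrm f + \<epsilon> / 2"
    using g(2) Lp_norm_minus_commute[of p lebesgue f g] by simp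
  then have "D * (nrm g + \<epsilon> / 2) \<le> D * (nrm f + \<epsilon>)"
    using D_pos by (intro mult_left_mono) auto
  then have bound: "(\<Sum>j\<in>F. lp_norm p (c j)) \<le> D * (nrm f + \<epsilon>)"
    using cF(5) by linarith
  have "nrm (\<lambda>x. f x - (\<Sum>j\<in>F. S c j x)) \<le>
    nrm (\<lambda>x. f x - g x) + nrm (\<lambda>x. g x - (\<Sum>j\<in>F. S c j x))"
    by (rule Lp_norm_triangle_diff[OF p in_Lp_diff[OF p f gLp] in_Lp_diff[OF p gLp SLp]])
  then have res: "nrm (\<lambda>x. f x - (\<Sum>j\<in>F. S c j x)) \<le> \<epsilon>"
    using g(2) cF(6) by linarith
  show ?thesis
    by (rule exI[of _ c], rule exI[of _ F]) (intro conjI cF(1-4) bound res)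
qed

text \<open>The upper limit is excluded, so \<open>J\<close> is the lowest scale still free and the
  next extension may start there.\<close>

definition partial_sum :: "(nat \<Rightarrow> int^'n \<Rightarrow> complex) \<Rightarrow> nat \<Rightarrow> real^'n \<Rightarrow> complex" where
  "partial_sum c J x = (\<Sum>j\<in>{1..<J}. S c j x)"

lemma partial_sum_in_Lp:
  assumes "\<And>j. (\<lambda>k. norm (c j k) powr p) summable_on UNIV"
  shows "in_Lp p lebesgue (partial_sum c J)"
  unfolding partial_sum_def[abs_def] using assms by (intro in_Lp_sum p scale_in_Lp) auto

lemma partial_sum_cong:
  assumes "\<And>j. j < J \<Longrightarrow> c j = c' j"
  shows "partial_sum c J = partial_sum c' J"
proof
  fix x
  show "partial_sum c J x = partial_sum c' J x"
    unfolding partial_sum_def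
    by (intro sum.cong refl fun_cong[OF synthesis_scale_cong] assms) simp
qed

text \<open>The current remainder is approximated on scales from \<open>J\<close> on, and the
  coefficients below \<open>J\<close> are left alone, so norms and partial sums both split at
  \<open>J\<close>. The new coefficients cost \<open>D\<close> times the norm of the remainder, not
  of \<open>f\<close>.\<close>

lemma extension_step:
  assumes f: "in_Lp p lebesgue f" and \<epsilon>: "\<epsilon> > 0" and J: "1 \<le> J"
    and c: "\<And>j. (\<lambda>k. norm (c j k) powr p) summable_on UNIV"
  shows "\<exists>J' c'. J < J' \<and> (\<forall>j<J. c' j = c j) \<and>
    (\<forall>j. (\<lambda>k. norm (c' j k) powr p) summable_on UNIV) \<and>
    (\<Sum>j\<in>{1..<J'}. lp_norm p (c' j)) \<le> (\<Sum>j\<in>{1..<J}. lp_norm p (c j)) +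
      D * (nrm (\<lambda>x. f x - partial_sum c J x) + \<epsilon>) \<and>
    nrm (\<lambda>x. f x - partial_sum c' J' x) \<le> \<epsilon>"
proof -
  have r: "in_Lp p lebesgue (\<lambda>x. f x - partial_sum c J x)"
    by (rule in_Lp_diff[OF p f partial_sum_in_Lp[OF c]])
  obtain d F where dF: "finite F" "F \<subseteq> {J..}" "\<forall>j. j \<notin> F \<longrightarrow> d j = (\<lambda>k. 0)"
    "\<forall>j. (\<lambda>k. norm (d j k) powr p) summable_on UNIV"
    "(\<Sum>j\<in>F. lp_norm p (d j)) \<le> D * (nrm (\<lambda>x. f x - partial_sum c J x) + \<epsilon>)"
    "nrm (\<lambda>x. f x - partial_sum c J x - (\<Sum>j\<in>F. S d j x)) \<le> \<epsilon>"
    using approx_Lp[OF r \<epsilon> J] by blast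
  \<comment> \<open>Inserting \<open>J\<close> makes the new bound exceed \<open>J\<close> even if
    \<open>F\<close> is empty.\<close>
  obtain J' where J': "J < J'" "\<forall>j\<in>F. j < J'"
  proof (rule that)
    show "J < Suc (Max (insert J F))" "\<forall>j\<in>F. j < Suc (Max (insert J F))"
      using dF(1) by (auto simp: less_Suc_eq_le)
  qed
  define c' where "c' j = (if j < J then c j else d j)" for j
  have split: "{1..<J'} = {1..<J} \<union> {J..<J'}" using J J' by auto
  have F: "F \<subseteq> {J..<J'}" using dF(2) J'(2) by auto
  have sum_split: "(\<Sum>j\<in>{1..<J'}. h j) = (\<Sum>j\<in>{1..<J}. h j) + (\<Sum>j\<in>F. h j)"
    if "\<And>j. J \<le> j \<Longrightarrow> j \<notin> F \<Longrightarrow> h j = 0" for h :: "nat \<Rightarrow> 'z::comm_monoid_add"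
  proof -
    have "(\<Sum>j\<in>{1..<J'}. h j) = (\<Sum>j\<in>{1..<J}. h j) + (\<Sum>j\<in>{J..<J'}. h j)"
      unfolding split by (rule sum.union_disjoint) auto
    also have "(\<Sum>j\<in>{J..<J'}. h j) = (\<Sum>j\<in>F. h j)"
      using F that by (intro sum.mono_neutral_right) auto
    finally show ?thesis .
  qed
  have z: "c' j = (\<lambda>k. 0)" if "J \<le> j" "j \<notin> F" for j
    using that dF(3) by (simp add: c'_def)
  have eqF: "c' j = d j" if "j \<in> F" for j using that F by (auto simp: c'_def)
  have "(\<Sum>j\<in>{1..<J'}. lp_norm p (c' j)) = (\<Sum>j\<in>{1..<J}. lp_norm p (c' j)) + (\<Sum>j\<in>F. lp_norm p (c' j))"
    by (rule sum_split) (simp add: z)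
  also have "\<dots> = (\<Sum>j\<in>{1..<J}. lp_norm p (c j)) + (\<Sum>j\<in>F. lp_norm p (d j))"
    by (intro arg_cong2[where f="(+)"] sum.cong) (auto simp: eqF, simp add: c'_def)
  finally have norms: "(\<Sum>j\<in>{1..<J'}. lp_norm p (c' j)) \<le> (\<Sum>j\<in>{1..<J}. lp_norm p (c j)) +
      D * (nrm (\<lambda>x. f x - partial_sum c J x) + \<epsilon>)"
    using dF(5) by linarith
  have "partial_sum c' J' x = partial_sum c J x + (\<Sum>j\<in>F. S d j x)" for x
  proof -
    have "partial_sum c' J' x = partial_sum c' J x + (\<Sum>j\<in>F. S c' j x)"
      unfolding partial_sum_def by (rule sum_split) (simp add: synthesis_scale_zero z)
    also have "partial_sum c' J = partial_sum c J" by (rule partial_sum_cong) (simp add: c'_def)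
    also have "(\<Sum>j\<in>F. S c' j x) = (\<Sum>j\<in>F. S d j x)"
      by (intro sum.cong refl fun_cong[OF synthesis_scale_cong] eqF)
    finally show ?thesis .
  qed
  then have res: "nrm (\<lambda>x. f x - partial_sum c' J' x) \<le> \<epsilon>"
    using dF(6) by (simp add: diff_diff_eq)
  have "\<forall>j<J. c' j = c j" by (simp add: c'_def)
  moreover have "\<forall>j. (\<lambda>k. norm (c' j k) powr p) summable_on UNIV"
    using c dF(4) by (simp add: c'_def)
  ultimately show ?thesis using J'(1) norms res by blast
qed

text \<open>The invariant concerns \<open>?tot s + D * ?res s\<close>: the coefficient norm already
  spent plus \<open>D\<close> times the remainder. A step pays for its new coefficients out of the
  second summand and raises the sum by at most twice \<open>D * \<delta> / 2 ^ Suc n\<close>; these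
  increments add up to at most \<open>2 * D * \<delta>\<close>.\<close>

lemma synthesis_exists:
  assumes f: "in_Lp p lebesgue f" and \<delta>: "\<delta> > 0"
  shows "\<exists>c. in_l1lp p c \<and> synthesizes p a b \<psi> c f \<and> l1lp_norm p c \<le> D * (nrm f + 2 * \<delta>)"
proof -
  let ?Nf = "nrm f"
  let ?res = "\<lambda>s. nrm (\<lambda>x. f x - partial_sum (snd s) (fst s) x)"
  let ?tot = "\<lambda>s. \<Sum>j\<in>{1..<fst s}. lp_norm p (snd s j)"
  \<comment> \<open>\<open>Suc n \<le> fst s\<close> ensures that every scale is settled at some
    stage. At stage 0 the remainder is \<open>f\<close> itself, which is not small, so the last
    clause exempts \<open>n = 0\<close>.\<close>
  define P where "P n s \<longleftrightarrow> Suc n \<le> fst s \<and> (\<forall>j. (\<lambda>k. norm (snd s j k) powr p) summable_on UNIV) \<and>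
    ?tot s + D * ?res s \<le> D * (?Nf + 2 * \<delta> * (1 - 1 / 2 ^ n)) \<and> (n = 0 \<or> ?res s \<le> \<delta> / 2 ^ n)"
    for n and s :: "nat \<times> (nat \<Rightarrow> int^'n \<Rightarrow> complex)"
  define Q where "Q s s' \<longleftrightarrow> fst s < fst s' \<and> (\<forall>j<fst s. snd s' j = snd s j)"
    for s s' :: "nat \<times> (nat \<Rightarrow> int^'n \<Rightarrow> complex)"
  have "\<exists>s. \<forall>n. P n (s n) \<and> Q (s n) (s (Suc n))"
  proof (rule dependent_nat_choice)
    have "P 0 (1, \<lambda>j k. 0)"
      by (simp add: P_def partial_sum_def)
    then show "\<exists>s. P 0 s" ..
  next
    fix s n assume P: "P n s"
    let ?\<epsilon> = "\<delta> / 2 ^ Suc n"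
    have \<epsilon>: "?\<epsilon> > 0" using \<delta> by simp
    have s1: "1 \<le> fst s" and ssum: "\<And>j. (\<lambda>k. norm (snd s j k) powr p) summable_on UNIV"
      using P by (auto simp: P_def)
    obtain J' c' where ext: "fst s < J'" "\<forall>j<fst s. c' j = snd s j"
      "\<forall>j. (\<lambda>k. norm (c' j k) powr p) summable_on UNIV"
      "(\<Sum>j\<in>{1..<J'}. lp_norm p (c' j)) \<le> ?tot s + D * (?res s + ?\<epsilon>)"
      "nrm (\<lambda>x. f x - partial_sum c' J' x) \<le> ?\<epsilon>"
      using extension_step[where c="snd s", OF f \<epsilon> s1 ssum] by (elim exE conjE) (rule that)
    have "D * nrm (\<lambda>x. f x - partial_sum c' J' x) \<le> D * ?\<epsilon>"
      using ext(5) D_pos by (intro mult_left_mono) auto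
    moreover have "u + v \<le> t + r + 2 * e" if "v \<le> e" "u \<le> t + (r + e)" for u v t r e :: real
      using that by linarith
    ultimately have "(\<Sum>j\<in>{1..<J'}. lp_norm p (c' j)) + D * nrm (\<lambda>x. f x - partial_sum c' J' x)
        \<le> ?tot s + D * ?res s + 2 * (D * ?\<epsilon>)"
      using ext(4)[unfolded distrib_left] by blast
    also have "\<dots> \<le> D * (?Nf + 2 * \<delta> * (1 - 1 / 2 ^ n)) + 2 * (D * ?\<epsilon>)"
      using P unfolding P_def by linarith
    also have "\<dots> = D * (?Nf + 2 * \<delta> * (1 - 1 / 2 ^ Suc n))"
      by (simp add: algebra_simps)
    finally have "(\<Sum>j\<in>{1..<J'}. lp_norm p (c' j)) + D * nrm (\<lambda>x. f x - partial_sum c' J' x)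
        \<le> D * (?Nf + 2 * \<delta> * (1 - 1 / 2 ^ Suc n))" .
    moreover have "Suc (Suc n) \<le> J'" using P ext(1) unfolding P_def by linarith
    ultimately have "P (Suc n) (J', c')"
      using ext(3,5) unfolding P_def fst_conv snd_conv by blast
    moreover have "Q s (J', c')" using ext by (simp add: Q_def)
    ultimately show "\<exists>s'. P (Suc n) s' \<and> Q s s'" by blast
  qed
  then obtain s where sP: "\<And>n. P n (s n)" and sQ: "\<And>n. Q (s n) (s (Suc n))" by blast
  define J where "J n = fst (s n)" for n
  define C where "C n = snd (s n)" for n
  have Jn: "n < J n" for n using sP[of n] by (simp add: P_def J_def)
  have Jmono: "J n \<le> J m" if "n \<le> m" for n m
    using that by (rule lift_Suc_mono_le[rotated]) (use sQ in \<open>simp add: Q_def J_def less_imp_le\<close>)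
  have stable: "C m j = C n j" if "n \<le> m" "j < J n" for n m j
    using that(1)
  proof (induction m rule: dec_induct)
    case (step m)
    have "j < J m" using that(2) Jmono[OF step(1)] by linarith
    then show ?case using sQ[of m] step by (simp add: Q_def J_def C_def)
  qed simp
  \<comment> \<open>Scale \<open>j\<close> is settled by stage \<open>Suc j\<close>, because
    \<open>j < J (Suc j)\<close>, and later stages do not touch it.\<close>
  define c where "c j = C (Suc j) j" for j
  have c_eq: "c j = C n j" if "j < J n" for j n
  proof (cases "n \<le> Suc j")
    case True
    then show ?thesis unfolding c_def using that by (rule stable)
  next
    case False
    then have "Suc j \<le> n" by simp
    moreover have "j < J (Suc j)" using Jn[of "Suc j"] by simp
    ultimately show ?thesis unfolding c_def by (rule stable[symmetric])
  qed
  have csum: "(\<lambda>k. norm (c j k) powr p) summable_on UNIV" for j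
    using sP[of "Suc j"] by (simp add: P_def c_def C_def)
  have ps: "partial_sum c (J n) = partial_sum (C n) (J n)" for n
    by (rule partial_sum_cong) (rule c_eq)
  let ?bd = "D * (?Nf + 2 * \<delta>)"
  have tot: "(\<Sum>j\<in>{1..<J n}. lp_norm p (c j)) \<le> ?bd" for n
  proof -
    have "(\<Sum>j\<in>{1..<J n}. lp_norm p (c j)) = ?tot (s n)"
      by (intro sum.cong) (auto simp: J_def[symmetric] C_def[symmetric] c_eq)
    moreover have "0 \<le> D * ?res (s n)" using D_pos by simp
    ultimately have "(\<Sum>j\<in>{1..<J n}. lp_norm p (c j)) \<le> D * (?Nf + 2 * \<delta> * (1 - 1 / 2 ^ n))"
      using sP[of n] unfolding P_def by linarith
    also have "\<dots> \<le> ?bd" using D_pos \<delta> by (intro mult_left_mono add_left_mono) auto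
    finally show ?thesis .
  qed
  have fin_bd: "(\<Sum>j\<in>F. lp_norm p (c j)) \<le> ?bd" if "finite F" "F \<subseteq> {1..}" for F
  proof -
    have "F \<subseteq> {1..<J (Max (insert 0 F))}"
    proof
      fix j assume "j \<in> F"
      then have "j \<le> Max (insert 0 F)" using that(1) by simp
      then show "j \<in> {1..<J (Max (insert 0 F))}" using Jn[of "Max (insert 0 F)"] that(2) \<open>j \<in> F\<close> by auto
    qed
    then have "(\<Sum>j\<in>F. lp_norm p (c j)) \<le> (\<Sum>j\<in>{1..<J (Max (insert 0 F))}. lp_norm p (c j))"
      by (intro sum_mono2) auto
    with tot show ?thesis by (rule order_trans[rotated])
  qed
  have lsum: "(\<lambda>j. lp_norm p (c j)) summable_on {1..}"
    by (rule nonneg_bdd_above_summable_on) (auto intro!: bdd_aboveI[where M="?bd"] fin_bd)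
  have l1: "in_l1lp p c"
    using csum lsum by (simp add: in_l1lp_def lp_norm_def[abs_def])
  have norm_le: "l1lp_norm p c \<le> ?bd"
    using infsum_le_finite_sums[OF lsum fin_bd] by (simp add: l1lp_norm_def lp_norm_def[abs_def])
  define \<sigma> where "\<sigma> K = (\<Sum>j\<in>{1..<K}. lp_norm p (c j))" for K
  have "incseq \<sigma>" unfolding \<sigma>_def by (intro monoI sum_mono2) auto
  moreover have "\<sigma> K \<le> ?bd" for K unfolding \<sigma>_def by (intro fin_bd) auto
  ultimately obtain L where L: "\<sigma> \<longlonglongrightarrow> L" "\<forall>i. \<sigma> i \<le> L"
    using incseq_convergent by blast
  have J_lim: "filterlim J at_top sequentially"
    by (rule filterlim_at_top_mono[OF filterlim_ident]) (simp add: Jn less_imp_le)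
  \<comment> \<open>By construction the remainders are small only along the subsequence
    \<open>J n\<close>. For any later \<open>K\<close> the additional scales are bounded by a tail
    of the convergent series of coefficient norms.\<close>
  have res_bound: "nrm (\<lambda>x. f x - partial_sum c K x)
      \<le> \<delta> / 2 ^ n + W * (L - \<sigma> (J n))" if "J n \<le> K" "n > 0" for K n
  proof -
    have tail: "partial_sum c K x - partial_sum c (J n) x = (\<Sum>j\<in>{J n..<K}. S c j x)" for x
    proof -
      have "{1..<K} = {1..<J n} \<union> {J n..<K}" using that(1) Jn[of n] by auto
      then show ?thesis unfolding partial_sum_def by (simp add: sum.union_disjoint ivl_disj_int)
    qed
    have j1: "1 \<le> j" if "j \<in> {J n..<K}" for j using that Jn[of n] by auto
    have "nrm (\<lambda>x. partial_sum c (J n) x - partial_sum c K x)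
        = nrm (\<lambda>x. \<Sum>j\<in>{J n..<K}. S c j x)"
      unfolding tail[symmetric] by (rule Lp_norm_minus_commute)
    also have "\<dots> \<le> (\<Sum>j\<in>{J n..<K}. nrm (S c j))"
      by (intro Lp_norm_sum p scale_in_Lp j1 csum)
    also have "\<dots> \<le> (\<Sum>j\<in>{J n..<K}. W * lp_norm p (c j))"
      by (intro sum_mono scale_Lp_norm j1 csum)
    also have "\<dots> = W * (\<sigma> K - \<sigma> (J n))"
    proof -
      have "{1..<K} = {1..<J n} \<union> {J n..<K}" using that(1) Jn[of n] by auto
      then show ?thesis unfolding \<sigma>_def by (simp add: sum.union_disjoint ivl_disj_int sum_distrib_left)
    qed
    also have "\<dots> \<le> W * (L - \<sigma> (J n))" using L(2) W_nonneg by (intro mult_left_mono) auto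
    finally have 1: "nrm (\<lambda>x. partial_sum c (J n) x - partial_sum c K x) \<le> W * (L - \<sigma> (J n))" .
    have 2: "nrm (\<lambda>x. f x - partial_sum c (J n) x) \<le> \<delta> / 2 ^ n"
      using sP[of n] that(2) unfolding ps P_def by (simp add: J_def C_def)
    have "nrm (\<lambda>x. f x - partial_sum c K x) \<le> nrm (\<lambda>x. f x - partial_sum c (J n) x)
        + nrm (\<lambda>x. partial_sum c (J n) x - partial_sum c K x)"
      by (intro Lp_norm_triangle_diff p in_Lp_diff f partial_sum_in_Lp csum)
    with 1 2 show ?thesis by linarith
  qed
  have lim: "(\<lambda>K. nrm (\<lambda>x. f x - (\<Sum>j=1..K. S c j x))) \<longlonglongrightarrow> 0"
  proof (rule LIMSEQ_I)
    fix r :: real assume r: "r > 0"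
    have "(\<lambda>n. \<delta> * (1 / 2) ^ n + W * (L - \<sigma> (J n))) \<longlonglongrightarrow> \<delta> * 0 + W * (L - L)"
      by (intro tendsto_intros filterlim_compose[OF L(1) J_lim] LIMSEQ_power_zero) simp
    then have "eventually (\<lambda>n. \<delta> * (1 / 2) ^ n + W * (L - \<sigma> (J n)) < r) sequentially"
      using r by (intro order_tendstoD(2)[where y="\<delta> * 0 + W * (L - L)"]) auto
    then have "eventually (\<lambda>n. \<delta> * (1 / 2) ^ n + W * (L - \<sigma> (J n)) < r \<and> 0 < n) sequentially"
      using eventually_gt_at_top by (rule eventually_conj)
    from eventually_happens'[OF sequentially_bot this]
    obtain n where n: "\<delta> / 2 ^ n + W * (L - \<sigma> (J n)) < r" "0 < n"
      by (auto simp: power_divide)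
    have "norm (nrm (\<lambda>x. f x - (\<Sum>j=1..K. S c j x)) - 0) < r" if "K \<ge> J n" for K
    proof -
      have "{1..K} = {1..<Suc K}" by auto
      then have "(\<lambda>x. f x - (\<Sum>j=1..K. S c j x)) = (\<lambda>x. f x - partial_sum c (Suc K) x)"
        by (simp only: partial_sum_def)
      then show ?thesis using res_bound[of n "Suc K"] n that by simp
    qed
    then show "\<exists>no. \<forall>K\<ge>no. norm (nrm (\<lambda>x. f x - (\<Sum>j=1..K. S c j x)) - 0) < r"
      by blast
  qed
  have "(\<lambda>j. nrm (S c j)) summable_on {1..}"
    by (rule summable_on_comparison_test[OF summable_on_cmult_right[OF lsum, of W]])
      (auto intro!: scale_Lp_norm csum)
  then have "synthesizes p a b \<psi> c f"
    unfolding synthesizes_def by (intro conjI allI impI scale_summable scale_in_Lp csum lim)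
  with l1 norm_le show ?thesis by blast
qed

section \<open>The two inequalities and positivity of the constant\<close>

lemma synthesis_lower_bound:
  assumes f: "in_Lp p lebesgue f" and c: "in_l1lp p c" and s: "synthesizes p a b \<psi> c f"
  shows "nrm f \<le> W * l1lp_norm p c"
proof (rule LIMSEQ_le_const)
  let ?S = "\<lambda>J x. \<Sum>j=1..J. S c j x"
  have csum: "(\<lambda>k. norm (c j k) powr p) summable_on UNIV" if "1 \<le> j" for j
    using c that by (simp add: in_l1lp_def)
  have lsum: "(\<lambda>j. lp_norm p (c j)) summable_on {1..}"
    using c by (simp add: in_l1lp_def lp_norm_def[abs_def])
  have "(\<lambda>J. nrm (\<lambda>x. f x - ?S J x)) \<longlonglongrightarrow> 0"
    using s by (simp add: synthesizes_def)
  from tendsto_add[OF this tendsto_const[of "W * l1lp_norm p c"]]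
  show "(\<lambda>J. nrm (\<lambda>x. f x - ?S J x) + W * l1lp_norm p c) \<longlonglongrightarrow> W * l1lp_norm p c" by simp
  show "\<exists>N. \<forall>J\<ge>N. nrm f \<le> nrm (\<lambda>x. f x - ?S J x) + W * l1lp_norm p c"
  proof (intro exI allI impI)
    fix J
    have SLp: "in_Lp p lebesgue (?S J)" by (intro in_Lp_sum p scale_in_Lp csum) auto
    have "nrm (?S J) \<le> (\<Sum>j=1..J. nrm (S c j))"
      by (intro Lp_norm_sum p scale_in_Lp csum) auto
    also have "\<dots> \<le> (\<Sum>j=1..J. W * lp_norm p (c j))"
      by (intro sum_mono scale_Lp_norm csum) auto
    also have "\<dots> = W * (\<Sum>j=1..J. lp_norm p (c j))" by (rule sum_distrib_left[symmetric])
    also have "\<dots> \<le> W * l1lp_norm p c"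
      unfolding l1lp_norm_def lp_norm_def[symmetric] using W_nonneg
      by (intro mult_left_mono finite_sum_le_infsum lsum) auto
    finally have "nrm (?S J) \<le> W * l1lp_norm p c" .
    moreover have "nrm f \<le> nrm (\<lambda>x. f x - ?S J x) + nrm (?S J)"
      using Lp_norm_triangle[OF p in_Lp_diff[OF p f SLp] SLp] by simp
    ultimately show "nrm f \<le> nrm (\<lambda>x. f x - ?S J x) + W * l1lp_norm p c"
      by linarith
  qed
qed

text \<open>If \<open>W\<close> were 0, the lower bound would give norm 0 to every function that can
  be synthesized; but the indicator of the tile can be synthesized and has positive norm.\<close>

lemma W_pos: "W > 0"
proof (rule ccontr)
  assume "\<not> W > 0"
  then have W0: "W = 0" using W_nonneg by simp
  let ?f = "\<lambda>x. indicator (tile b) x :: complex"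
  have f: "in_Lp p lebesgue ?f"
    by (rule in_Lp_bounded_support(1)[OF p _ tile_lmeasurable(1)[of b], of _ 1]) (auto simp: indicator_def)
  obtain c where c: "in_l1lp p c" "synthesizes p a b \<psi> c ?f"
    using synthesis_exists[OF f, of 1] by auto
  have "nrm ?f \<le> 0" using synthesis_lower_bound[OF f c] W0 by simp
  then have "nrm ?f = 0" using Lp_norm_nonneg[of p lebesgue ?f] by linarith
  then have "(\<integral>x. norm (?f x) powr p \<partial>lebesgue) = 0 powr p"
    unfolding Lp_norm_powr[OF p, symmetric] by (rule arg_cong)
  moreover have "norm (?f x) powr p = indicator (tile b) x" for x
    using p by (simp add: indicator_def)
  ultimately have "measure lebesgue (tile b) = 0" by simp
  then show False unfolding tile_lmeasurable(2) using b_inv by (simp add: invertible_det_nz)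
qed

lemma synthesis_norm_upper:
  assumes f: "in_Lp p lebesgue f"
  shows "synthesis_norm p a b \<psi> f \<le> ennreal (D * nrm f)"
proof (rule ennreal_le_epsilon)
  fix e :: real assume e: "e > 0"
  \<comment> \<open>With \<delta> = e / (2D) the excess D * 2 * \<delta> equals
    \<open>e\<close>.\<close>
  have \<delta>: "e / (2 * D) > 0" using e D_pos by simp
  obtain c where c: "in_l1lp p c" "synthesizes p a b \<psi> c f"
    "l1lp_norm p c \<le> D * (nrm f + 2 * (e / (2 * D)))"
    using synthesis_exists[OF f \<delta>] by blast
  have "synthesis_norm p a b \<psi> f \<le> ennreal (l1lp_norm p c)"
    unfolding synthesis_norm_def using c by (intro Inf_lower) blast
  also have "\<dots> \<le> ennreal (D * nrm f + e)"
    using c(3) D_pos by (intro ennreal_leI) (simp add: distrib_left)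
  also have "\<dots> = ennreal (D * nrm f) + ennreal e"
    using D_pos e by (intro ennreal_plus) auto
  finally show "synthesis_norm p a b \<psi> f \<le> ennreal (D * nrm f) + ennreal e" .
qed

lemma synthesis_norm_lower:
  assumes f: "in_Lp p lebesgue f"
  shows "ennreal (inverse W * nrm f) \<le> synthesis_norm p a b \<psi> f"
  unfolding synthesis_norm_def
proof (rule Inf_greatest)
  fix z assume "z \<in> {ennreal (l1lp_norm p c) | c. in_l1lp p c \<and> synthesizes p a b \<psi> c f}"
  then obtain c where c: "z = ennreal (l1lp_norm p c)" "in_l1lp p c" "synthesizes p a b \<psi> c f" by blast
  have "inverse W * nrm f \<le> l1lp_norm p c"
    using synthesis_lower_bound[OF f c(2,3)] W_pos by (simp add: field_simps)
  then show "ennreal (inverse W * nrm f) \<le> z" unfolding c(1) by (rule ennreal_leI)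
qed

end

text \<open>Here p = 1 corresponds to q = \<infinity> and 1/q = 0. The equation rules out an
  infinite 1/q, so \<open>enn2real\<close> preserves its value.\<close>

lemma conjugate_exponent:
  assumes p: "1 \<le> p" and q: "1 / ennreal p + 1 / q = 1"
  shows "enn2real (1 / q) = 1 - 1 / p"
proof -
  have p1: "1 / ennreal p = ennreal (1 / p)"
    using divide_ennreal[of 1 p] p by simp
  have "1 / q \<noteq> top" using q by auto
  then obtain r where r: "0 \<le> r" "1 / q = ennreal r" by (cases "1 / q") auto
  have "ennreal (1 / p + r) = ennreal 1"
    using q p r by (simp add: p1 ennreal_plus)
  then have "1 / p + r = 1" using r p by (subst (asm) ennreal_inj) auto
  then show ?thesis using r by simp
qed

theorem corollary3:
  fixes a :: "nat \<Rightarrow> real^'n^'n"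
    and b :: "real^'n^'n"
    and \<psi> :: "real^'n \<Rightarrow> complex"
    and p :: real
    and q :: ennreal
  assumes a_inv: "\<And>j. j \<ge> 1 \<Longrightarrow> invertible (a j)"
    and a_exp: "expanding a"
    and b_inv: "invertible b"
    and p: "1 \<le> p"
    and q: "1 / ennreal p + 1 / q = 1"
    and \<psi>_Lp: "in_Lp p lebesgue \<psi>"
    and P\<psi>_conv: "periodization_converges b (\<lambda>x. norm (\<psi> x))"
    and P\<psi>_loc: "in_Lp_loc p (periodization b (\<lambda>x. norm (\<psi> x)))"
    and \<psi>_int: "(\<integral>x. \<psi> x \<partial>lebesgue) = 1"
  shows "(\<exists>A B :: real. 0 < A \<and> 0 < B \<and>
            (\<forall>f. in_Lp p lebesgue f \<longrightarrow>
               ennreal (A * Lp_norm p lebesgue f) \<le> synthesis_norm p a b \<psi> f \<and>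
               synthesis_norm p a b \<psi> f \<le> ennreal (B * Lp_norm p lebesgue f)))
       \<and> (\<forall>f. in_Lp p lebesgue f \<longrightarrow>
            ennreal (\<bar>det b\<bar>
                * inverse (Lp_norm p (lebesgue_on ((\<lambda>x. b *v x) ` unit_cube))
                            (periodization b (\<lambda>x. norm (\<psi> x))))
                * Lp_norm p lebesgue f)
              \<le> synthesis_norm p a b \<psi> f \<and>
            synthesis_norm p a b \<psi> f
              \<le> ennreal (\<bar>det b\<bar> powr enn2real (1 / q) * Lp_norm p lebesgue f))"
proof -
  let ?P = "periodization b (\<lambda>x. norm (\<psi> x))"
  have det: "\<bar>det b\<bar> > 0" using b_inv by (simp add: invertible_det_nz)
  have \<psi>m: "\<psi> \<in> borel_measurable lebesgue" using \<psi>_Lp by (simp add: in_Lp_def)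
  have P_eq: "?P = (\<lambda>x. \<bar>det b\<bar> * lattice_sum b \<psi> x)"
    by (simp add: periodization_def lattice_sum_def fun_eq_iff)
  have loc: "in_Lp p (lebesgue_on (tile b)) (lattice_sum b \<psi>)"
  proof -
    \<comment> \<open>Local integrability is tested on compact sets; the half-open tile is bounded,
      so its closure is compact and the integrability restricts to the tile.\<close>
    let ?K = "closure (tile b)"
    have "compact ?K" using bounded_tile[of b] by (rule compact_closure[THEN iffD2])
    then have "integrable (lebesgue_on ?K) (\<lambda>x. norm (?P x) powr p)"
      using P\<psi>_loc by (simp add: in_Lp_loc_def in_Lp_def)
    then have "set_integrable lebesgue ?K (\<lambda>x. norm (?P x) powr p)"
      unfolding set_integrable_def by (subst (asm) integrable_restrict_space) auto
    then have "set_integrable lebesgue (tile b) (\<lambda>x. norm (?P x) powr p)"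
      by (rule set_integrable_subset) (auto simp: closure_subset)
    then have "integrable (lebesgue_on (tile b)) (\<lambda>x. norm (?P x) powr p)"
      unfolding set_integrable_def by (subst integrable_restrict_space) auto
    then have "integrable (lebesgue_on (tile b)) (\<lambda>x. inverse (\<bar>det b\<bar> powr p) * (norm (?P x) powr p))"
      by (rule integrable_mult_right)
    moreover have "inverse (\<bar>det b\<bar> powr p) * (norm (?P x) powr p) = norm (lattice_sum b \<psi> x) powr p" for x
      using det by (simp add: P_eq abs_mult powr_mult)
    ultimately have "integrable (lebesgue_on (tile b)) (\<lambda>x. norm (lattice_sum b \<psi> x) powr p)"
      by (simp only:)
    with measurable_restrict_space1[OF borel_measurable_lattice_sum[OF \<psi>m]] show ?thesis
      unfolding in_Lp_def by (rule conjI)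
  qed
  interpret affine_synthesis a b \<psi> p
    using assms \<psi>m loc by unfold_locales (auto simp: periodization_converges_def)
  \<comment> \<open>The factor |det b| of the periodization cancels the one in the explicit lower
    constant, which is therefore \<open>inverse W\<close>.\<close>
  have "Lp_norm p (lebesgue_on (tile b)) ?P = \<bar>det b\<bar> * W"
    using p by (simp add: W_def P_eq Lp_norm_def abs_mult powr_mult powr_powr)
  then have A: "\<bar>det b\<bar> * inverse (Lp_norm p (lebesgue_on ((\<lambda>x. b *v x) ` unit_cube)) ?P) = inverse W"
    using det by (simp add: tile_def[symmetric])
  have B: "\<bar>det b\<bar> powr enn2real (1 / q) = D"
    by (simp add: conjugate_exponent[OF p q] D_def)
  have both: "ennreal (inverse W * Lp_norm p lebesgue f) \<le> synthesis_norm p a b \<psi> f \<and>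
      synthesis_norm p a b \<psi> f \<le> ennreal (D * Lp_norm p lebesgue f)" if "in_Lp p lebesgue f" for f
    using synthesis_norm_lower[OF that] synthesis_norm_upper[OF that] ..
  have "0 < inverse W" using W_pos by simp
  with D_pos both show ?thesis unfolding A B by blast
qed

end
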